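(* Let $G$ be a group with a subgroup $H$ such that $\mathrm{Comm}_G(H)=G$ and $\mathbb ZH$ is a prime Goldie ring. Then the set $\Lambda$ of non-zero divisors in $\mathbb ZH$ is a right Ore set in $\mathbb ZG$. Moreover, if $H$ is non-trivial, then the localization $R:=\mathbb ZG\Lambda^{-1}$ is an overring of $\mathbb ZG$ which is flat as a left $\mathbb ZG$-module and satisfies $\mathbb Z\otimes_{\mathbb ZG}R=0$.
   Context: Two subgroups $H$ and $K$ of a group $G$ are commensurable if $H\cap K$ has finite index in both $H$ and $K$. $\mathrm{Comm}_G(H)$ denotes the set (a subgroup of $G$) $\{g\in G : H \text{ and } H^g \text{ are commensurable}\}$, where $H^g=g^{-1}Hg$. A non-zero divisor of a ring is an element that is neither a left nor a right zero divisor. A multiplicatively closed subset $\Lambda$ of a ring $A$, consisting of non-zero divisors of $A$, is a right Ore set in $A$ if for all $r\in A$ and $\lambda\in\Lambda$ there exist $\mu\in\Lambda$ and $s\in A$ with $r\mu=\lambda s$; $A\Lambda^{-1}$ then denotes the right Ore localization, which contains $A$. In $\mathbb Z\otimes_{\mathbb ZG}R$, $\mathbb Z$ is the trivial right $\mathbb ZG$-module. *)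

theory Defs
  imports "HOL-Algebra.Free_Abelian_Groups" "HOL-Algebra.Ideal_Product" "HOL-Algebra.Module"
begin

section \<open>Commensurators\<close>

definition commensurable :: "('g, 'b) monoid_scheme \<Rightarrow> 'g set \<Rightarrow> 'g set \<Rightarrow> bool" where
  "commensurable G H K \<longleftrightarrow>
     finite (rcosets\<^bsub>G\<lparr>carrier := H\<rparr>\<^esub> (H \<inter> K)) \<and> finite (rcosets\<^bsub>G\<lparr>carrier := K\<rparr>\<^esub> (H \<inter> K))"

definition conjugate_by :: "('g, 'b) monoid_scheme \<Rightarrow> 'g set \<Rightarrow> 'g \<Rightarrow> 'g set" where
  "conjugate_by G H g = (\<lambda>h. inv\<^bsub>G\<^esub> g \<otimes>\<^bsub>G\<^esub> h \<otimes>\<^bsub>G\<^esub> g) ` H"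

definition commensurator :: "('g, 'b) monoid_scheme \<Rightarrow> 'g set \<Rightarrow> 'g set" where
  "commensurator G H = {g \<in> carrier G. commensurable G H (conjugate_by G H g)}"


section \<open>Integral group rings\<close>

text \<open>Elements are the finitely supported integer-valued functions with support in
  \<^term>\<open>carrier G\<close>. Applied to \<^term>\<open>G\<lparr>carrier := H\<rparr>\<close> for a subgroup \<open>H\<close> of \<open>G\<close>, the
  definition gives the group ring of \<open>H\<close> literally as a subring of that of \<open>G\<close>.\<close>

definition group_ring :: "('g, 'b) monoid_scheme \<Rightarrow> ('g \<Rightarrow>\<^sub>0 int) ring" where
  "group_ring G =
     \<lparr>carrier = {x. Poly_Mapping.keys x \<subseteq> carrier G},
      monoid.mult = (\<lambda>x y. frag_extend (\<lambda>g. frag_extend (\<lambda>h. frag_of (g \<otimes>\<^bsub>G\<^esub> h)) y) x),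
      one = frag_of \<one>\<^bsub>G\<^esub>,
      zero = 0,
      add = (+)\<rparr>"


section \<open>Prime Goldie rings\<close>

definition prime_ring :: "('a, 'b) ring_scheme \<Rightarrow> bool" where
  "prime_ring A \<longleftrightarrow> ring A \<and> carrier A \<noteq> {\<zero>\<^bsub>A\<^esub>} \<and>
     (\<forall>I J. ideal I A \<and> ideal J A \<and> I \<cdot>\<^bsub>A\<^esub> J = {\<zero>\<^bsub>A\<^esub>} \<longrightarrow> I = {\<zero>\<^bsub>A\<^esub>} \<or> J = {\<zero>\<^bsub>A\<^esub>})"

definition opposite_ring :: "('a, 'b) ring_scheme \<Rightarrow> ('a, 'b) ring_scheme" where
  "opposite_ring A = A\<lparr>monoid.mult := \<lambda>x y. y \<otimes>\<^bsub>A\<^esub> x\<rparr>"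

definition right_ideal :: "'a set \<Rightarrow> ('a, 'b) ring_scheme \<Rightarrow> bool" where
  "right_ideal I A \<longleftrightarrow> additive_subgroup I A \<and> (\<forall>x\<in>I. \<forall>a\<in>carrier A. x \<otimes>\<^bsub>A\<^esub> a \<in> I)"

definition right_annihilator :: "('a, 'b) ring_scheme \<Rightarrow> 'a set \<Rightarrow> 'a set" where
  "right_annihilator A S = {x \<in> carrier A. \<forall>s\<in>S. s \<otimes>\<^bsub>A\<^esub> x = \<zero>\<^bsub>A\<^esub>}"

definition acc_right_annihilators :: "('a, 'b) ring_scheme \<Rightarrow> bool" where
  "acc_right_annihilators A \<longleftrightarrow>
     (\<forall>I :: nat \<Rightarrow> 'a set.
        (\<forall>n. \<exists>S \<subseteq> carrier A. I n = right_annihilator A S) \<and> (\<forall>n. I n \<subseteq> I (Suc n))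
        \<longrightarrow> (\<exists>N. \<forall>n\<ge>N. I n = I N))"

definition independent_family :: "('a, 'b) ring_scheme \<Rightarrow> ('i \<Rightarrow> 'a set) \<Rightarrow> bool" where
  "independent_family A I \<longleftrightarrow>
     (\<forall>F x. finite F \<and> x \<in> (\<Pi> i\<in>F. I i) \<and> finsum A x F = \<zero>\<^bsub>A\<^esub> \<longrightarrow> (\<forall>i\<in>F. x i = \<zero>\<^bsub>A\<^esub>))"

text \<open>Finite uniform dimension as a right module: there is no infinite direct sum of non-zero
  right ideals. It suffices to consider countably infinite families.\<close>

definition finite_right_uniform_dimension :: "('a, 'b) ring_scheme \<Rightarrow> bool" where
  "finite_right_uniform_dimension A \<longleftrightarrow>
     \<not> (\<exists>I :: nat \<Rightarrow> 'a set.
          (\<forall>n. right_ideal (I n) A \<and> I n \<noteq> {\<zero>\<^bsub>A\<^esub>}) \<and> independent_family A I)"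

definition right_Goldie :: "('a, 'b) ring_scheme \<Rightarrow> bool" where
  "right_Goldie A \<longleftrightarrow> ring A \<and> finite_right_uniform_dimension A \<and> acc_right_annihilators A"

definition Goldie_ring :: "('a, 'b) ring_scheme \<Rightarrow> bool" where
  "Goldie_ring A \<longleftrightarrow> right_Goldie A \<and> right_Goldie (opposite_ring A)"


section \<open>Ore sets and Ore localization\<close>

definition nonzerodivisors :: "('a, 'b) ring_scheme \<Rightarrow> 'a set" where
  "nonzerodivisors A =
     {x \<in> carrier A. \<forall>y\<in>carrier A. (x \<otimes>\<^bsub>A\<^esub> y = \<zero>\<^bsub>A\<^esub> \<longrightarrow> y = \<zero>\<^bsub>A\<^esub>) \<and> (y \<otimes>\<^bsub>A\<^esub> x = \<zero>\<^bsub>A\<^esub> \<longrightarrow> y = \<zero>\<^bsub>A\<^esub>)}"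

definition right_Ore_set :: "'a set \<Rightarrow> ('a, 'b) ring_scheme \<Rightarrow> bool" where
  "right_Ore_set \<Lambda> A \<longleftrightarrow>
     submonoid \<Lambda> A \<and> \<Lambda> \<subseteq> nonzerodivisors A \<and>
     (\<forall>r\<in>carrier A. \<forall>l\<in>\<Lambda>. \<exists>m\<in>\<Lambda>. \<exists>s\<in>carrier A. r \<otimes>\<^bsub>A\<^esub> m = l \<otimes>\<^bsub>A\<^esub> s)"

text \<open>The ring \<open>R\<close>, together with the map \<open>\<phi>\<close> from \<open>A\<close>, is the right Ore localization of \<open>A\<close>
  at \<open>\<Lambda>\<close>. These properties determine \<open>(R, \<phi>)\<close> up to unique isomorphism under \<open>A\<close>. The last one
  is the usual description of the kernel for arbitrary \<open>\<Lambda>\<close>; injectivity of \<open>\<phi>\<close> when \<open>\<Lambda>\<close>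
  consists of non-zero divisors is thus a consequence rather than part of the definition.\<close>

definition right_Ore_localization ::
  "('a, 'b) ring_scheme \<Rightarrow> 'a set \<Rightarrow> ('r, 'c) ring_scheme \<Rightarrow> ('a \<Rightarrow> 'r) \<Rightarrow> bool" where
  "right_Ore_localization A \<Lambda> R \<phi> \<longleftrightarrow>
     ring R \<and> \<phi> \<in> ring_hom A R \<and>
     (\<forall>l\<in>\<Lambda>. \<phi> l \<in> Units R) \<and>
     (\<forall>r\<in>carrier R. \<exists>a\<in>carrier A. \<exists>l\<in>\<Lambda>. r = \<phi> a \<otimes>\<^bsub>R\<^esub> inv\<^bsub>R\<^esub> (\<phi> l)) \<and>
     {a \<in> carrier A. \<phi> a = \<zero>\<^bsub>R\<^esub>} = {a \<in> carrier A. \<exists>l\<in>\<Lambda>. a \<otimes>\<^bsub>A\<^esub> l = \<zero>\<^bsub>A\<^esub>}"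


section \<open>Modules, tensor products and flatness over noncommutative rings\<close>

text \<open>The library locale \<^locale>\<open>module\<close> is restricted to commutative rings, so only its record
  type is used. For a right module \<open>N\<close>, the term \<open>a \<odot>\<^bsub>N\<^esub> n\<close> stands for the right action
  \<open>n \<cdot> a\<close>; hence the reversed order in \<open>smult_assoc\<close> below.\<close>

locale left_module = R?: ring A + M?: abelian_group M
  for A :: "('a, 'b) ring_scheme" (structure) and M :: "('a, 'm, 'c) module_scheme" (structure) +
  assumes smult_closed: "\<lbrakk>a \<in> carrier A; x \<in> carrier M\<rbrakk> \<Longrightarrow> a \<odot>\<^bsub>M\<^esub> x \<in> carrier M"
    and smult_l_distr: "\<lbrakk>a \<in> carrier A; b \<in> carrier A; x \<in> carrier M\<rbrakk>
      \<Longrightarrow> (a \<oplus>\<^bsub>A\<^esub> b) \<odot>\<^bsub>M\<^esub> x = a \<odot>\<^bsub>M\<^esub> x \<oplus>\<^bsub>M\<^esub> b \<odot>\<^bsub>M\<^esub> x"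
    and smult_r_distr: "\<lbrakk>a \<in> carrier A; x \<in> carrier M; y \<in> carrier M\<rbrakk>
      \<Longrightarrow> a \<odot>\<^bsub>M\<^esub> (x \<oplus>\<^bsub>M\<^esub> y) = a \<odot>\<^bsub>M\<^esub> x \<oplus>\<^bsub>M\<^esub> a \<odot>\<^bsub>M\<^esub> y"
    and smult_assoc: "\<lbrakk>a \<in> carrier A; b \<in> carrier A; x \<in> carrier M\<rbrakk>
      \<Longrightarrow> (a \<otimes>\<^bsub>A\<^esub> b) \<odot>\<^bsub>M\<^esub> x = a \<odot>\<^bsub>M\<^esub> (b \<odot>\<^bsub>M\<^esub> x)"
    and smult_one: "x \<in> carrier M \<Longrightarrow> \<one>\<^bsub>A\<^esub> \<odot>\<^bsub>M\<^esub> x = x"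

locale right_module = R?: ring A + N?: abelian_group N
  for A :: "('a, 'b) ring_scheme" (structure) and N :: "('a, 'n, 'c) module_scheme" (structure) +
  assumes smult_closed: "\<lbrakk>a \<in> carrier A; x \<in> carrier N\<rbrakk> \<Longrightarrow> a \<odot>\<^bsub>N\<^esub> x \<in> carrier N"
    and smult_l_distr: "\<lbrakk>a \<in> carrier A; b \<in> carrier A; x \<in> carrier N\<rbrakk>
      \<Longrightarrow> (a \<oplus>\<^bsub>A\<^esub> b) \<odot>\<^bsub>N\<^esub> x = a \<odot>\<^bsub>N\<^esub> x \<oplus>\<^bsub>N\<^esub> b \<odot>\<^bsub>N\<^esub> x"
    and smult_r_distr: "\<lbrakk>a \<in> carrier A; x \<in> carrier N; y \<in> carrier N\<rbrakk>
      \<Longrightarrow> a \<odot>\<^bsub>N\<^esub> (x \<oplus>\<^bsub>N\<^esub> y) = a \<odot>\<^bsub>N\<^esub> x \<oplus>\<^bsub>N\<^esub> a \<odot>\<^bsub>N\<^esub> y"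
    and smult_assoc: "\<lbrakk>a \<in> carrier A; b \<in> carrier A; x \<in> carrier N\<rbrakk>
      \<Longrightarrow> (a \<otimes>\<^bsub>A\<^esub> b) \<odot>\<^bsub>N\<^esub> x = b \<odot>\<^bsub>N\<^esub> (a \<odot>\<^bsub>N\<^esub> x)"
    and smult_one: "x \<in> carrier N \<Longrightarrow> \<one>\<^bsub>A\<^esub> \<odot>\<^bsub>N\<^esub> x = x"

definition right_module_hom ::
  "('a, 'b) ring_scheme \<Rightarrow> ('a, 'p, 'c) module_scheme \<Rightarrow> ('a, 'q, 'd) module_scheme \<Rightarrow> ('p \<Rightarrow> 'q) set"
where
  "right_module_hom A P Q =
     {f \<in> carrier P \<rightarrow> carrier Q.
        (\<forall>x\<in>carrier P. \<forall>y\<in>carrier P. f (x \<oplus>\<^bsub>P\<^esub> y) = f x \<oplus>\<^bsub>Q\<^esub> f y) \<and>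
        (\<forall>a\<in>carrier A. \<forall>x\<in>carrier P. f (a \<odot>\<^bsub>P\<^esub> x) = a \<odot>\<^bsub>Q\<^esub> f x)}"

text \<open>The subgroup of the free Abelian group on \<open>N \<times> M\<close> that is factored out to form the tensor
  product of the right module \<open>N\<close> and the left module \<open>M\<close>.\<close>

definition tensor_relations ::
  "('a, 'b) ring_scheme \<Rightarrow> ('a, 'n, 'c) module_scheme \<Rightarrow> ('a, 'm, 'd) module_scheme
     \<Rightarrow> ('n \<times> 'm \<Rightarrow>\<^sub>0 int) set"
where
  "tensor_relations A N M = generate (free_Abelian_group (carrier N \<times> carrier M))
     ({frag_of (x \<oplus>\<^bsub>N\<^esub> y, u) - frag_of (x, u) - frag_of (y, u) | x y u.
         x \<in> carrier N \<and> y \<in> carrier N \<and> u \<in> carrier M}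
      \<union> {frag_of (x, u \<oplus>\<^bsub>M\<^esub> v) - frag_of (x, u) - frag_of (x, v) | x u v.
         x \<in> carrier N \<and> u \<in> carrier M \<and> v \<in> carrier M}
      \<union> {frag_of (a \<odot>\<^bsub>N\<^esub> x, u) - frag_of (x, a \<odot>\<^bsub>M\<^esub> u) | a x u.
         a \<in> carrier A \<and> x \<in> carrier N \<and> u \<in> carrier M})"

definition tensor_product ::
  "('a, 'b) ring_scheme \<Rightarrow> ('a, 'n, 'c) module_scheme \<Rightarrow> ('a, 'm, 'd) module_scheme
     \<Rightarrow> ('n \<times> 'm \<Rightarrow>\<^sub>0 int) set monoid"
where
  "tensor_product A N M =
     free_Abelian_group (carrier N \<times> carrier M) Mod tensor_relations A N M"

text \<open>The map \<open>f \<otimes> id\<^sub>M\<close> from \<open>P \<otimes>\<^sub>A M\<close> to \<open>Q \<otimes>\<^sub>A M\<close> induced by \<open>f : P \<rightarrow> Q\<close>.\<close>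

definition tensor_map ::
  "('a, 'b) ring_scheme \<Rightarrow> ('a, 'q, 'd) module_scheme \<Rightarrow> ('a, 'm, 'e) module_scheme \<Rightarrow> ('p \<Rightarrow> 'q)
     \<Rightarrow> ('p \<times> 'm \<Rightarrow>\<^sub>0 int) set \<Rightarrow> ('q \<times> 'm \<Rightarrow>\<^sub>0 int) set"
where
  "tensor_map A Q M f X =
     the_elem ((\<lambda>c. tensor_relations A Q M #>\<^bsub>free_Abelian_group (carrier Q \<times> carrier M)\<^esub>
                      frag_extend (\<lambda>(x, u). frag_of (f x, u)) c) ` X)"

text \<open>Flatness of the left module \<open>M\<close>: tensoring with \<open>M\<close> preserves injectivity. Since one cannot
  quantify over types, the element types of the two right modules are parameters; flatness is
  the assertion for all types \<open>'p\<close> and \<open>'q\<close>.\<close>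

definition flat_left_module ::
  "'p itself \<Rightarrow> 'q itself \<Rightarrow> ('a, 'b) ring_scheme \<Rightarrow> ('a, 'm, 'c) module_scheme \<Rightarrow> bool"
where
  "flat_left_module TYPE('p) TYPE('q) A M \<longleftrightarrow> left_module A M \<and>
     (\<forall>(P :: ('a, 'p) module) (Q :: ('a, 'q) module) f.
        right_module A P \<and> right_module A Q \<and> f \<in> right_module_hom A P Q \<and> inj_on f (carrier P)
        \<longrightarrow> inj_on (tensor_map A Q M f) (carrier (tensor_product A P M)))"

text \<open>The target of a ring homomorphism \<open>\<phi>\<close> as a left module over its source.\<close>

definition left_module_via :: "('a \<Rightarrow> 'r) \<Rightarrow> ('r, 'c) ring_scheme \<Rightarrow> ('a, 'r) module" where
  "left_module_via \<phi> R =
     \<lparr>carrier = carrier R, monoid.mult = mult R, one = \<one>\<^bsub>R\<^esub>, zero = \<zero>\<^bsub>R\<^esub>, add = add R,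
      smult = (\<lambda>a r. \<phi> a \<otimes>\<^bsub>R\<^esub> r)\<rparr>"

text \<open>The integers as the trivial right module over an integral group ring: every group element
  acts as the identity. The multiplicative part of the record is irrelevant.\<close>

definition trivial_module :: "('g \<Rightarrow>\<^sub>0 int, int) module" where
  "trivial_module =
     \<lparr>carrier = UNIV, monoid.mult = (*), one = 1, zero = 0, add = (+),
      smult = (\<lambda>x n. n * (\<Sum>g\<in>Poly_Mapping.keys x. Poly_Mapping.lookup x g))\<rparr>"

end

theory Submission
  imports Defs
begin

text \<open>The trace form makes \<open>x \<mapsto> x\<^sup>*\<close>, \<open>g\<^sup>* = g\<^sup>-\<^sup>1\<close>, a positive involution of an integral group ring:
  \<open>\<Sum> x\<^sub>i x\<^sub>i\<^sup>* = 0\<close> forces all \<open>x\<^sub>i = 0\<close>. Hence the left annihilator of \<open>\<Sum> x\<^sub>i x\<^sub>i\<^sup>*\<close> is that of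
  the set of all \<open>x\<^sub>i\<close>, and by the chain condition a right ideal of \<open>\<int>H\<close> contains a non-zero divisor
  as soon as its left annihilator vanishes. This holds for essential right ideals, and, by
  primeness, for the augmentation ideal if \<open>H\<close> is non-trivial.

  For the Ore condition it thus suffices that \<open>{x \<in> \<int>H. r x \<in> l \<int>G}\<close> is essential. As \<open>H\<close> is
  commensurated, every element of \<open>\<int>G\<close> is supported in a finite union \<open>D\<close> of left cosets of \<open>H\<close>
  with \<open>H D = D\<close>. The elements supported in \<open>D\<close> form a right \<open>\<int>H\<close>-module of finite uniform
  dimension on which \<open>l\<close> acts injectively, so that the image of \<open>l\<close> is essential: if \<open>v \<int>H\<close> did not
  meet it, the submodules generated by \<open>v, l v, l\<^sup>2 v, \<dots>\<close> would be independent.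

  Every element of a tensor product with the localization \<open>R\<close> has the form \<open>x \<otimes> s\<^sup>-\<^sup>1\<close>, and it
  vanishes if and only if \<open>x t = 0\<close> for some \<open>t \<in> \<Lambda>\<close>, a condition that does not depend on the module
  containing \<open>x\<close>. This gives flatness, and \<open>\<int> \<otimes> R = 0\<close> because \<open>\<Lambda>\<close> contains an element of
  augmentation zero.\<close>

section \<open>Integral group rings and their involution\<close>

context group
begin

abbreviation group_ring_mult (infixl "\<star>" 70)
  where "x \<star> y \<equiv> x \<otimes>\<^bsub>group_ring G\<^esub> y"

lemma group_ring_simps [simp]:
  "x \<in> carrier (group_ring G) \<longleftrightarrow> Poly_Mapping.keys x \<subseteq> carrier G"
  "\<one>\<^bsub>group_ring G\<^esub> = frag_of \<one>"
  "\<zero>\<^bsub>group_ring G\<^esub> = 0"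
  "x \<oplus>\<^bsub>group_ring G\<^esub> y = x + y"
  by (simp_all add: group_ring_def)

text \<open>The product formula of \<open>group_ring\<close> never consults the carrier, so the last
  equation lets every computation in ZH use the product of ZG.\<close>

lemma group_ring_restrict_simps [simp]:
  "x \<in> carrier (group_ring (G\<lparr>carrier := H\<rparr>)) \<longleftrightarrow> Poly_Mapping.keys x \<subseteq> H"
  "\<one>\<^bsub>group_ring (G\<lparr>carrier := H\<rparr>)\<^esub> = frag_of \<one>"
  "\<zero>\<^bsub>group_ring (G\<lparr>carrier := H\<rparr>)\<^esub> = 0"
  "x \<oplus>\<^bsub>group_ring (G\<lparr>carrier := H\<rparr>)\<^esub> y = x + y"
  "x \<otimes>\<^bsub>group_ring (G\<lparr>carrier := H\<rparr>)\<^esub> y = x \<star> y"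
  by (simp_all add: group_ring_def)

lemma frag_of_mult [simp]: "frag_of g \<star> frag_of h = frag_of (g \<otimes> h)"
  by (simp add: group_ring_def)

lemma group_ring_zero_left [simp]: "0 \<star> y = 0"
  by (simp add: group_ring_def)

lemma group_ring_add_left: "(x + x') \<star> y = x \<star> y + x' \<star> y"
  by (simp add: group_ring_def frag_extend_add)

lemma group_ring_minus_left: "(- x) \<star> y = - (x \<star> y)"
  by (simp add: group_ring_def frag_extend_minus)

lemma group_ring_diff_left: "(x - x') \<star> y = x \<star> y - x' \<star> y"
  by (simp add: group_ring_def frag_extend_diff)

lemma group_ring_sum_left: "(\<Sum>i\<in>I. f i) \<star> y = (\<Sum>i\<in>I. f i \<star> y)"
  by (induction I rule: infinite_finite_induct) (simp_all add: group_ring_add_left)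

text \<open>On the left, additivity is that of the outer \<open>frag_extend\<close>. On the right it
  needs induction on the left factor, where a single group element leaves only the inner
  \<open>frag_extend\<close>. Differences come first because \<open>frag_induction\<close> builds
  elements by subtraction.\<close>

lemma group_ring_diff_right: "x \<star> (y - y') = x \<star> y - x \<star> y'"
  using subset_UNIV[of "Poly_Mapping.keys x"]
  by (induction x rule: frag_induction)
     (simp_all add: group_ring_diff_left, simp add: group_ring_def frag_extend_diff)

lemma group_ring_zero_right [simp]: "x \<star> 0 = 0"
  using group_ring_diff_right[of x 0 0] by simp

lemma group_ring_minus_right: "x \<star> (- y) = - (x \<star> y)"
  using group_ring_diff_right[of x 0 y] by simp

lemma group_ring_add_right: "x \<star> (y + y') = x \<star> y + x \<star> y'"
  using group_ring_diff_right[of x y "- y'"] by (simp add: group_ring_minus_right)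

lemma group_ring_sum_right: "x \<star> (\<Sum>i\<in>I. f i) = (\<Sum>i\<in>I. x \<star> f i)"
  by (induction I rule: infinite_finite_induct) (simp_all add: group_ring_add_right)

text \<open>The three sets are kept free because the bound is applied to cosets and to sets stable
  under left multiplication by \<open>H\<close>, besides subgroups.\<close>

lemma keys_mult_subset:
  assumes "Poly_Mapping.keys x \<subseteq> S" "Poly_Mapping.keys y \<subseteq> T"
    and "\<And>g h. g \<in> S \<Longrightarrow> h \<in> T \<Longrightarrow> g \<otimes> h \<in> U"
  shows "Poly_Mapping.keys (x \<star> y) \<subseteq> U"
proof -
  have "Poly_Mapping.keys (x \<star> y) \<subseteq>
    (\<Union>g\<in>Poly_Mapping.keys x. \<Union>h\<in>Poly_Mapping.keys y. Poly_Mapping.keys (frag_of (g \<otimes> h)))"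
    unfolding group_ring_def
    by simp (intro order.trans[OF keys_frag_extend] UN_mono order.refl
        order.trans[OF keys_frag_extend], simp)
  also have "\<dots> \<subseteq> U"
    using assms by auto
  finally show ?thesis .
qed

lemma keys_diff_subset:
  fixes x y :: "'x \<Rightarrow>\<^sub>0 int"
  assumes "Poly_Mapping.keys x \<subseteq> S" "Poly_Mapping.keys y \<subseteq> S"
  shows "Poly_Mapping.keys (x - y) \<subseteq> S"
  using assms keys_diff[of x y] by blast

lemma keys_add_subset:
  fixes x y :: "'x \<Rightarrow>\<^sub>0 int"
  assumes "Poly_Mapping.keys x \<subseteq> S" "Poly_Mapping.keys y \<subseteq> S"
  shows "Poly_Mapping.keys (x + y) \<subseteq> S"
  using assms keys_add[of x y] by blast

lemma keys_sum_subset: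
  fixes f :: "'i \<Rightarrow> 'x \<Rightarrow>\<^sub>0 int"
  assumes "\<And>i. i \<in> I \<Longrightarrow> Poly_Mapping.keys (f i) \<subseteq> S"
  shows "Poly_Mapping.keys (sum f I) \<subseteq> S"
  using assms keys_sum[of f I] by blast

lemma keys_mult_closed:
  assumes "subgroup H G" "Poly_Mapping.keys x \<subseteq> H" "Poly_Mapping.keys y \<subseteq> H"
  shows "Poly_Mapping.keys (x \<star> y) \<subseteq> H"
  using assms(2,3) by (rule keys_mult_subset) (rule subgroup.m_closed[OF assms(1)])

lemma keys_mult_carrier:
  assumes "Poly_Mapping.keys x \<subseteq> carrier G" "Poly_Mapping.keys y \<subseteq> carrier G"
  shows "Poly_Mapping.keys (x \<star> y) \<subseteq> carrier G"
  using assms by (intro keys_mult_subset) auto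

lemma group_ring_assoc:
  assumes "Poly_Mapping.keys x \<subseteq> carrier G" "Poly_Mapping.keys y \<subseteq> carrier G"
    "Poly_Mapping.keys z \<subseteq> carrier G"
  shows "x \<star> y \<star> z = x \<star> (y \<star> z)"
  using assms(1)
proof (induction x rule: frag_induction)
  case (one g)
  note g = one
  show ?case
    using assms(2)
  proof (induction y rule: frag_induction)
    case (one h)
    note h = one
    show ?case
      using assms(3)
    proof (induction z rule: frag_induction)
      case (one k)
      then show ?case using g h by (simp add: m_assoc)
    qed (simp_all add: group_ring_diff_right)
  qed (simp_all add: group_ring_diff_right group_ring_diff_left)
qed (simp_all add: group_ring_diff_left)

lemma group_ring_one_left:
  assumes "Poly_Mapping.keys x \<subseteq> carrier G"
  shows "frag_of \<one> \<star> x = x"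
  using assms by (induction x rule: frag_induction) (simp_all add: group_ring_diff_right)

lemma group_ring_one_right:
  assumes "Poly_Mapping.keys x \<subseteq> carrier G"
  shows "x \<star> frag_of \<one> = x"
  using assms by (induction x rule: frag_induction) (simp_all add: group_ring_diff_left)

lemma ring_group_ring: "ring (group_ring G)"
proof (intro ringI abelian_groupI monoidI; (simp add: keys_mult_carrier keys_add_subset
      group_ring_assoc group_ring_one_left group_ring_one_right group_ring_add_left group_ring_add_right)?)
  fix x :: "'a \<Rightarrow>\<^sub>0 int"
  assume "Poly_Mapping.keys x \<subseteq> carrier G"
  then show "\<exists>y\<in>carrier (group_ring G). y + x = 0"
    by (intro bexI[of _ "- x"]) simp_all
qed

lemma finsum_group_ring:
  assumes "finite I" "\<And>i. i \<in> I \<Longrightarrow> Poly_Mapping.keys (f i) \<subseteq> carrier G"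
  shows "finsum (group_ring G) f I = sum f I"
proof -
  interpret ring "group_ring G" by (rule ring_group_ring)
  show ?thesis
    using assms by (induction I rule: finite_induct) (simp_all add: Pi_iff)
qed

section \<open>The involution and the trace form\<close>

definition star :: "('a \<Rightarrow>\<^sub>0 int) \<Rightarrow> ('a \<Rightarrow>\<^sub>0 int)"
  where "star = frag_extend (\<lambda>g. frag_of (inv g))"

lemma star_zero [simp]: "star 0 = 0"
  by (simp add: star_def)

lemma star_diff: "star (x - y) = star x - star y"
  by (simp add: star_def frag_extend_diff)

lemma star_sum: "star (\<Sum>i\<in>I. f i) = (\<Sum>i\<in>I. star (f i))"
  by (induction I rule: infinite_finite_induct) (simp_all add: star_def frag_extend_add)

lemma star_frag_of [simp]: "star (frag_of g) = frag_of (inv g)"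
  by (simp add: star_def)

lemma keys_star:
  assumes "subgroup H G" "Poly_Mapping.keys x \<subseteq> H"
  shows "Poly_Mapping.keys (star x) \<subseteq> H"
proof -
  have "Poly_Mapping.keys (star x) \<subseteq> (\<Union>g\<in>Poly_Mapping.keys x. Poly_Mapping.keys (frag_of (inv g)))"
    unfolding star_def by (rule keys_frag_extend)
  also have "\<dots> \<subseteq> H"
    using assms(2) subgroup.m_inv_closed[OF assms(1)] by auto
  finally show ?thesis .
qed

lemma keys_star_carrier:
  "Poly_Mapping.keys x \<subseteq> carrier G \<Longrightarrow> Poly_Mapping.keys (star x) \<subseteq> carrier G"
  by (rule keys_star[OF subgroup_self])

lemma star_star:
  assumes "Poly_Mapping.keys x \<subseteq> carrier G"
  shows "star (star x) = x"
  using assms by (induction x rule: frag_induction) (simp_all add: star_diff)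

lemma star_mult:
  assumes "Poly_Mapping.keys x \<subseteq> carrier G" "Poly_Mapping.keys y \<subseteq> carrier G"
  shows "star (x \<star> y) = star y \<star> star x"
  using assms(1)
proof (induction x rule: frag_induction)
  case (one g)
  note g = one
  show ?case
    using assms(2)
  proof (induction y rule: frag_induction)
    case (one h)
    then show ?case using g by (simp add: inv_mult_group)
  qed (simp_all add: group_ring_diff_right star_diff group_ring_diff_left)
qed (simp_all add: group_ring_diff_left star_diff group_ring_diff_right)

text \<open>A pair of group elements g, h contributes to the coefficient at the identity only if g
  times the inverse of h is the identity, that is, if g = h.\<close>

lemma lookup_mult_star_one:
  assumes x: "Poly_Mapping.keys x \<subseteq> carrier G" and y: "Poly_Mapping.keys y \<subseteq> carrier G"
  shows "Poly_Mapping.lookup (x \<star> star y) \<one> =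
    (\<Sum>g\<in>Poly_Mapping.keys x. Poly_Mapping.lookup x g * Poly_Mapping.lookup y g)"
proof -
  have *: "Poly_Mapping.lookup (frag_extend (\<lambda>h. frag_of (g \<otimes> h)) (star y)) \<one> = Poly_Mapping.lookup y g"
    if g: "g \<in> carrier G" for g
    using y
  proof (induction y rule: frag_induction)
    case (one h)
    then have "g \<otimes> inv h = \<one> \<longleftrightarrow> h = g"
      using g by (metis inv_closed inv_equality inv_inv r_inv)
    then show ?case by (auto simp: lookup_single when_def simp del: r_inv)
  qed (simp_all add: star_diff frag_extend_diff lookup_minus)
  have "x \<star> star y = (\<Sum>g\<in>Poly_Mapping.keys x.
      frag_cmul (Poly_Mapping.lookup x g) (frag_extend (\<lambda>h. frag_of (g \<otimes> h)) (star y)))"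
    by (simp add: group_ring_def frag_extend_def[of _ x])
  then show ?thesis
    using * x by (auto simp: lookup_sum intro!: sum.cong)
qed

lemma mult_star_self_eq_0_iff:
  assumes "Poly_Mapping.keys x \<subseteq> carrier G"
  shows "x \<star> star x = 0 \<longleftrightarrow> x = 0"
proof
  assume "x \<star> star x = 0"
  then have "(\<Sum>g\<in>Poly_Mapping.keys x. Poly_Mapping.lookup x g * Poly_Mapping.lookup x g) = 0"
    using lookup_mult_star_one[OF assms assms] by simp
  then have "\<forall>g\<in>Poly_Mapping.keys x. Poly_Mapping.lookup x g * Poly_Mapping.lookup x g = 0"
    by (subst (asm) sum_nonneg_eq_0_iff) simp_all
  then show "x = 0"
    by (auto simp: poly_mapping_eq_iff fun_eq_iff in_keys_iff)
qed simp

text \<open>The coefficient at the identity of each summand is a sum of squares of integers, so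
  neither different group elements nor different indices can cancel.\<close>

lemma sum_mult_star_eq_0_iff:
  assumes "finite I" "\<And>i. i \<in> I \<Longrightarrow> Poly_Mapping.keys (f i) \<subseteq> carrier G"
  shows "(\<Sum>i\<in>I. f i \<star> star (f i)) = 0 \<longleftrightarrow> (\<forall>i\<in>I. f i = 0)"
proof
  assume "(\<Sum>i\<in>I. f i \<star> star (f i)) = 0"
  then have "Poly_Mapping.lookup (\<Sum>i\<in>I. f i \<star> star (f i)) \<one> = 0"
    by simp
  then have *: "(\<Sum>i\<in>I. Poly_Mapping.lookup (f i \<star> star (f i)) \<one>) = 0"
    by (simp add: lookup_sum)
  have "\<forall>i\<in>I. Poly_Mapping.lookup (f i \<star> star (f i)) \<one> = 0"
    using * assms(1)
    by (subst (asm) sum_nonneg_eq_0_iff) (simp_all add: lookup_mult_star_one assms(2) sum_nonneg)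
  then have "\<forall>i\<in>I. \<forall>g\<in>Poly_Mapping.keys (f i). Poly_Mapping.lookup (f i) g * Poly_Mapping.lookup (f i) g = 0"
    by (auto simp: lookup_mult_star_one assms(2) sum_nonneg_eq_0_iff)
  then show "\<forall>i\<in>I. f i = 0"
    by (auto simp: poly_mapping_eq_iff fun_eq_iff in_keys_iff)
qed simp

section \<open>Projections that forget coefficients\<close>

definition restrict_support :: "'x set \<Rightarrow> ('x \<Rightarrow>\<^sub>0 int) \<Rightarrow> ('x \<Rightarrow>\<^sub>0 int)"
  where "restrict_support S = frag_extend (\<lambda>g. if g \<in> S then frag_of g else 0)"

lemma lookup_restrict_support:
  "Poly_Mapping.lookup (restrict_support S x) k = (if k \<in> S then Poly_Mapping.lookup x k else 0)"
  using subset_UNIV[of "Poly_Mapping.keys x"]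
  by (induction x rule: frag_induction)
     (auto simp: restrict_support_def frag_extend_diff lookup_minus lookup_single when_def)

lemma keys_restrict_support: "Poly_Mapping.keys (restrict_support S x) = Poly_Mapping.keys x \<inter> S"
  by (auto simp: in_keys_iff lookup_restrict_support split: if_splits)

lemma restrict_support_diff: "restrict_support S (x - y) = restrict_support S x - restrict_support S y"
  by (simp add: restrict_support_def frag_extend_diff)

lemma restrict_support_sum: "restrict_support S (\<Sum>i\<in>I. f i) = (\<Sum>i\<in>I. restrict_support S (f i))"
  by (induction I rule: infinite_finite_induct) (simp_all add: restrict_support_def frag_extend_add)

lemma restrict_support_zero [simp]: "restrict_support S 0 = 0"
  by (simp add: restrict_support_def)

lemma restrict_support_frag_of:
  "restrict_support S (frag_of g) = (if g \<in> S then frag_of g else 0)"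
  by (simp add: restrict_support_def)

text \<open>Right translation by elements of \<open>H\<close> neither enters nor leaves
  \<open>S\<close> within \<open>T\<close>, so the projection onto the coefficients in
  \<open>S\<close> is right ZH-linear.\<close>

lemma restrict_support_mult_right:
  assumes "Poly_Mapping.keys x \<subseteq> T" "Poly_Mapping.keys y \<subseteq> H"
    and "\<And>g h. g \<in> T \<Longrightarrow> h \<in> H \<Longrightarrow> g \<otimes> h \<in> S \<longleftrightarrow> g \<in> S"
  shows "restrict_support S (x \<star> y) = restrict_support S x \<star> y"
  using assms(1)
proof (induction x rule: frag_induction)
  case (one g)
  note g = one
  show ?case
    using assms(2)
  proof (induction y rule: frag_induction)
    case (one h)
    then show ?case using g assms(3) by (simp add: restrict_support_frag_of)
  qed (simp_all add: group_ring_diff_right restrict_support_diff)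
qed (simp_all add: group_ring_diff_left restrict_support_diff)

lemma restrict_support_mult_left:
  assumes "Poly_Mapping.keys x \<subseteq> H" "Poly_Mapping.keys y \<subseteq> T"
    and "\<And>h g. h \<in> H \<Longrightarrow> g \<in> T \<Longrightarrow> h \<otimes> g \<in> S \<longleftrightarrow> g \<in> S"
  shows "restrict_support S (x \<star> y) = x \<star> restrict_support S y"
  using assms(1)
proof (induction x rule: frag_induction)
  case (one h)
  note h = one
  show ?case
    using assms(2)
  proof (induction y rule: frag_induction)
    case (one g)
    then show ?case using h assms(3) by (simp add: restrict_support_frag_of)
  qed (simp_all add: group_ring_diff_right restrict_support_diff)
qed (simp_all add: group_ring_diff_left restrict_support_diff)

end

section \<open>Regular elements of the group ring of a subgroup\<close>

locale group_subgroup = group G for G (structure) +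
  fixes H :: "'a set"
  assumes subgroup_H: "subgroup H G"
begin

abbreviation group_ring_H :: "('a \<Rightarrow>\<^sub>0 int) ring" ("\<int>H")
  where "\<int>H \<equiv> group_ring (G\<lparr>carrier := H\<rparr>)"

abbreviation \<Lambda> :: "('a \<Rightarrow>\<^sub>0 int) set"
  where "\<Lambda> \<equiv> nonzerodivisors \<int>H"

lemma H_subset: "H \<subseteq> carrier G"
  by (rule subgroup.subset[OF subgroup_H])

lemma keys_H_carrier: "Poly_Mapping.keys x \<subseteq> H \<Longrightarrow> Poly_Mapping.keys x \<subseteq> carrier G"
  using H_subset by blast

lemmas H_mult_closed = keys_mult_closed[OF subgroup_H]
  and H_star_closed = keys_star[OF subgroup_H]

lemma ring_group_ring_H: "ring \<int>H"
  by (rule group.ring_group_ring[OF subgroup.subgroup_is_group[OF subgroup_H is_group]])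

lemma finsum_group_ring_H:
  assumes "finite I" "\<And>i. i \<in> I \<Longrightarrow> Poly_Mapping.keys (f i) \<subseteq> H"
  shows "finsum \<int>H f I = sum f I"
  using group.finsum_group_ring[OF subgroup.subgroup_is_group[OF subgroup_H is_group], of I f] assms
  by simp

lemma regular_keys: "l \<in> \<Lambda> \<Longrightarrow> Poly_Mapping.keys l \<subseteq> H"
  by (simp add: nonzerodivisors_def)

lemma regular_keys_carrier: "l \<in> \<Lambda> \<Longrightarrow> Poly_Mapping.keys l \<subseteq> carrier G"
  by (rule keys_H_carrier[OF regular_keys])

lemma mem_\<Lambda>_iff:
  "l \<in> \<Lambda> \<longleftrightarrow> Poly_Mapping.keys l \<subseteq> H \<and>
    (\<forall>y. Poly_Mapping.keys y \<subseteq> H \<longrightarrow> (l \<star> y = 0 \<longrightarrow> y = 0) \<and> (y \<star> l = 0 \<longrightarrow> y = 0))"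
  by (auto simp: nonzerodivisors_def)

lemma star_eq_0: "Poly_Mapping.keys x \<subseteq> carrier G \<Longrightarrow> star x = 0 \<longleftrightarrow> x = 0"
  by (metis star_star star_zero)

text \<open>The involution is anti-multiplicative: it exchanges left and right annihilation, and
  regularity is symmetric in the two sides.\<close>

lemma star_regular:
  assumes "l \<in> \<Lambda>"
  shows "star l \<in> \<Lambda>"
proof -
  have l: "Poly_Mapping.keys l \<subseteq> H" "Poly_Mapping.keys l \<subseteq> carrier G"
    using regular_keys[OF assms] keys_H_carrier by auto
  have "y = 0" if y: "Poly_Mapping.keys y \<subseteq> H" and "star l \<star> y = 0 \<or> y \<star> star l = 0" for y
  proof -
    have y': "Poly_Mapping.keys y \<subseteq> carrier G"
      using y by (rule keys_H_carrier)
    have "star (star l \<star> y) = star y \<star> l" "star (y \<star> star l) = l \<star> star y"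
      using l(2) y' by (simp_all add: star_mult keys_star_carrier star_star)
    then have "star y \<star> l = 0 \<or> l \<star> star y = 0"
      using that(2) by auto
    then show "y = 0"
      using assms H_star_closed[OF y] star_eq_0[OF y'] by (auto simp: mem_\<Lambda>_iff)
  qed
  then show ?thesis
    using H_star_closed[OF l(1)] by (auto simp: mem_\<Lambda>_iff)
qed

text \<open>As a left ZH-module, ZG is the direct sum of the free modules ZH g over the right cosets
  H g. Left multiplication by \<open>l\<close> respects this decomposition, and right translation by
  the inverse of g carries each component into ZH, where \<open>l\<close> is regular.\<close>

lemma regular_left_cancel:
  assumes l: "l \<in> \<Lambda>" and x: "Poly_Mapping.keys x \<subseteq> carrier G" and 0: "l \<star> x = 0"
  shows "x = 0"
proof (rule ccontr)
  assume "x \<noteq> 0"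
  then obtain g where g: "g \<in> Poly_Mapping.keys x"
    by (metis ex_in_conv keys_eq_empty)
  then have gG: "g \<in> carrier G" using x by blast
  \<comment> \<open>The component \<open>z\<close> of \<open>x\<close> on the coset of
    \<open>g\<close> is non-zero, as it keeps the coefficient at \<open>g\<close>; the contradiction
    will be that \<open>z\<close> vanishes.\<close>
  define S where "S = H #> g"
  define z where "z = restrict_support S x"
  have S: "h \<otimes> k \<in> S \<longleftrightarrow> k \<in> S" if h: "h \<in> H" and k: "k \<in> carrier G" for h k
  proof -
    have hG: "h \<in> carrier G" using h H_subset by blast
    have iff: "k' \<in> S \<longleftrightarrow> k' \<otimes> inv g \<in> H" if "k' \<in> carrier G" for k'
      unfolding S_def by (rule subgroup.rcos_module[OF subgroup_H is_group gG that])
    have "h \<otimes> k \<otimes> inv g = h \<otimes> (k \<otimes> inv g)"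
      using hG k gG by (simp add: m_assoc)
    moreover have "h \<otimes> (k \<otimes> inv g) \<in> H \<longleftrightarrow> k \<otimes> inv g \<in> H"
      using h k gG hG subgroup_H
      by (metis inv_closed inv_solve_left m_closed subgroup.m_closed subgroup.m_inv_closed)
    ultimately show ?thesis
      using iff[OF k] iff[of "h \<otimes> k"] hG k by simp
  qed
  have "l \<star> z = restrict_support S (l \<star> x)"
    unfolding z_def by (rule restrict_support_mult_left[OF regular_keys[OF l] x S, symmetric])
  then have lz: "l \<star> z = 0" using 0 by simp
  have zS: "Poly_Mapping.keys z \<subseteq> S" and zG: "Poly_Mapping.keys z \<subseteq> carrier G"
    using x by (auto simp: z_def keys_restrict_support)
  have "Poly_Mapping.keys (z \<star> frag_of (inv g)) \<subseteq> H"
  proof (rule keys_mult_subset[OF zS])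
    show "Poly_Mapping.keys (frag_of (inv g)) \<subseteq> {inv g}" by simp
  next
    fix a b assume "a \<in> S" "b \<in> {inv g}"
    then show "a \<otimes> b \<in> H"
      using gG H_subset by (auto simp: S_def r_coset_def m_assoc subset_iff)
  qed
  moreover have "l \<star> (z \<star> frag_of (inv g)) = 0"
    using group_ring_assoc[of l z "frag_of (inv g)"] lz zG gG regular_keys_carrier[OF l]
    by simp
  ultimately have "z \<star> frag_of (inv g) = 0"
    using l by (auto simp: mem_\<Lambda>_iff)
  then have "z \<star> (frag_of (inv g) \<star> frag_of g) = 0"
    using group_ring_assoc[of z "frag_of (inv g)" "frag_of g"] zG gG by simp
  then have "z = 0"
    using zG gG by (simp add: group_ring_one_right)
  moreover have "g \<in> Poly_Mapping.keys z"
    using g gG subgroup.one_closed[OF subgroup_H]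
    by (auto simp: z_def keys_restrict_support S_def r_coset_def intro!: bexI[of _ \<one>])
  ultimately show False by simp
qed

text \<open>The involution turns this into left cancellation by \<open>star l\<close>, which is
  regular as well.\<close>

lemma regular_right_cancel:
  assumes l: "l \<in> \<Lambda>" and x: "Poly_Mapping.keys x \<subseteq> carrier G" and 0: "x \<star> l = 0"
  shows "x = 0"
proof -
  have "star l \<star> star x = 0"
    using star_mult[OF x regular_keys_carrier[OF l]] 0 by simp
  then show ?thesis
    using regular_left_cancel[OF star_regular[OF l] keys_star_carrier[OF x]] star_eq_0[OF x] by simp
qed

lemma \<Lambda>_subset_nonzerodivisors: "\<Lambda> \<subseteq> nonzerodivisors (group_ring G)"
proof
  fix l assume "l \<in> \<Lambda>"
  then show "l \<in> nonzerodivisors (group_ring G)"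
    using regular_left_cancel regular_right_cancel regular_keys_carrier
    by (simp add: nonzerodivisors_def[of "group_ring G"])
qed

lemma submonoid_\<Lambda>: "submonoid \<Lambda> (group_ring G)"
proof
  show "\<Lambda> \<subseteq> carrier (group_ring G)"
    by (rule subsetI) (simp add: regular_keys_carrier)
  show "\<one>\<^bsub>group_ring G\<^esub> \<in> \<Lambda>"
    using subgroup.one_closed[OF subgroup_H]
    by (auto simp: mem_\<Lambda>_iff group_ring_one_left group_ring_one_right keys_H_carrier)
next
  fix l m assume l: "l \<in> \<Lambda>" and m: "m \<in> \<Lambda>"
  note k = regular_keys_carrier[OF l] regular_keys_carrier[OF m]
  have "y = 0" if y: "Poly_Mapping.keys y \<subseteq> H" and "l \<star> m \<star> y = 0" for y
    using that regular_left_cancel[OF l, of "m \<star> y"] regular_left_cancel[OF m, of y]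
      group_ring_assoc[OF k keys_H_carrier[OF y]] keys_H_carrier[OF y] k(2)
    by (simp add: keys_mult_carrier)
  moreover have "y = 0" if y: "Poly_Mapping.keys y \<subseteq> H" and "y \<star> (l \<star> m) = 0" for y
    using that regular_right_cancel[OF m, of "y \<star> l"] regular_right_cancel[OF l, of y]
      group_ring_assoc[OF keys_H_carrier[OF y] k] keys_H_carrier[OF y] k(1)
    by (simp add: keys_mult_carrier)
  ultimately show "l \<star> m \<in> \<Lambda>"
    using H_mult_closed[OF regular_keys[OF l] regular_keys[OF m]] by (auto simp: mem_\<Lambda>_iff)
qed

text \<open>For s the sum, y s \<open>star\<close> y is the sum of the terms (y x)
  \<open>star\<close> (y x). If y s = 0, positivity gives y x = 0 for every x in \<open>F\<close>,
  hence y = 0. The other side follows by the involution, which fixes s.\<close>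

lemma regular_sum_mult_star:
  assumes F: "finite F" "\<And>x. x \<in> F \<Longrightarrow> Poly_Mapping.keys x \<subseteq> H"
    and ann: "\<And>y. Poly_Mapping.keys y \<subseteq> H \<Longrightarrow> (\<And>x. x \<in> F \<Longrightarrow> y \<star> x = 0) \<Longrightarrow> y = 0"
  shows "(\<Sum>x\<in>F. x \<star> star x) \<in> \<Lambda>"
proof -
  define s where "s = (\<Sum>x\<in>F. x \<star> star x)"
  have sH: "Poly_Mapping.keys s \<subseteq> H"
    unfolding s_def using F by (intro keys_sum_subset H_mult_closed H_star_closed) auto
  have FG: "Poly_Mapping.keys x \<subseteq> carrier G" if "x \<in> F" for x
    using F(2) that keys_H_carrier by blast
  have star_s: "star s = s"
    unfolding s_def star_sum by (intro sum.cong) (simp_all add: star_mult star_star keys_star_carrier FG)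
  have r: "y = 0" if y: "Poly_Mapping.keys y \<subseteq> H" and ys: "y \<star> s = 0" for y
  proof -
    note yG = keys_H_carrier[OF y]
    have "(\<Sum>x\<in>F. (y \<star> x) \<star> star (y \<star> x)) = y \<star> s \<star> star y"
      unfolding s_def group_ring_sum_right group_ring_sum_left
      by (intro sum.cong)
         (simp_all add: star_mult yG FG group_ring_assoc keys_star_carrier keys_mult_carrier)
    then have "\<forall>x\<in>F. y \<star> x = 0"
      using sum_mult_star_eq_0_iff[of F "\<lambda>x. y \<star> x"] F(1) FG yG ys by (simp add: keys_mult_carrier)
    then show "y = 0" using ann[OF y] by blast
  qed
  moreover have "y = 0" if y: "Poly_Mapping.keys y \<subseteq> H" and "s \<star> y = 0" for y
    using r[OF H_star_closed[OF y]] that star_mult[OF keys_H_carrier[OF sH] keys_H_carrier[OF y]]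
      star_s star_eq_0[OF keys_H_carrier[OF y]] by simp
  ultimately show ?thesis
    using sH by (auto simp: mem_\<Lambda>_iff simp flip: s_def)
qed

text \<open>The descending chain of the left annihilators of finite subsets of \<open>J\<close> is turned into an
  ascending chain by taking right annihilators.\<close>

lemma right_ideal_contains_regular:
  assumes acc: "acc_right_annihilators \<int>H"
    and J: "\<And>x. x \<in> J \<Longrightarrow> Poly_Mapping.keys x \<subseteq> H" "0 \<in> J"
      "\<And>x y. x \<in> J \<Longrightarrow> y \<in> J \<Longrightarrow> x + y \<in> J"
      "\<And>x a. x \<in> J \<Longrightarrow> Poly_Mapping.keys a \<subseteq> H \<Longrightarrow> x \<star> a \<in> J"
    and ann: "\<And>y. Poly_Mapping.keys y \<subseteq> H \<Longrightarrow> (\<And>x. x \<in> J \<Longrightarrow> y \<star> x = 0) \<Longrightarrow> y = 0"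
  shows "\<exists>l\<in>J. l \<in> \<Lambda>"
proof (rule ccontr)
  assume no: "\<not> (\<exists>l\<in>J. l \<in> \<Lambda>)"
  have sumJ: "finite F \<Longrightarrow> F \<subseteq> J \<Longrightarrow> (\<Sum>x\<in>F. x \<star> star x) \<in> J" for F
    by (induction F rule: finite_induct) (auto simp: J H_star_closed)
  \<comment> \<open>The sum over \<open>F\<close> lies in \<open>J\<close>, hence is not regular by
    assumption, so some non-zero \<open>y\<close> annihilates \<open>F\<close>. It does not
    annihilate \<open>J\<close>, and adding a witness \<open>x\<close> of this to \<open>F\<close>
    strictly shrinks the left annihilator.\<close>
  have step: "\<exists>F'. (finite F' \<and> F' \<subseteq> J) \<and> F \<subseteq> F' \<and>
      (\<exists>y. Poly_Mapping.keys y \<subseteq> H \<and> (\<forall>x\<in>F. y \<star> x = 0) \<and> (\<exists>x\<in>F'. y \<star> x \<noteq> 0))"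
    if F: "finite F \<and> F \<subseteq> J" for F
  proof -
    have "(\<Sum>x\<in>F. x \<star> star x) \<notin> \<Lambda>"
      using no sumJ F by blast
    then obtain y where y: "Poly_Mapping.keys y \<subseteq> H" "\<And>x. x \<in> F \<Longrightarrow> y \<star> x = 0" "y \<noteq> 0"
      using regular_sum_mult_star[of F] F J(1) by blast
    then obtain x where "x \<in> J" "y \<star> x \<noteq> 0"
      using ann by blast
    then show ?thesis
      using F y by (intro exI[of _ "insert x F"]) auto
  qed
  have "\<exists>F. \<forall>n. (finite (F n) \<and> F n \<subseteq> J) \<and> F n \<subseteq> F (Suc n) \<and>
      (\<exists>y. Poly_Mapping.keys y \<subseteq> H \<and> (\<forall>x\<in>F n. y \<star> x = 0) \<and> (\<exists>x\<in>F (Suc n). y \<star> x \<noteq> 0))"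
    by (rule dependent_nat_choice[where P = "\<lambda>_ F. finite F \<and> F \<subseteq> J"]) (use step in auto)
  then obtain F where "\<forall>n. (finite (F n) \<and> F n \<subseteq> J) \<and> F n \<subseteq> F (Suc n) \<and>
      (\<exists>y. Poly_Mapping.keys y \<subseteq> H \<and> (\<forall>x\<in>F n. y \<star> x = 0) \<and> (\<exists>x\<in>F (Suc n). y \<star> x \<noteq> 0))"
    by (rule exE)
  then have F: "F n \<subseteq> J" "F n \<subseteq> F (Suc n)"
    "\<exists>y. Poly_Mapping.keys y \<subseteq> H \<and> (\<forall>x\<in>F n. y \<star> x = 0) \<and> (\<exists>x\<in>F (Suc n). y \<star> x \<noteq> 0)" for n
    by simp_all
  \<comment> \<open>The left annihilators \<open>L n\<close> decrease, so their right annihilators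
    \<open>I n\<close> increase, and \<open>I n\<close> contains \<open>F n\<close>.\<close>
  define L where "L n = {y. Poly_Mapping.keys y \<subseteq> H \<and> (\<forall>x\<in>F n. y \<star> x = 0)}" for n
  define I where "I n = right_annihilator \<int>H (L n)" for n
  have "L (Suc n) \<subseteq> L n" for n
    using F(2)[of n] unfolding L_def by blast
  then have "I n \<subseteq> I (Suc n)" for n
    unfolding I_def right_annihilator_def by blast
  moreover have "\<exists>S \<subseteq> carrier \<int>H. I n = right_annihilator \<int>H S" for n
    by (rule exI[of _ "L n"]) (auto simp: I_def L_def)
  ultimately obtain N where N: "\<And>n. n \<ge> N \<Longrightarrow> I n = I N"
    using acc unfolding acc_right_annihilators_def by blast
  obtain y x where y: "y \<in> L N" "x \<in> F (Suc N)" "y \<star> x \<noteq> 0"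
    using F(3)[of N] by (auto simp: L_def)
  \<comment> \<open>Once the chain is stationary, \<open>x\<close> is annihilated by all of
    \<open>L N\<close>, against the choice of \<open>y\<close> and \<open>x\<close>.\<close>
  have "x \<in> I (Suc N)"
    using y(2) F(1) J(1) by (auto simp: I_def right_annihilator_def L_def)
  then have "x \<in> I N" using N[of "Suc N"] by simp
  then show False
    using y by (auto simp: I_def right_annihilator_def)
qed

text \<open>With \<open>s = y\<^sup>* y\<close>, the right annihilator of \<open>s\<close> meets \<open>s \<int>H\<close> trivially.\<close>

lemma essential_left_annihilator:
  assumes ess: "\<And>v. Poly_Mapping.keys v \<subseteq> H \<Longrightarrow> v \<noteq> 0 \<Longrightarrow>
      \<exists>a. Poly_Mapping.keys a \<subseteq> H \<and> v \<star> a \<noteq> 0 \<and> v \<star> a \<in> J"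
    and y: "Poly_Mapping.keys y \<subseteq> H" "\<And>x. x \<in> J \<Longrightarrow> y \<star> x = 0"
  shows "y = 0"
proof (rule ccontr)
  assume "y \<noteq> 0"
  note yG = keys_H_carrier[OF y(1)]
  define s where "s = star y \<star> y"
  have sH: "Poly_Mapping.keys s \<subseteq> H"
    unfolding s_def by (intro H_mult_closed H_star_closed y)
  note sG = keys_H_carrier[OF sH]
  have star_s: "star s = s"
    unfolding s_def using yG by (simp add: star_mult star_star keys_star_carrier)
  have "s \<noteq> 0"
    using mult_star_self_eq_0_iff[OF keys_star_carrier[OF yG]] \<open>y \<noteq> 0\<close> star_eq_0[OF yG]
    by (simp add: s_def star_star[OF yG])
  then obtain a where a: "Poly_Mapping.keys a \<subseteq> H" "s \<star> a \<noteq> 0" "s \<star> a \<in> J"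
    using ess[OF sH] by blast
  note aG = keys_H_carrier[OF a(1)]
  have "s \<star> (s \<star> a) = star y \<star> (y \<star> (s \<star> a))"
    unfolding s_def using yG aG by (simp add: group_ring_assoc keys_mult_carrier keys_star_carrier)
  also have "\<dots> = 0"
    using y(2)[OF a(3)] by simp
  finally have ssa: "s \<star> (s \<star> a) = 0" .
  \<comment> \<open>Positivity is applied to \<open>star (s \<star> a)\<close>: as \<open>s\<close>
    is fixed by the involution, the resulting product ends in s s a, which has just been shown to
    vanish.\<close>
  have "star (s \<star> a) \<star> star (star (s \<star> a)) = star a \<star> (s \<star> (s \<star> a))"
    using sG aG by (simp add: star_mult star_s star_star group_ring_assoc keys_mult_carrier keys_star_carrier)
  also have "\<dots> = 0" using ssa by simp
  finally have "star (s \<star> a) = 0"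
    using mult_star_self_eq_0_iff[of "star (s \<star> a)"] sG aG
    by (simp add: keys_mult_carrier keys_star_carrier)
  then show False
    using a(2) star_eq_0[of "s \<star> a"] sG aG by (simp add: keys_mult_carrier)
qed

end

section \<open>Uniform dimension and the Ore condition\<close>

context group_subgroup
begin

text \<open>This says that the sum of the cyclic right ZH-modules generated by the
  \<open>w i\<close> is direct. Only the products are required to vanish, since \<open>w i\<close>
  may be annihilated by non-zero coefficients. Initial segments suffice because coefficients may be
  0.\<close>

definition independent :: "(nat \<Rightarrow> 'a \<Rightarrow>\<^sub>0 int) \<Rightarrow> bool"
  where "independent w \<longleftrightarrow>
    (\<forall>a n. (\<forall>i. Poly_Mapping.keys (a i) \<subseteq> H) \<and> (\<Sum>i<n. w i \<star> a i) = 0 \<longrightarrow> (\<forall>i<n. w i \<star> a i = 0))"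

lemma independentD:
  "independent w \<Longrightarrow> (\<And>i. Poly_Mapping.keys (a i) \<subseteq> H) \<Longrightarrow> (\<Sum>i<n. w i \<star> a i) = 0 \<Longrightarrow> i < n
    \<Longrightarrow> w i \<star> a i = 0"
  unfolding independent_def by blast

text \<open>If \<open>D\<close> is stable under right multiplication by \<open>H\<close>, this is
  finite uniform dimension of the right ZH-module of elements supported in \<open>D\<close>: an
  infinite direct sum of non-zero submodules contains one of non-zero cyclic submodules.\<close>

definition finite_uniform_dim :: "'a set \<Rightarrow> bool"
  where "finite_uniform_dim D \<longleftrightarrow>
    \<not> (\<exists>w. (\<forall>i. w i \<noteq> 0 \<and> Poly_Mapping.keys (w i) \<subseteq> D) \<and> independent w)"

lemma finite_uniform_dim_mono: "finite_uniform_dim D' \<Longrightarrow> D \<subseteq> D' \<Longrightarrow> finite_uniform_dim D"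
  unfolding finite_uniform_dim_def by (meson order.trans)

lemma finite_uniform_dim_empty: "finite_uniform_dim {}"
  by (auto simp: finite_uniform_dim_def)

text \<open>An independent sequence of non-zero elements of ZH would make the right ideals
  \<open>w i\<close> ZH an infinite independent family.\<close>

lemma finite_uniform_dim_H:
  assumes "finite_right_uniform_dimension \<int>H"
  shows "finite_uniform_dim H"
  unfolding finite_uniform_dim_def
proof (rule notI, elim exE conjE)
  fix w assume w: "\<forall>i. w i \<noteq> 0 \<and> Poly_Mapping.keys (w i) \<subseteq> H" and ind: "independent w"
  note wH = w[rule_format, THEN conjunct2] and wG = w[rule_format, THEN conjunct2, THEN keys_H_carrier]
  define I where "I i = {w i \<star> a | a. Poly_Mapping.keys a \<subseteq> H}" for i
  interpret ZH: ring "\<int>H" by (rule ring_group_ring_H)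
  have sub: "Poly_Mapping.keys x \<subseteq> H" if "x \<in> I i" for x i
    using that H_mult_closed[OF wH] by (auto simp: I_def)
  have "right_ideal (I i) \<int>H \<and> I i \<noteq> {\<zero>\<^bsub>\<int>H\<^esub>}" for i
  proof
    have "additive_subgroup (I i) \<int>H"
    proof (intro additive_subgroup.intro ZH.add.subgroupI)
      show "I i \<subseteq> carrier \<int>H"
        using sub by auto
      show "I i \<noteq> {}"
        unfolding I_def by (auto intro: exI[of _ 0])
    next
      fix x assume x: "x \<in> I i"
      then obtain a where a: "Poly_Mapping.keys a \<subseteq> H" "x = w i \<star> a" by (auto simp: I_def)
      have "\<ominus>\<^bsub>\<int>H\<^esub> x = - x"
        using sub[OF x] by (intro ZH.minus_equality) simp_all
      moreover have "- x \<in> I i"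
        using a by (auto simp: I_def group_ring_minus_right intro!: exI[of _ "- a"])
      ultimately show "\<ominus>\<^bsub>\<int>H\<^esub> x \<in> I i" by simp
    next
      fix x y assume "x \<in> I i" "y \<in> I i"
      then obtain a b where a: "Poly_Mapping.keys a \<subseteq> H" "x = w i \<star> a"
          "Poly_Mapping.keys b \<subseteq> H" "y = w i \<star> b" by (auto simp: I_def)
      then have "x + y \<in> I i"
        using keys_add_subset[OF a(1,3)] by (simp add: I_def) (metis group_ring_add_right)
      then show "x \<oplus>\<^bsub>\<int>H\<^esub> y \<in> I i" by simp
    qed
    moreover have "x \<star> b \<in> I i" if x: "x \<in> I i" and b: "Poly_Mapping.keys b \<subseteq> H" for x b
    proof -
      obtain a where a: "Poly_Mapping.keys a \<subseteq> H" "x = w i \<star> a" using x by (auto simp: I_def)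
      show ?thesis
        using a b group_ring_assoc[OF wG keys_H_carrier[OF a(1)] keys_H_carrier[OF b]]
        using H_mult_closed[OF a(1) b] by (auto simp: I_def)
    qed
    ultimately show "right_ideal (I i) \<int>H"
      by (simp add: right_ideal_def)
    have "w i \<in> I i"
      using group_ring_one_right[OF wG[of i]] subgroup.one_closed[OF subgroup_H]
      by (auto simp: I_def intro!: exI[of _ "frag_of \<one>"])
    then show "I i \<noteq> {\<zero>\<^bsub>\<int>H\<^esub>}"
      using w by auto
  qed
  moreover have "independent_family \<int>H I"
    unfolding independent_family_def
  proof (intro allI impI ballI, elim conjE)
    fix F :: "nat set" and x i
    assume F: "finite F" and x: "x \<in> (\<Pi> i\<in>F. I i)" and 0: "finsum \<int>H x F = \<zero>\<^bsub>\<int>H\<^esub>" and i: "i \<in> F"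
    \<comment> \<open>The finite index set \<open>F\<close> is extended to an initial segment with
      coefficient 0 outside \<open>F\<close>, as independence of \<open>w\<close> is phrased for
      initial segments.\<close>
    have "\<exists>a. Poly_Mapping.keys a \<subseteq> H \<and> w i \<star> a = (if i \<in> F then x i else 0)" for i
    proof (cases "i \<in> F")
      case True
      then have "x i \<in> I i" using x by blast
      then show ?thesis using True unfolding I_def by auto
    qed (auto intro: exI[of _ 0])
    then obtain a where a: "Poly_Mapping.keys (a i) \<subseteq> H" "w i \<star> a i = (if i \<in> F then x i else 0)" for i
      by metis
    obtain n where n: "F \<subseteq> {..<n}"
      using F finite_nat_iff_bounded by blast
    have "(\<Sum>i<n. w i \<star> a i) = (\<Sum>i\<in>F. x i)"
      by (rule sum.mono_neutral_cong_right) (use n a(2) in auto)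
    also have "\<dots> = finsum \<int>H x F"
      using F x sub by (intro finsum_group_ring_H[symmetric]) (auto simp: Pi_iff)
    finally have "(\<Sum>i<n. w i \<star> a i) = 0" using 0 by simp
    then have "w i \<star> a i = 0"
      using independentD[where a = a and n = n and i = i, OF ind a(1)] i n by blast
    then show "x i = \<zero>\<^bsub>\<int>H\<^esub>"
      using a(2) i by simp
  qed
  ultimately show False
    using assms unfolding finite_right_uniform_dimension_def by blast
qed

text \<open>Left multiplication by the inverse of \<open>g\<close> is an injective right ZH-linear
  map from the elements supported in \<open>g <# H\<close> to ZH, so it transports independent
  sequences.\<close>

lemma finite_uniform_dim_l_coset:
  assumes H: "finite_uniform_dim H" and g: "g \<in> carrier G"
  shows "finite_uniform_dim (g <# H)"
  unfolding finite_uniform_dim_def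
proof (rule notI, elim exE conjE)
  fix w assume w: "\<forall>i. w i \<noteq> 0 \<and> Poly_Mapping.keys (w i) \<subseteq> g <# H" and ind: "independent w"
  have gH: "g <# H \<subseteq> carrier G"
    using g H_subset by (auto simp: l_coset_def)
  have wG: "Poly_Mapping.keys (w i) \<subseteq> carrier G" for i
    using w gH by blast
  define u where "u i = frag_of (inv g) \<star> w i" for i
  have gu: "frag_of g \<star> (u i \<star> a) = w i \<star> a" if a: "Poly_Mapping.keys a \<subseteq> carrier G" for a i
  proof -
    have "frag_of g \<star> (u i \<star> a) = frag_of g \<star> frag_of (inv g) \<star> (w i \<star> a)"
      unfolding u_def using wG a g
      by (simp only: group_ring_assoc keys_mult_carrier keys_frag_of inv_closed insert_subset empty_subsetI simp_thms)
    then show ?thesis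
      using g wG[of i] a by (simp add: group_ring_one_left keys_mult_carrier)
  qed
  have "u i \<noteq> 0" for i
    using gu[of "frag_of \<one>" i] w wG[of i] by (auto simp: group_ring_one_right)
  moreover have "Poly_Mapping.keys (u i) \<subseteq> H" for i
    unfolding u_def
  proof (rule keys_mult_subset[where S = "{inv g}" and T = "g <# H"])
    fix x y assume "x \<in> {inv g}" "y \<in> g <# H"
    then show "x \<otimes> y \<in> H"
      using g H_subset by (auto simp: l_coset_def m_assoc[symmetric] subset_iff)
  qed (use w in simp_all)
  moreover have "independent u"
    unfolding independent_def
  proof (intro allI impI, elim conjE)
    fix a n i assume a: "\<forall>i. Poly_Mapping.keys (a i) \<subseteq> H" and 0: "(\<Sum>i<n. u i \<star> a i) = 0" and i: "i < n"
    have aG: "Poly_Mapping.keys (a i) \<subseteq> carrier G" for i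
      using a keys_H_carrier by blast
    have "(\<Sum>i<n. w i \<star> a i) = frag_of g \<star> (\<Sum>i<n. u i \<star> a i)"
      by (simp add: group_ring_sum_right gu[OF aG])
    then have "w i \<star> a i = 0"
      using independentD[OF ind _ _ i, of a] a 0 by simp
    then have "frag_of (inv g) \<star> (w i \<star> a i) = 0" by simp
    then show "u i \<star> a i = 0"
      unfolding u_def using group_ring_assoc[of "frag_of (inv g)" "w i" "a i"] g wG aG by simp
  qed
  ultimately show False
    using H unfolding finite_uniform_dim_def by blast
qed

text \<open>Either the module supported in \<open>D\<^sub>2\<close> meets every tail of the direct sum spanned by an
  independent sequence, so that it contains an independent sequence itself, or some tail is mapped
  injectively by the projection that forgets the coefficients in \<open>D\<^sub>2\<close>.\<close>

lemma finite_uniform_dim_Un: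
  assumes D1: "finite_uniform_dim D1" and D2: "finite_uniform_dim D2"
    and sub: "D1 \<subseteq> carrier G" "D2 \<subseteq> carrier G"
    and stable: "\<And>g h. g \<in> carrier G \<Longrightarrow> h \<in> H \<Longrightarrow> g \<otimes> h \<in> D2 \<longleftrightarrow> g \<in> D2"
  shows "finite_uniform_dim (D1 \<union> D2)"
  unfolding finite_uniform_dim_def
proof (rule notI, elim exE conjE)
  fix w assume w: "\<forall>i. w i \<noteq> 0 \<and> Poly_Mapping.keys (w i) \<subseteq> D1 \<union> D2" and ind: "independent w"
  have wG: "Poly_Mapping.keys (w i) \<subseteq> carrier G" for i
    using w sub by blast
  \<comment> \<open>\<open>P k m a\<close> exhibits a non-zero element supported in
    \<open>D2\<close> that is a combination of \<open>w k\<close> to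
    \<open>w (m - 1)\<close>.\<close>
  define P where "P k m a \<longleftrightarrow> (\<forall>i. Poly_Mapping.keys (a i) \<subseteq> H) \<and>
      (\<Sum>i\<in>{k..<m}. w i \<star> a i) \<noteq> 0 \<and> Poly_Mapping.keys (\<Sum>i\<in>{k..<m}. w i \<star> a i) \<subseteq> D2" for k m a
  show False
  proof (cases "\<forall>k. \<exists>m a. P k m a")
    case True
    then obtain m a where ma: "P k (m k) (a k)" for k
      by metis
    have m: "k < m k" for k
      using ma[of k] by (cases "k < m k") (simp_all add: P_def)
    \<comment> \<open>Iterating \<open>m\<close> cuts the indices into consecutive non-empty blocks.
      Each block provides one element \<open>u j\<close> supported in \<open>D2\<close>, and
      disjoint blocks give independent elements.\<close>
    define K where "K j = (m ^^ j) 0" for j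
    have K: "K (Suc j) = m (K j)" "K 0 = 0" for j
      by (simp_all add: K_def)
    define u where "u j = (\<Sum>i\<in>{K j..<K (Suc j)}. w i \<star> a (K j) i)" for j
    have aH: "Poly_Mapping.keys (a k i) \<subseteq> H" for k i
      using ma[of k] by (simp add: P_def)
    have u: "u j \<noteq> 0 \<and> Poly_Mapping.keys (u j) \<subseteq> D2" for j
      using ma[of "K j"] by (simp add: P_def u_def K)
    have ub: "u j \<star> b = (\<Sum>i\<in>{K j..<K (Suc j)}. w i \<star> (a (K j) i \<star> b))"
      if b: "Poly_Mapping.keys b \<subseteq> H" for j b
      unfolding u_def group_ring_sum_left
      by (intro sum.cong refl group_ring_assoc wG keys_H_carrier aH b)
    \<comment> \<open>A combination of the \<open>u j\<close> is rewritten as a single combination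
      of an initial segment of \<open>w\<close>, with \<open>c\<close> collecting the coefficients
      block by block.\<close>
    have ex: "\<exists>c. (\<forall>i. Poly_Mapping.keys (c i) \<subseteq> H) \<and> (\<Sum>j<n. u j \<star> b j) = (\<Sum>i<K n. w i \<star> c i) \<and>
        (\<forall>j<n. \<forall>i\<in>{K j..<K (Suc j)}. c i = a (K j) i \<star> b j)"
      if b: "\<And>j. Poly_Mapping.keys (b j) \<subseteq> H" for b n
    proof (induction n)
      case 0
      show ?case by (intro exI[of _ "\<lambda>_. 0"]) (simp add: K)
    next
      case (Suc n)
      then obtain c where c: "\<And>i. Poly_Mapping.keys (c i) \<subseteq> H" "(\<Sum>j<n. u j \<star> b j) = (\<Sum>i<K n. w i \<star> c i)"
        "\<And>j i. j < n \<Longrightarrow> i \<in> {K j..<K (Suc j)} \<Longrightarrow> c i = a (K j) i \<star> b j"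
        by blast
      have mono: "K j \<le> K n" if "j \<le> n" for j
        using that by (rule lift_Suc_mono_le[rotated]) (simp add: K m less_imp_le)
      define c' where "c' i = (if i < K n then c i else a (K n) i \<star> b n)" for i
      have "Poly_Mapping.keys (c' i) \<subseteq> H" for i
        by (simp add: c'_def c(1) H_mult_closed aH b)
      moreover have "(\<Sum>j<Suc n. u j \<star> b j) = (\<Sum>i<K (Suc n). w i \<star> c' i)"
      proof -
        have "(\<Sum>i<K (Suc n). w i \<star> c' i) = (\<Sum>i<K n. w i \<star> c' i) + (\<Sum>i\<in>{K n..<K (Suc n)}. w i \<star> c' i)"
          using m[of "K n"] sum.atLeastLessThan_concat[of 0 "K n" "K (Suc n)" "\<lambda>i. w i \<star> c' i"]
          by (simp add: K atLeast0LessThan less_imp_le)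
        then show ?thesis
          using c(2) ub[OF b, of n n] by (simp add: c'_def)
      qed
      moreover have "c' i = a (K j) i \<star> b j" if "j < Suc n" "i \<in> {K j..<K (Suc j)}" for i j
      proof (cases "j = n")
        case False
        then have "i < K n"
          using mono[of "Suc j"] that by auto
        then show ?thesis
          using c(3)[of j i] that False by (simp add: c'_def)
      qed (use that in \<open>simp add: c'_def\<close>)
      ultimately show ?case by blast
    qed
    have "independent u"
      unfolding independent_def
    proof (intro allI impI, elim conjE)
      fix b n j assume b: "\<forall>i. Poly_Mapping.keys (b i) \<subseteq> H" and 0: "(\<Sum>i<n. u i \<star> b i) = 0" and j: "j < n"
      obtain c where c: "\<And>i. Poly_Mapping.keys (c i) \<subseteq> H" "(\<Sum>j<n. u j \<star> b j) = (\<Sum>i<K n. w i \<star> c i)"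
        "\<And>j i. j < n \<Longrightarrow> i \<in> {K j..<K (Suc j)} \<Longrightarrow> c i = a (K j) i \<star> b j"
        using ex[of b n] b by blast
      have mono: "K (Suc j) \<le> K n"
        by (rule lift_Suc_mono_le[of K]) (use j in \<open>simp_all add: K m less_imp_le\<close>)
      have "w i \<star> (a (K j) i \<star> b j) = 0" if i: "i \<in> {K j..<K (Suc j)}" for i
      proof -
        have "i < K n" using i mono by simp
        then have "w i \<star> c i = 0"
          by (rule independentD[OF ind c(1), rotated]) (use c(2) 0 in simp)
        then show ?thesis
          using c(3)[OF j i] by simp
      qed
      then show "u j \<star> b j = 0"
        using ub[of "b j" j] b by simp
    qed
    then show False
      using D2 u unfolding finite_uniform_dim_def by blast
  next
    case False
    then obtain k where k: "\<And>m a. \<not> P k m a"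
      by blast
    \<comment> \<open>The kernel of \<open>R\<close> consists of elements supported in
      \<open>D2\<close>. By the choice of \<open>k\<close>, no non-zero combination of the
      \<open>w i\<close> with i at least \<open>k\<close> is of this kind, so \<open>R\<close> is
      injective on the tail.\<close>
    define R where "R = restrict_support (- D2)"
    define v where "v i = R (w (k + i))" for i
    have R0: "Poly_Mapping.keys x \<subseteq> D2" if "R x = 0" for x
    proof -
      have "Poly_Mapping.keys x \<inter> - D2 = {}"
        using that unfolding R_def by (metis keys_restrict_support keys_zero)
      then show ?thesis by blast
    qed
    have Rm: "R (w i \<star> a) = R (w i) \<star> a" if a: "Poly_Mapping.keys a \<subseteq> H" for i a
      unfolding R_def by (rule restrict_support_mult_right[OF wG a]) (simp add: stable)
    have tail: "\<forall>i<n. w (k + i) \<star> a i = 0"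
      if a: "\<And>i. Poly_Mapping.keys (a i) \<subseteq> H" and 0: "(\<Sum>i<n. v i \<star> a i) = 0" for a n
    proof -
      \<comment> \<open>Shifting by \<open>k\<close> and padding with zeros turns a relation of the
        tail into one of an initial segment of \<open>w\<close>.\<close>
      define a' where "a' i = (if i < k then 0 else a (i - k))" for i
      have a': "Poly_Mapping.keys (a' i) \<subseteq> H" for i
        by (simp add: a'_def a)
      have eq: "(\<Sum>i\<in>{k..<k + n}. w i \<star> a' i) = (\<Sum>i<n. w (k + i) \<star> a i)"
        using sum.shift_bounds_nat_ivl[of "\<lambda>i. w i \<star> a' i" 0 k n]
        by (simp add: a'_def atLeast0LessThan add.commute)
      have "R (\<Sum>i<n. w (k + i) \<star> a i) = (\<Sum>i<n. v i \<star> a i)"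
        unfolding R_def restrict_support_sum unfolding v_def
        by (intro sum.cong refl) (simp add: Rm[OF a] flip: R_def)
      then have "Poly_Mapping.keys (\<Sum>i<n. w (k + i) \<star> a i) \<subseteq> D2"
        using R0 0 by simp
      then have "(\<Sum>i\<in>{k..<k + n}. w i \<star> a' i) = 0"
        using k[of "k + n" a'] a' eq by (simp add: P_def)
      moreover have "(\<Sum>i<k + n. w i \<star> a' i) = (\<Sum>i\<in>{k..<k + n}. w i \<star> a' i)"
        by (rule sum.mono_neutral_right) (auto simp: a'_def)
      ultimately have "w (k + i) \<star> a' (k + i) = 0" if "i < n" for i
        using independentD[where a = a' and n = "k + n" and i = "k + i", OF ind a'] that by simp
      then show ?thesis by (simp add: a'_def)
    qed
    have "independent v"
      unfolding independent_def
    proof (intro allI impI, elim conjE)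
      fix a n i assume a: "\<forall>i. Poly_Mapping.keys (a i) \<subseteq> H" and 0: "(\<Sum>i<n. v i \<star> a i) = 0" and i: "i < n"
      have "w (k + i) \<star> a i = 0"
        using tail[of a n] a 0 i by blast
      then show "v i \<star> a i = 0"
        using Rm[of "a i" "k + i"] a by (simp add: v_def R_def)
    qed
    moreover have "v i \<noteq> 0" for i
    proof
      assume "v i = 0"
      \<comment> \<open>The injectivity on the tail is tested on \<open>w (k + i)\<close> itself,
        that is, on a single coefficient 1.\<close>
      define a where "a j = (if j = i then frag_of \<one> else 0)" for j
      have "(\<Sum>j<Suc i. v j \<star> a j) = 0"
        using \<open>v i = 0\<close> by (intro sum.neutral) (auto simp: a_def)
      moreover have "Poly_Mapping.keys (a j) \<subseteq> H" for j
        using subgroup.one_closed[OF subgroup_H] by (simp add: a_def)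
      ultimately have "w (k + i) \<star> a i = 0"
        using tail[of a "Suc i"] by blast
      then show False
        using w wG[of "k + i"] by (simp add: a_def group_ring_one_right)
    qed
    moreover have "Poly_Mapping.keys (v i) \<subseteq> D1" for i
      using w[rule_format, of "k + i"] by (auto simp: v_def R_def keys_restrict_support)
    ultimately show False
      using D1 unfolding finite_uniform_dim_def by blast
  qed
qed

section \<open>Finite unions of left cosets, and essential left multiples\<close>

lemma l_coset_subset: "g \<in> carrier G \<Longrightarrow> g <# H \<subseteq> carrier G"
  using H_subset by (auto simp: l_coset_def)

lemma mem_l_coset_mult_iff:
  assumes "g \<in> carrier G" "x \<in> carrier G" "h \<in> H"
  shows "x \<otimes> h \<in> g <# H \<longleftrightarrow> x \<in> g <# H"
proof
  have hG: "h \<in> carrier G" using assms H_subset by blast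
  { assume "x \<otimes> h \<in> g <# H"
    then obtain k where k: "k \<in> H" "x \<otimes> h = g \<otimes> k" by (auto simp: l_coset_def)
    then have "x = g \<otimes> (k \<otimes> inv h)"
      using assms hG H_subset by (metis inv_solve_right m_assoc m_closed inv_closed subsetD)
    then show "x \<in> g <# H"
      using k assms subgroup_H by (auto simp: l_coset_def subgroup.m_closed subgroup.m_inv_closed) }
  { assume "x \<in> g <# H"
    then obtain k where k: "k \<in> H" "x = g \<otimes> k" by (auto simp: l_coset_def)
    then have "x \<otimes> h = g \<otimes> (k \<otimes> h)"
      using assms hG H_subset by (auto simp: m_assoc)
    then show "x \<otimes> h \<in> g <# H"
      using k assms subgroup.m_closed[OF subgroup_H] by (auto simp: l_coset_def) }
qed

lemma finite_uniform_dim_l_cosets: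
  assumes H: "finite_uniform_dim H" and F: "finite F" "F \<subseteq> carrier G"
  shows "finite_uniform_dim (\<Union>g\<in>F. g <# H)"
  using F
proof (induction F rule: finite_induct)
  case empty
  then show ?case by (simp add: finite_uniform_dim_empty)
next
  case (insert g F)
  have "finite_uniform_dim ((\<Union>g\<in>F. g <# H) \<union> (g <# H))"
  proof (rule finite_uniform_dim_Un)
    show "(\<Union>g\<in>F. g <# H) \<subseteq> carrier G"
      using insert.prems l_coset_subset by blast
  qed (use insert l_coset_subset mem_l_coset_mult_iff finite_uniform_dim_l_coset[OF H] in simp_all)
  then show ?case by (simp add: Un_commute)
qed

text \<open>In a relation between v, l v, l l v and so on, the term with v alone is a left multiple
  of \<open>l\<close>, so it vanishes if no non-zero multiple of \<open>v\<close> has this form.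
  Cancelling \<open>l\<close> from the rest leaves a shorter relation of the same shape, so the
  sequence is independent.\<close>

lemma essential_left_multiple:
  assumes D: "finite_uniform_dim D" "D \<subseteq> carrier G" "\<And>h g. h \<in> H \<Longrightarrow> g \<in> D \<Longrightarrow> h \<otimes> g \<in> D"
    and l: "l \<in> \<Lambda>" and v: "Poly_Mapping.keys v \<subseteq> D" "v \<noteq> 0"
  shows "\<exists>a u. Poly_Mapping.keys a \<subseteq> H \<and> Poly_Mapping.keys u \<subseteq> carrier G \<and> v \<star> a \<noteq> 0 \<and> v \<star> a = l \<star> u"
proof (rule ccontr)
  assume no: "\<not> ?thesis"
  define w where "w i = ((\<lambda>x. l \<star> x) ^^ i) v" for i
  have w_Suc: "w (Suc i) = l \<star> w i" "w 0 = v" for i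
    by (simp_all add: w_def)
  have w: "w i \<noteq> 0 \<and> Poly_Mapping.keys (w i) \<subseteq> D" for i
  proof (induction i)
    case (Suc i)
    then have "Poly_Mapping.keys (w i) \<subseteq> carrier G" using D(2) by blast
    then have "w (Suc i) \<noteq> 0"
      using Suc regular_left_cancel[OF l] by (auto simp: w_Suc)
    moreover have "Poly_Mapping.keys (w (Suc i)) \<subseteq> D"
      unfolding w_Suc by (rule keys_mult_subset[OF regular_keys[OF l] conjunct2[OF Suc] D(3)])
    ultimately show ?case by simp
  qed (simp_all add: w_Suc v)
  have wG: "Poly_Mapping.keys (w i) \<subseteq> carrier G" for i
    using w D(2) by blast
  have "\<forall>i<n. w i \<star> a i = 0"
    if "\<And>i. Poly_Mapping.keys (a i) \<subseteq> H" "(\<Sum>i<n. w i \<star> a i) = 0" for n a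
    using that
  proof (induction n arbitrary: a)
    case (Suc n)
    note aG = Suc.prems(1)[THEN keys_H_carrier]
    define S where "S = (\<Sum>i<n. w i \<star> a (Suc i))"
    have SG: "Poly_Mapping.keys S \<subseteq> carrier G"
      unfolding S_def by (intro keys_sum_subset keys_mult_carrier wG aG)
    have wS: "w (Suc i) \<star> a (Suc i) = l \<star> (w i \<star> a (Suc i))" for i
      unfolding w_Suc by (intro group_ring_assoc wG aG regular_keys_carrier[OF l])
    \<comment> \<open>The first term is split off and one factor \<open>l\<close> is taken out of
      the others; \<open>S\<close> is the shorter relation with shifted coefficients.\<close>
    have eq: "v \<star> a 0 + l \<star> S = 0"
      using Suc.prems(2) unfolding sum.lessThan_Suc_shift S_def group_ring_sum_right wS by (simp add: w_Suc)
    then have "v \<star> a 0 = l \<star> (- S)"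
      by (simp add: group_ring_minus_right eq_neg_iff_add_eq_0)
    then have v0: "v \<star> a 0 = 0"
      using no Suc.prems(1)[of 0] SG by (metis keys_minus)
    then have "S = 0"
      using eq regular_left_cancel[OF l SG] by simp
    then have "\<forall>i<n. w i \<star> a (Suc i) = 0"
      using Suc.IH[of "\<lambda>i. a (Suc i)"] Suc.prems(1) unfolding S_def by blast
    then have "\<forall>i<n. w (Suc i) \<star> a (Suc i) = 0"
      by (simp add: wS)
    then show ?case
      using v0 by (auto simp: less_Suc_eq_0_disj w_Suc)
  qed simp
  then have "independent w"
    unfolding independent_def by blast
  then show False
    using D(1) w unfolding finite_uniform_dim_def by blast
qed

text \<open>The left cosets of \<open>H\<close> in the double coset H g H correspond to the cosets
  in \<open>H\<close> of its intersection with g H g^-1. As \<open>conjugate_by\<close> conjugates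
  the other way, commensurability is applied to \<open>inv g\<close>.\<close>

lemma double_coset_finite_union:
  assumes comm: "commensurator G H = carrier G" and g: "g \<in> carrier G"
  shows "\<exists>F. finite F \<and> F \<subseteq> carrier G \<and> (\<forall>h\<in>H. h \<otimes> g \<in> (\<Union>f\<in>F. f <# H))"
proof -
  define K where "K = H \<inter> conjugate_by G H (inv g)"
  have "finite (rcosets\<^bsub>G\<lparr>carrier := H\<rparr>\<^esub> K)"
    using comm g inv_closed[OF g] unfolding K_def commensurator_def commensurable_def by blast
  moreover have "rcosets\<^bsub>G\<lparr>carrier := H\<rparr>\<^esub> K = (\<lambda>a. K #> a) ` H"
    by (auto simp: RCOSETS_def r_coset_def)
  ultimately obtain A where A: "finite A" "A \<subseteq> H" "(\<lambda>a. K #> a) ` H = (\<lambda>a. K #> a) ` A"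
    using finite_subset_image[of "(\<lambda>a. K #> a) ` H" "\<lambda>a. K #> a" H] by auto
  have oneK: "\<one> \<in> K"
    using g subgroup.one_closed[OF subgroup_H]
    by (auto simp: K_def conjugate_by_def image_iff intro!: bexI[of _ \<one>])
  show ?thesis
  proof (intro exI[of _ "(\<lambda>a. inv a \<otimes> g) ` A"] conjI ballI)
    show "finite ((\<lambda>a. inv a \<otimes> g) ` A)" using A by simp
    show "(\<lambda>a. inv a \<otimes> g) ` A \<subseteq> carrier G" using A g H_subset by auto
    fix h assume h: "h \<in> H"
    have hG: "h \<in> carrier G" using h H_subset by blast
    \<comment> \<open>The cosets of \<open>K\<close> are right cosets, so the inverse of
      \<open>h\<close> is decomposed: h^-1 = k a with k = g m g^-1 gives h g = a^-1 g m^-1, which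
      lies in the left coset of a^-1 g.\<close>
    have "inv h \<in> K #> inv h"
      using oneK hG by (auto simp: r_coset_def intro!: bexI[of _ \<one>])
    moreover have "K #> inv h \<in> (\<lambda>a. K #> a) ` A"
      using A(3) subgroup.m_inv_closed[OF subgroup_H h] by blast
    ultimately obtain a where a: "a \<in> A" "inv h \<in> K #> a"
      by auto
    then obtain k where k: "k \<in> K" "inv h = k \<otimes> a"
      by (auto simp: r_coset_def)
    obtain m where m: "m \<in> H" "k = g \<otimes> m \<otimes> inv g"
      using k(1) g by (auto simp: K_def conjugate_by_def)
    have G: "a \<in> carrier G" "m \<in> carrier G" using a A m H_subset by auto
    have "h = inv (k \<otimes> a)" using k hG by (metis inv_inv)
    also have "\<dots> = inv a \<otimes> g \<otimes> inv m \<otimes> inv g"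
      unfolding m(2) using G g by (simp add: inv_mult_group m_assoc)
    finally have "h \<otimes> g = inv a \<otimes> g \<otimes> inv m"
      using G g by (simp add: m_assoc)
    then show "h \<otimes> g \<in> (\<Union>f\<in>(\<lambda>a. inv a \<otimes> g) ` A. f <# H)"
      using a subgroup.m_inv_closed[OF subgroup_H m(1)] by (auto simp: l_coset_def)
  qed
qed

lemma finite_uniform_dim_double_cosets:
  assumes comm: "commensurator G H = carrier G" and H: "finite_uniform_dim H"
    and A: "finite A" "A \<subseteq> carrier G"
  shows "finite_uniform_dim {h \<otimes> g | h g. h \<in> H \<and> g \<in> A}"
proof -
  obtain F where F: "\<And>g. g \<in> A \<Longrightarrow> finite (F g) \<and> F g \<subseteq> carrier G \<and> (\<forall>h\<in>H. h \<otimes> g \<in> (\<Union>f\<in>F g. f <# H))"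
    using double_coset_finite_union[OF comm] A(2) by (metis subsetD)
  show ?thesis
  proof (rule finite_uniform_dim_mono[OF finite_uniform_dim_l_cosets[OF H, of "\<Union>g\<in>A. F g"]])
    show "finite (\<Union>g\<in>A. F g)" "(\<Union>g\<in>A. F g) \<subseteq> carrier G"
      using F A by auto
    show "{h \<otimes> g | h g. h \<in> H \<and> g \<in> A} \<subseteq> (\<Union>f\<in>\<Union>g\<in>A. F g. f <# H)"
    proof clarify
      fix h g assume "h \<in> H" "g \<in> A"
      then show "h \<otimes> g \<in> (\<Union>f\<in>\<Union>g\<in>A. F g. f <# H)"
        using F[of g] by (simp only: UN_iff) blast
    qed
  qed
qed

section \<open>The right Ore condition\<close>

theorem right_Ore_set_\<Lambda>:
  assumes comm: "commensurator G H = carrier G" and goldie: "right_Goldie \<int>H"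
  shows "right_Ore_set \<Lambda> (group_ring G)"
proof -
  have acc: "acc_right_annihilators \<int>H" and dim: "finite_uniform_dim H"
    using goldie finite_uniform_dim_H unfolding right_Goldie_def by blast+
  have "\<exists>m\<in>\<Lambda>. \<exists>s. Poly_Mapping.keys s \<subseteq> carrier G \<and> r \<star> m = l \<star> s"
    if r: "Poly_Mapping.keys r \<subseteq> carrier G" and l: "l \<in> \<Lambda>" for r l
  proof -
    note lG = regular_keys_carrier[OF l]
    \<comment> \<open>Every regular element of the right ideal \<open>J\<close> of ZH is a possible
      \<open>m\<close> in the Ore condition for \<open>r\<close> and \<open>l\<close>.\<close>
    define J where "J = {x. Poly_Mapping.keys x \<subseteq> H \<and> (\<exists>u. Poly_Mapping.keys u \<subseteq> carrier G \<and> r \<star> x = l \<star> u)}"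
    have "\<exists>m\<in>J. m \<in> \<Lambda>"
    proof (rule right_ideal_contains_regular[OF acc])
      show "0 \<in> J" by (auto simp: J_def intro: exI[of _ 0])
      show "Poly_Mapping.keys x \<subseteq> H" if "x \<in> J" for x
        using that by (simp add: J_def)
    next
      fix x y assume "x \<in> J" "y \<in> J"
      then obtain u v where xy: "Poly_Mapping.keys x \<subseteq> H" "Poly_Mapping.keys y \<subseteq> H"
        and uv: "Poly_Mapping.keys u \<subseteq> carrier G" "r \<star> x = l \<star> u" "Poly_Mapping.keys v \<subseteq> carrier G" "r \<star> y = l \<star> v"
        by (auto simp: J_def)
      then have "r \<star> (x + y) = l \<star> (u + v)"
        by (simp add: group_ring_add_right)
      then show "x + y \<in> J"
        unfolding J_def using keys_add_subset[OF xy] keys_add_subset[OF uv(1,3)] by blast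
    next
      fix x a :: "'a \<Rightarrow>\<^sub>0 int" assume "x \<in> J" and a: "Poly_Mapping.keys a \<subseteq> H"
      then obtain u where x: "Poly_Mapping.keys x \<subseteq> H" and u: "Poly_Mapping.keys u \<subseteq> carrier G" "r \<star> x = l \<star> u"
        by (auto simp: J_def)
      have "r \<star> (x \<star> a) = l \<star> (u \<star> a)"
        using group_ring_assoc[OF r keys_H_carrier[OF x] keys_H_carrier[OF a]]
          group_ring_assoc[OF lG u(1) keys_H_carrier[OF a]] u(2) by simp
      then show "x \<star> a \<in> J"
        unfolding J_def using H_mult_closed[OF x a] keys_mult_carrier[OF u(1) keys_H_carrier[OF a]] by blast
    next
      fix y assume y: "Poly_Mapping.keys y \<subseteq> H" "\<And>x. x \<in> J \<Longrightarrow> y \<star> x = 0"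
      show "y = 0"
      proof (rule essential_left_annihilator[OF _ y])
        fix v :: "'a \<Rightarrow>\<^sub>0 int" assume v: "Poly_Mapping.keys v \<subseteq> H" "v \<noteq> 0"
        note vG = keys_H_carrier[OF v(1)]
        show "\<exists>a. Poly_Mapping.keys a \<subseteq> H \<and> v \<star> a \<noteq> 0 \<and> v \<star> a \<in> J"
        \<comment> \<open>If r v = 0, then \<open>v\<close> itself lies in \<open>J\<close>, with u
          = 0.\<close>
        proof (cases "r \<star> v = 0")
          case True
          then show ?thesis
            using v group_ring_one_right[OF vG] subgroup.one_closed[OF subgroup_H]
            by (intro exI[of _ "frag_of \<one>"]) (auto simp: J_def intro: exI[of _ 0])
        next
          case False
          \<comment> \<open>\<open>D\<close> is the smallest left \<open>H\<close>-stable set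
            containing the support of r v. As H is commensurated, it lies in finitely many left
            cosets. A non-zero multiple r v a in l ZG then puts v a into \<open>J\<close>, and v a
            is non-zero because r v a is.\<close>
          define D where "D = {h \<otimes> g | h g. h \<in> H \<and> g \<in> Poly_Mapping.keys (r \<star> v)}"
          have rv: "Poly_Mapping.keys (r \<star> v) \<subseteq> carrier G"
            by (rule keys_mult_carrier[OF r vG])
          have "\<exists>a u. Poly_Mapping.keys a \<subseteq> H \<and> Poly_Mapping.keys u \<subseteq> carrier G \<and>
              (r \<star> v) \<star> a \<noteq> 0 \<and> (r \<star> v) \<star> a = l \<star> u"
          proof (rule essential_left_multiple[OF _ _ _ l _ False])
            show "finite_uniform_dim D"
              unfolding D_def by (rule finite_uniform_dim_double_cosets[OF comm dim finite_keys rv])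
            show "D \<subseteq> carrier G"
              unfolding D_def using rv H_subset by (auto simp: subset_iff)
            show "h \<otimes> g \<in> D" if h: "h \<in> H" and "g \<in> D" for h g
            proof -
              obtain h' g' where g: "g = h' \<otimes> g'" "h' \<in> H" "g' \<in> Poly_Mapping.keys (r \<star> v)"
                using \<open>g \<in> D\<close> unfolding D_def by blast
              then have "h \<otimes> g = (h \<otimes> h') \<otimes> g'"
                using h rv H_subset by (auto simp: m_assoc subset_iff)
              then show ?thesis
                unfolding D_def using g h subgroup.m_closed[OF subgroup_H] by blast
            qed
            show "Poly_Mapping.keys (r \<star> v) \<subseteq> D"
              unfolding D_def using rv subgroup.one_closed[OF subgroup_H] by (force intro: l_one[symmetric])
          qed
          then obtain a u where au: "Poly_Mapping.keys a \<subseteq> H" "Poly_Mapping.keys u \<subseteq> carrier G"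
              "(r \<star> v) \<star> a \<noteq> 0" "(r \<star> v) \<star> a = l \<star> u" by blast
          have "(r \<star> v) \<star> a = r \<star> (v \<star> a)"
            by (rule group_ring_assoc[OF r vG keys_H_carrier[OF au(1)]])
          then show ?thesis
            using au H_mult_closed[OF v(1) au(1)] unfolding J_def by (intro exI[of _ a]) auto
        qed
      qed
    qed
    then show ?thesis
      by (auto simp: J_def)
  qed
  then show ?thesis
    using submonoid_\<Lambda> \<Lambda>_subset_nonzerodivisors
    by (simp add: right_Ore_set_def Bex_def[of "carrier (group_ring G)"])
qed

end

section \<open>Existence of Ore localizations\<close>

locale right_Ore = ring A for A (structure) +
  fixes S :: "'a set"
  assumes right_Ore: "right_Ore_set S A"
begin

lemma S_closed: "s \<in> S \<Longrightarrow> s \<in> carrier A"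
  using right_Ore by (auto simp: right_Ore_set_def submonoid_def)

lemma one_S: "\<one> \<in> S"
  using right_Ore by (simp add: right_Ore_set_def submonoid_def)

lemma mult_S: "s \<in> S \<Longrightarrow> t \<in> S \<Longrightarrow> s \<otimes> t \<in> S"
  using right_Ore by (simp add: right_Ore_set_def submonoid_def)

lemma S_nonzerodivisor: "s \<in> S \<Longrightarrow> s \<in> nonzerodivisors A"
  using right_Ore by (auto simp: right_Ore_set_def)

lemma eq_if_minus_eq_zero:
  assumes "x \<in> carrier A" "y \<in> carrier A" "x \<ominus> y = \<zero>"
  shows "x = y"
proof -
  have "x = x \<ominus> y \<oplus> y"
    using assms(1,2) by (simp add: minus_eq a_assoc l_neg)
  then show ?thesis
    using assms by simp
qed

lemma S_cancel_left:
  assumes "s \<in> S" "x \<in> carrier A" "y \<in> carrier A" "s \<otimes> x = s \<otimes> y"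
  shows "x = y"
proof -
  have "s \<otimes> (x \<ominus> y) = \<zero>"
    using assms S_closed[OF assms(1)] by (simp add: minus_eq r_distr r_minus r_neg)
  then have "x \<ominus> y = \<zero>"
    using S_nonzerodivisor[OF assms(1)] minus_closed[OF assms(2,3)]
    unfolding nonzerodivisors_def by blast
  then show ?thesis
    by (rule eq_if_minus_eq_zero[OF assms(2,3)])
qed

lemma S_cancel_right:
  assumes "s \<in> S" "x \<in> carrier A" "y \<in> carrier A" "x \<otimes> s = y \<otimes> s"
  shows "x = y"
proof -
  have "(x \<ominus> y) \<otimes> s = \<zero>"
    using assms S_closed[OF assms(1)] by (simp add: minus_eq l_distr l_minus r_neg)
  then have "x \<ominus> y = \<zero>"
    using S_nonzerodivisor[OF assms(1)] minus_closed[OF assms(2,3)]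
    unfolding nonzerodivisors_def by blast
  then show ?thesis
    by (rule eq_if_minus_eq_zero[OF assms(2,3)])
qed

lemma Ore_condition:
  assumes "r \<in> carrier A" "s \<in> S"
  obtains t c where "t \<in> S" "c \<in> carrier A" "r \<otimes> t = s \<otimes> c"
  using right_Ore assms unfolding right_Ore_set_def by blast

text \<open>The two factors play different roles: \<open>c\<close> is only known to lie in
  \<open>A\<close>, but the common multiple belongs to \<open>S\<close> and can serve as a common
  denominator.\<close>

lemma common_multiple:
  assumes "s \<in> S" "t \<in> S"
  obtains b c where "b \<in> S" "c \<in> carrier A" "s \<otimes> b = t \<otimes> c" "s \<otimes> b \<in> S"
  by (metis Ore_condition S_closed assms mult_S)

text \<open>The fraction \<open>a s\<^sup>-\<^sup>1\<close>, encoded as the graph \<open>{(x, y). y = a s\<^sup>-\<^sup>1 x}\<close> of a partially defined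
  left multiplication on \<open>A\<close>. Distinct fractions have distinct graphs, so that no quotient is
  needed.\<close>

definition frac :: "'a \<Rightarrow> 'a \<Rightarrow> ('a \<times> 'a) set"
  where "frac a s = {(x, y). x \<in> carrier A \<and> y \<in> carrier A \<and>
    (\<exists>t\<in>S. \<exists>c\<in>carrier A. x \<otimes> t = s \<otimes> c \<and> y \<otimes> t = a \<otimes> c)}"

definition fracs :: "('a \<times> 'a) set set"
  where "fracs = {frac a s | a s. a \<in> carrier A \<and> s \<in> S}"

lemma frac_in_fracs: "a \<in> carrier A \<Longrightarrow> s \<in> S \<Longrightarrow> frac a s \<in> fracs"
  by (auto simp: fracs_def)

lemma fracs_closed:
  assumes "F \<in> fracs" "(x, y) \<in> F"
  shows "x \<in> carrier A" "y \<in> carrier A"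
  using assms by (auto simp: fracs_def frac_def)

lemma frac_self: "a \<in> carrier A \<Longrightarrow> s \<in> S \<Longrightarrow> (s, a) \<in> frac a s"
  using one_S S_closed by (auto simp: frac_def)

text \<open>The two witnesses are compared over a common multiple of \<open>t\<close> and
  \<open>t'\<close>: cancelling \<open>s\<close> on the left identifies the multiples of
  \<open>c\<close> and \<open>c'\<close>, and then the common multiple is cancelled on the
  right.\<close>

lemma fracs_functional:
  assumes F: "F \<in> fracs" and xy: "(x, y) \<in> F" "(x, y') \<in> F"
  shows "y = y'"
proof -
  obtain a s where a: "a \<in> carrier A" and s: "s \<in> S" and Fas: "F = frac a s"
    using F by (auto simp: fracs_def)
  obtain t c t' c' where t: "t \<in> S" "t' \<in> S" "c \<in> carrier A" "c' \<in> carrier A"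
    and eq: "x \<otimes> t = s \<otimes> c" "y \<otimes> t = a \<otimes> c" "x \<otimes> t' = s \<otimes> c'" "y' \<otimes> t' = a \<otimes> c'"
    using xy unfolding Fas frac_def mem_Collect_eq case_prod_conv by blast
  note cl = fracs_closed[OF F xy(1)] fracs_closed[OF F xy(2)] a S_closed[OF s] t S_closed[OF t(1)] S_closed[OF t(2)]
  obtain b e where be: "b \<in> S" "e \<in> carrier A" "t \<otimes> b = t' \<otimes> e" "t \<otimes> b \<in> S"
    using common_multiple[OF t(1,2)] .
  note cl = cl be(2) S_closed[OF be(1)]
  have "s \<otimes> (c \<otimes> b) = x \<otimes> (t \<otimes> b)"
    using cl eq(1) by (metis m_assoc)
  also have "\<dots> = s \<otimes> (c' \<otimes> e)"
    using cl eq(3) be(3) by (metis m_assoc)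
  finally have cb: "c \<otimes> b = c' \<otimes> e"
    by (rule S_cancel_left[OF s, rotated 2]) (use cl in simp_all)
  have "y \<otimes> (t \<otimes> b) = a \<otimes> (c \<otimes> b)"
    using cl eq(2) by (metis m_assoc)
  also have "\<dots> = y' \<otimes> (t \<otimes> b)"
    unfolding cb be(3) using cl eq(4) by (metis m_assoc)
  finally show ?thesis
    using S_cancel_right[OF be(4)] cl by blast
qed

text \<open>Together with \<open>fracs_add\<close> this says that a fraction acts as a right
  \<open>A\<close>-linear partial map; the Ore condition moves \<open>z\<close> past the witness
  \<open>t\<close>.\<close>

lemma fracs_mult:
  assumes F: "F \<in> fracs" and xy: "(x, y) \<in> F" and z: "z \<in> carrier A"
  shows "(x \<otimes> z, y \<otimes> z) \<in> F"
proof -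
  obtain a s where a: "a \<in> carrier A" and s: "s \<in> S" and Fas: "F = frac a s"
    using F by (auto simp: fracs_def)
  obtain t c where t: "t \<in> S" "c \<in> carrier A" and eq: "x \<otimes> t = s \<otimes> c" "y \<otimes> t = a \<otimes> c"
    using xy unfolding Fas frac_def mem_Collect_eq case_prod_conv by blast
  obtain m e where m: "m \<in> S" "e \<in> carrier A" "z \<otimes> m = t \<otimes> e"
    using Ore_condition[OF z t(1)] .
  note cl = fracs_closed[OF F xy] z a S_closed[OF s] t(2) S_closed[OF t(1)] S_closed[OF m(1)] m(2)
  have "x \<otimes> z \<otimes> m = s \<otimes> (c \<otimes> e)" "y \<otimes> z \<otimes> m = a \<otimes> (c \<otimes> e)"
    using cl eq m(3) by (metis m_assoc)+
  then show ?thesis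
    unfolding Fas frac_def using cl m(1) by blast
qed

text \<open>If \<open>t\<close> witnesses membership of the multiple by \<open>s\<close>, then
  \<open>s \<otimes> t\<close> witnesses that of (x, y). Graphs are thus closed under cancelling
  elements of \<open>S\<close>.\<close>

lemma fracs_saturated:
  assumes F: "F \<in> fracs" and cl: "x \<in> carrier A" "y \<in> carrier A" and s: "s \<in> S" and xy: "(x \<otimes> s, y \<otimes> s) \<in> F"
  shows "(x, y) \<in> F"
proof -
  obtain a u where a: "a \<in> carrier A" and u: "u \<in> S" and Fau: "F = frac a u"
    using F by (auto simp: fracs_def)
  obtain t c where t: "t \<in> S" "c \<in> carrier A" and eq: "x \<otimes> s \<otimes> t = u \<otimes> c" "y \<otimes> s \<otimes> t = a \<otimes> c"
    using xy unfolding Fau frac_def mem_Collect_eq case_prod_conv by blast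
  have "x \<otimes> (s \<otimes> t) = u \<otimes> c" "y \<otimes> (s \<otimes> t) = a \<otimes> c"
    using eq cl S_closed[OF s] S_closed[OF t(1)] by (simp_all add: m_assoc)
  then show ?thesis
    unfolding Fau frac_def using cl t(2) mult_S[OF s t(1)] by blast
qed

lemma fracs_add:
  assumes F: "F \<in> fracs" and xy: "(x, y) \<in> F" "(x', y') \<in> F"
  shows "(x \<oplus> x', y \<oplus> y') \<in> F"
proof -
  obtain a s where a: "a \<in> carrier A" and s: "s \<in> S" and Fas: "F = frac a s"
    using F by (auto simp: fracs_def)
  obtain t c t' c' where t: "t \<in> S" "t' \<in> S" "c \<in> carrier A" "c' \<in> carrier A"
    and eq: "x \<otimes> t = s \<otimes> c" "y \<otimes> t = a \<otimes> c" "x' \<otimes> t' = s \<otimes> c'" "y' \<otimes> t' = a \<otimes> c'"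
    using xy unfolding Fas frac_def mem_Collect_eq case_prod_conv by blast
  obtain b e where be: "b \<in> S" "e \<in> carrier A" "t \<otimes> b = t' \<otimes> e" "t \<otimes> b \<in> S"
    using common_multiple[OF t(1,2)] .
  note cl = fracs_closed[OF F xy(1)] fracs_closed[OF F xy(2)] a S_closed[OF s] t S_closed[OF t(1)] S_closed[OF t(2)]
    be(2) S_closed[OF be(1)]
  have 1: "x \<otimes> (t \<otimes> b) = s \<otimes> (c \<otimes> b)" "y \<otimes> (t \<otimes> b) = a \<otimes> (c \<otimes> b)"
    using cl eq by (metis m_assoc)+
  have 2: "x' \<otimes> (t \<otimes> b) = s \<otimes> (c' \<otimes> e)" "y' \<otimes> (t \<otimes> b) = a \<otimes> (c' \<otimes> e)"
    unfolding be(3) using cl eq by (metis m_assoc)+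
  have "(x \<oplus> x') \<otimes> (t \<otimes> b) = s \<otimes> (c \<otimes> b \<oplus> c' \<otimes> e)" "(y \<oplus> y') \<otimes> (t \<otimes> b) = a \<otimes> (c \<otimes> b \<oplus> c' \<otimes> e)"
    using cl by (simp_all add: l_distr r_distr 1 2)
  then show ?thesis
    unfolding Fas frac_def using cl be(4) by blast
qed

lemma fracs_dense:
  assumes F: "F \<in> fracs" and z: "z \<in> carrier A"
  obtains t y where "t \<in> S" "(z \<otimes> t, y) \<in> F"
proof -
  obtain a s where a: "a \<in> carrier A" and s: "s \<in> S" and Fas: "F = frac a s"
    using F by (auto simp: fracs_def)
  obtain t c where "t \<in> S" "c \<in> carrier A" "z \<otimes> t = s \<otimes> c"
    using Ore_condition[OF z s] .
  then show thesis
    using that fracs_mult[OF F, of s a c] frac_self[OF a s] Fas by metis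
qed

lemma fracs_dense_S:
  assumes F: "F \<in> fracs" and s: "s \<in> S"
  obtains t y where "t \<in> S" "s \<otimes> t \<in> S" "(s \<otimes> t, y) \<in> F"
  by (rule fracs_dense[OF F S_closed[OF s]]) (use that mult_S[OF s] in blast)

text \<open>A single pair whose first component lies in \<open>S\<close> determines a fraction. One
  inclusion uses the Ore condition and functionality, the other saturation. Equality of fractions
  can therefore be checked at one common denominator.\<close>

lemma fracs_eq_frac:
  assumes F: "F \<in> fracs" and uz: "u \<in> S" "(u, z) \<in> F"
  shows "F = frac z u"
proof (intro equalityI subrelI)
  note cl = fracs_closed[OF F uz(2)]
  fix x y
  {
    assume xy: "(x, y) \<in> F"
    obtain m c where m: "m \<in> S" "c \<in> carrier A" "x \<otimes> m = u \<otimes> c"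
      using Ore_condition[OF fracs_closed(1)[OF F xy] uz(1)] .
    have "(x \<otimes> m, y \<otimes> m) \<in> F" "(u \<otimes> c, z \<otimes> c) \<in> F"
      using fracs_mult[OF F] xy uz m S_closed by blast+
    then have "y \<otimes> m = z \<otimes> c"
      using fracs_functional[OF F] m(3) by metis
    then show "(x, y) \<in> frac z u"
      unfolding frac_def using fracs_closed[OF F xy] m by blast
  }
  {
    assume xy: "(x, y) \<in> frac z u"
    then obtain t c where t: "t \<in> S" "c \<in> carrier A" and eq: "x \<otimes> t = u \<otimes> c" "y \<otimes> t = z \<otimes> c"
      and xyA: "x \<in> carrier A" "y \<in> carrier A"
      unfolding frac_def mem_Collect_eq case_prod_conv by blast
    have "(u \<otimes> c, z \<otimes> c) \<in> F"
      by (rule fracs_mult[OF F uz(2) t(2)])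
    then show "(x, y) \<in> F"
      using fracs_saturated[OF F xyA t(1)] eq by simp
  }
qed

lemma fracs_eqI:
  assumes "F \<in> fracs" "F' \<in> fracs" "u \<in> S" "(u, z) \<in> F" "(u, z) \<in> F'"
  shows "F = F'"
  using fracs_eq_frac[OF assms(1,3,4)] fracs_eq_frac[OF assms(2,3,5)] by simp

text \<open>This is the pointwise sum of partial maps, and \<open>frac_mult\<close> below is their
  composition. The factor \<open>t\<close> saturates the graph, since the sum or composite may at
  first be defined only on a multiple of \<open>x\<close>.\<close>

definition frac_add :: "('a \<times> 'a) set \<Rightarrow> ('a \<times> 'a) set \<Rightarrow> ('a \<times> 'a) set"
  where "frac_add F F' = {(x, y). x \<in> carrier A \<and> y \<in> carrier A \<and>
    (\<exists>t\<in>S. \<exists>z z'. (x \<otimes> t, z) \<in> F \<and> (x \<otimes> t, z') \<in> F' \<and> y \<otimes> t = z \<oplus> z')}"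

definition frac_mult :: "('a \<times> 'a) set \<Rightarrow> ('a \<times> 'a) set \<Rightarrow> ('a \<times> 'a) set"
  where "frac_mult F F' = {(x, y). x \<in> carrier A \<and> y \<in> carrier A \<and>
    (\<exists>t\<in>S. \<exists>z. (x \<otimes> t, z) \<in> F' \<and> (z, y \<otimes> t) \<in> F)}"

lemma frac_add_eq:
  assumes F: "F \<in> fracs" "F' \<in> fracs" and s: "s \<in> S" "(s, a) \<in> F" "(s, a') \<in> F'"
  shows "frac_add F F' = frac (a \<oplus> a') s"
proof (intro equalityI subrelI)
  note cl = S_closed[OF s(1)] fracs_closed(2)[OF F(1) s(2)] fracs_closed(2)[OF F(2) s(3)]
  fix x y
  {
    assume "(x, y) \<in> frac_add F F'"
    then obtain t z z' where t: "t \<in> S" and xy: "x \<in> carrier A" "y \<in> carrier A"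
      and z: "(x \<otimes> t, z) \<in> F" "(x \<otimes> t, z') \<in> F'" "y \<otimes> t = z \<oplus> z'"
      unfolding frac_add_def mem_Collect_eq case_prod_conv by blast
    obtain m c where m: "m \<in> S" "c \<in> carrier A" "x \<otimes> t \<otimes> m = s \<otimes> c"
      using Ore_condition[OF _ s(1), of "x \<otimes> t"] xy S_closed[OF t] by blast
    note mA = S_closed[OF m(1)]
    have "z \<otimes> m = a \<otimes> c"
      using fracs_mult[OF F(1) z(1) mA] fracs_mult[OF F(1) s(2) m(2)] fracs_functional[OF F(1)] m(3) by metis
    moreover have "z' \<otimes> m = a' \<otimes> c"
      using fracs_mult[OF F(2) z(2) mA] fracs_mult[OF F(2) s(3) m(2)] fracs_functional[OF F(2)] m(3) by metis
    moreover have "y \<otimes> (t \<otimes> m) = z \<otimes> m \<oplus> z' \<otimes> m"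
      using xy S_closed[OF t] mA z fracs_closed(2)[OF F(1) z(1)] fracs_closed(2)[OF F(2) z(2)]
      by (simp add: m_assoc[symmetric] l_distr)
    ultimately have "x \<otimes> (t \<otimes> m) = s \<otimes> c" "y \<otimes> (t \<otimes> m) = (a \<oplus> a') \<otimes> c"
      using xy S_closed[OF t] mA m cl by (simp_all add: m_assoc l_distr)
    then show "(x, y) \<in> frac (a \<oplus> a') s"
      unfolding frac_def using xy mult_S[OF t m(1)] m(2) by blast
  }
  {
    assume "(x, y) \<in> frac (a \<oplus> a') s"
    then obtain t c where t: "t \<in> S" "c \<in> carrier A" "x \<otimes> t = s \<otimes> c" "y \<otimes> t = (a \<oplus> a') \<otimes> c"
      and xy: "x \<in> carrier A" "y \<in> carrier A"
      unfolding frac_def mem_Collect_eq case_prod_conv by blast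
    have "(x \<otimes> t, a \<otimes> c) \<in> F" "(x \<otimes> t, a' \<otimes> c) \<in> F'" "y \<otimes> t = a \<otimes> c \<oplus> a' \<otimes> c"
      using fracs_mult[OF F(1) s(2) t(2)] fracs_mult[OF F(2) s(3) t(2)] t cl by (simp_all add: l_distr)
    then show "(x, y) \<in> frac_add F F'"
      unfolding frac_add_def using xy t(1) by blast
  }
qed

text \<open>The chain from \<open>s\<close> to \<open>b\<close> under \<open>F'\<close> and from
  \<open>b\<close> to \<open>a\<close> under \<open>F\<close> computes the composite at the
  denominator \<open>s\<close>, and one value at an element of \<open>S\<close> determines
  it.\<close>

lemma frac_mult_eq:
  assumes F: "F \<in> fracs" "F' \<in> fracs" and s: "s \<in> S" "(s, b) \<in> F'" "(b, a) \<in> F"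
  shows "frac_mult F F' = frac a s"
proof (intro equalityI subrelI)
  note cl = S_closed[OF s(1)] fracs_closed[OF F(1) s(3)]
  fix x y
  {
    assume "(x, y) \<in> frac_mult F F'"
    then obtain t z where t: "t \<in> S" and xy: "x \<in> carrier A" "y \<in> carrier A"
      and z: "(x \<otimes> t, z) \<in> F'" "(z, y \<otimes> t) \<in> F"
      unfolding frac_mult_def mem_Collect_eq case_prod_conv by blast
    obtain m c where m: "m \<in> S" "c \<in> carrier A" "x \<otimes> t \<otimes> m = s \<otimes> c"
      using Ore_condition[OF _ s(1), of "x \<otimes> t"] xy S_closed[OF t] by blast
    note mA = S_closed[OF m(1)]
    have "z \<otimes> m = b \<otimes> c"
      using fracs_mult[OF F(2) z(1) mA] fracs_mult[OF F(2) s(2) m(2)] fracs_functional[OF F(2)] m(3) by metis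
    then have "y \<otimes> t \<otimes> m = a \<otimes> c"
      using fracs_mult[OF F(1) z(2) mA] fracs_mult[OF F(1) s(3) m(2)] fracs_functional[OF F(1)] by metis
    then have "x \<otimes> (t \<otimes> m) = s \<otimes> c" "y \<otimes> (t \<otimes> m) = a \<otimes> c"
      using xy S_closed[OF t] mA m by (simp_all add: m_assoc)
    then show "(x, y) \<in> frac a s"
      unfolding frac_def using xy mult_S[OF t m(1)] m(2) by blast
  }
  {
    assume "(x, y) \<in> frac a s"
    then obtain t c where t: "t \<in> S" "c \<in> carrier A" "x \<otimes> t = s \<otimes> c" "y \<otimes> t = a \<otimes> c"
      and xy: "x \<in> carrier A" "y \<in> carrier A"
      unfolding frac_def mem_Collect_eq case_prod_conv by blast
    have "(x \<otimes> t, b \<otimes> c) \<in> F'" "(b \<otimes> c, y \<otimes> t) \<in> F"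
      using fracs_mult[OF F(2) s(2) t(2)] fracs_mult[OF F(1) s(3) t(2)] t by simp_all
    then show "(x, y) \<in> frac_mult F F'"
      unfolding frac_mult_def using xy t(1) by blast
  }
qed

lemma frac_addI:
  assumes F: "F \<in> fracs" "F' \<in> fracs" and s: "s \<in> S" "(s, a) \<in> F" "(s, a') \<in> F'"
  shows "(s, a \<oplus> a') \<in> frac_add F F'"
  unfolding frac_add_eq[OF assms]
  using frac_self fracs_closed(2)[OF F(1) s(2)] fracs_closed(2)[OF F(2) s(3)] s(1) by simp

lemma frac_multI:
  assumes F: "F \<in> fracs" "F' \<in> fracs" and s: "s \<in> S" "(s, b) \<in> F'" "(b, a) \<in> F"
  shows "(s, a) \<in> frac_mult F F'"
  unfolding frac_mult_eq[OF assms] using frac_self fracs_closed(2)[OF F(1) s(3)] s(1) by simp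

text \<open>Denominators are enlarged one at a time, staying in \<open>S\<close>. Three fractions
  are what associativity of addition requires; fewer are handled by repeating an argument.\<close>

lemma common_denominator_frac:
  assumes F: "F \<in> fracs" "F' \<in> fracs" "F'' \<in> fracs"
  obtains s a a' a'' where "s \<in> S" "(s, a) \<in> F" "(s, a') \<in> F'" "(s, a'') \<in> F''"
proof -
  obtain t a where t: "\<one> \<otimes> t \<in> S" "(\<one> \<otimes> t, a) \<in> F"
    by (rule fracs_dense_S[OF F(1) one_S])
  obtain u a' where u: "u \<in> S" "\<one> \<otimes> t \<otimes> u \<in> S" "(\<one> \<otimes> t \<otimes> u, a') \<in> F'"
    by (rule fracs_dense_S[OF F(2) t(1)])
  obtain v a'' where v: "v \<in> S" "\<one> \<otimes> t \<otimes> u \<otimes> v \<in> S" "(\<one> \<otimes> t \<otimes> u \<otimes> v, a'') \<in> F''"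
    by (rule fracs_dense_S[OF F(3) u(2)])
  show thesis
    using that[OF v(2) _ _ v(3)] fracs_mult[OF F(2) u(3) S_closed[OF v(1)]]
      fracs_mult[OF F(1) fracs_mult[OF F(1) t(2) S_closed[OF u(1)]] S_closed[OF v(1)]] by blast
qed

text \<open>The numerator \<open>b\<close> may lie outside the domain of \<open>F\<close>; enlarging
  the denominator by \<open>t\<close> replaces it by a multiple inside the domain.\<close>

lemma composable_frac:
  assumes F: "F \<in> fracs" "F' \<in> fracs" and s: "s \<in> S" "(s, b) \<in> F'"
  obtains t a where "t \<in> S" "s \<otimes> t \<in> S" "(s \<otimes> t, b \<otimes> t) \<in> F'" "(b \<otimes> t, a) \<in> F"
proof -
  obtain t a where t: "t \<in> S" "(b \<otimes> t, a) \<in> F"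
    using fracs_dense[OF F(1) fracs_closed(2)[OF F(2) s(2)]] .
  show thesis
    using that[OF t(1) mult_S[OF s(1) t(1)] fracs_mult[OF F(2) s(2) S_closed[OF t(1)]] t(2)] .
qed

lemma frac_add_closed:
  assumes "F \<in> fracs" "F' \<in> fracs"
  shows "frac_add F F' \<in> fracs"
proof -
  obtain s a a' where s: "s \<in> S" "(s, a) \<in> F" "(s, a') \<in> F'"
    using common_denominator_frac[OF assms(1,2,2)] by metis
  show ?thesis
    using frac_add_eq[OF assms s] frac_in_fracs s(1) fracs_closed(2)[OF assms(1) s(2)]
      fracs_closed(2)[OF assms(2) s(3)] by simp
qed

lemma frac_mult_closed:
  assumes "F \<in> fracs" "F' \<in> fracs"
  shows "frac_mult F F' \<in> fracs"
proof -
  obtain s b where s: "s \<in> S" "(s, b) \<in> F'"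
    using common_denominator_frac[OF assms(2,2,2)] by metis
  obtain t a where t: "s \<otimes> t \<in> S" "(s \<otimes> t, b \<otimes> t) \<in> F'" "(b \<otimes> t, a) \<in> F"
    using composable_frac[OF assms s] by metis
  show ?thesis
    using frac_mult_eq[OF assms t] frac_in_fracs t(1) fracs_closed(2)[OF assms(1) t(3)] by simp
qed

section \<open>The ring of fractions\<close>

definition ring_of_fractions :: "('a \<times> 'a) set ring"
  where "ring_of_fractions = \<lparr>carrier = fracs, monoid.mult = frac_mult, one = frac \<one> \<one>,
    zero = frac \<zero> \<one>, add = frac_add\<rparr>"

lemma frac_one: "frac \<one> \<one> \<in> fracs" "x \<in> carrier A \<Longrightarrow> (x, x) \<in> frac \<one> \<one>"
proof -
  show 1: "frac \<one> \<one> \<in> fracs" by (simp add: frac_in_fracs one_S)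
  show "(x, x) \<in> frac \<one> \<one>" if "x \<in> carrier A"
    using fracs_mult[OF 1 frac_self[OF one_closed one_S] that] that by simp
qed

lemma frac_zero: "frac \<zero> \<one> \<in> fracs" "x \<in> carrier A \<Longrightarrow> (x, \<zero>) \<in> frac \<zero> \<one>"
proof -
  show 1: "frac \<zero> \<one> \<in> fracs" by (simp add: frac_in_fracs one_S)
  show "(x, \<zero>) \<in> frac \<zero> \<one>" if "x \<in> carrier A"
    using fracs_mult[OF 1 frac_self[OF zero_closed one_S] that] that by simp
qed

lemma abelian_group_ring_of_fractions: "abelian_group ring_of_fractions"
proof (rule abelian_groupI; unfold ring_of_fractions_def ring.simps partial_object.simps)
  fix F F' F'' assume F: "F \<in> fracs" "F' \<in> fracs" "F'' \<in> fracs"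
  obtain s a a' a'' where s: "s \<in> S" "(s, a) \<in> F" "(s, a') \<in> F'" "(s, a'') \<in> F''"
    using common_denominator_frac[OF F] .
  note cl = fracs_closed(2)[OF F(1) s(2)] fracs_closed(2)[OF F(2) s(3)] fracs_closed(2)[OF F(3) s(4)]
  show "frac_add (frac_add F F') F'' = frac_add F (frac_add F' F'')"
  proof (rule fracs_eqI[OF _ _ s(1)])
    show "(s, (a \<oplus> a') \<oplus> a'') \<in> frac_add (frac_add F F') F''"
      by (intro frac_addI frac_add_closed F s)
    have "(s, a \<oplus> (a' \<oplus> a'')) \<in> frac_add F (frac_add F' F'')"
      by (intro frac_addI frac_add_closed F s)
    then show "(s, (a \<oplus> a') \<oplus> a'') \<in> frac_add F (frac_add F' F'')"
      using cl by (simp add: a_assoc)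
  qed (intro frac_add_closed F)+
next
  fix F F' assume F: "F \<in> fracs" "F' \<in> fracs"
  then show "frac_add F F' \<in> fracs" by (rule frac_add_closed)
  obtain s a a' where s: "s \<in> S" "(s, a) \<in> F" "(s, a') \<in> F'"
    using common_denominator_frac[OF F F(2)] by metis
  note cl = fracs_closed(2)[OF F(1) s(2)] fracs_closed(2)[OF F(2) s(3)]
  show "frac_add F F' = frac_add F' F"
    using frac_add_eq[OF F s] frac_add_eq[OF F(2,1) s(1,3,2)] cl by (simp add: a_comm)
next
  show "frac \<zero> \<one> \<in> fracs" by (rule frac_zero)
next
  fix F assume F: "F \<in> fracs"
  obtain s a where s: "s \<in> S" "(s, a) \<in> F"
    using common_denominator_frac[OF F F F] by metis
  note cl = fracs_closed[OF F s(2)]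
  show "frac_add (frac \<zero> \<one>) F = F"
    using frac_add_eq[OF frac_zero(1) F s(1) frac_zero(2) s(2)] cl fracs_eq_frac[OF F s] by simp
  have "frac_add (frac (\<ominus> a) s) F = frac (\<ominus> a \<oplus> a) s"
    using frac_add_eq[OF frac_in_fracs F s(1) frac_self s(2)] cl s(1) by simp
  also have "\<dots> = frac \<zero> \<one>"
    using fracs_eq_frac[OF frac_zero(1) s(1) frac_zero(2)] cl by (simp add: l_neg)
  finally show "\<exists>F'\<in>fracs. frac_add F' F = frac \<zero> \<one>"
    using frac_in_fracs[of "\<ominus> a" s] cl s(1) by blast
qed

lemma ring_ring_of_fractions: "ring ring_of_fractions"
proof (rule ringI[OF abelian_group_ring_of_fractions monoidI];
    unfold ring_of_fractions_def ring.simps partial_object.simps monoid.simps)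
  fix F F' assume F: "F \<in> fracs" "F' \<in> fracs"
  then show "frac_mult F F' \<in> fracs" by (rule frac_mult_closed)
next
  show "frac \<one> \<one> \<in> fracs" by (rule frac_one)
next
  fix F F' F'' assume F: "F \<in> fracs" "F' \<in> fracs" "F'' \<in> fracs"
  obtain s c where s: "s \<in> S" "(s, c) \<in> F''"
    using common_denominator_frac[OF F(3,3,3)] by metis
  obtain t b where t: "t \<in> S" "s \<otimes> t \<in> S" "(s \<otimes> t, c \<otimes> t) \<in> F''" "(c \<otimes> t, b) \<in> F'"
    by (rule composable_frac[OF F(2,3) s])
  obtain u a where u: "u \<in> S" "(b \<otimes> u, a) \<in> F"
    using fracs_dense[OF F(1) fracs_closed(2)[OF F(2) t(4)]] by metis
  note uA = S_closed[OF u(1)]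
  \<comment> \<open>At this denominator all three maps compose: \<open>x\<close> goes to c t u, then
    to b u, then to \<open>a\<close>. Both bracketings are therefore the fraction with numerator
    \<open>a\<close>.\<close>
  define x where "x = s \<otimes> t \<otimes> u"
  have x: "x \<in> S" "(x, c \<otimes> t \<otimes> u) \<in> F''" "(c \<otimes> t \<otimes> u, b \<otimes> u) \<in> F'"
    unfolding x_def using mult_S[OF t(2) u(1)] fracs_mult[OF F(3) t(3) uA] fracs_mult[OF F(2) t(4) uA]
    by auto
  have xb: "(x, b \<otimes> u) \<in> frac_mult F' F''"
    by (rule frac_multI[OF F(2,3) x])
  have 1: "frac_mult F (frac_mult F' F'') = frac a x"
    by (rule frac_mult_eq[OF F(1) frac_mult_closed[OF F(2,3)] x(1) xb u(2)])
  \<comment> \<open>The first component is a numerator and need not lie in \<open>S\<close>, so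
    \<open>frac_multI\<close> is replaced by the definition of the composite with t = 1.\<close>
  have "(c \<otimes> t \<otimes> u, a) \<in> frac_mult F F'"
    unfolding frac_mult_def
    using fracs_closed[OF F(2) x(3)] fracs_closed[OF F(1) u(2)] x(3) u(2) one_S
    by (auto intro!: bexI[of _ \<one>])
  then have 2: "frac_mult (frac_mult F F') F'' = frac a x"
    by (rule frac_mult_eq[OF frac_mult_closed[OF F(1,2)] F(3) x(1,2)])
  show "frac_mult (frac_mult F F') F'' = frac_mult F (frac_mult F' F'')"
    by (simp only: 1 2)
next
  fix F assume F: "F \<in> fracs"
  obtain s a where s: "s \<in> S" "(s, a) \<in> F"
    using common_denominator_frac[OF F F F] by metis
  note cl = fracs_closed[OF F s(2)]
  show "frac_mult (frac \<one> \<one>) F = F"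
    using frac_mult_eq[OF frac_one(1) F s frac_one(2)] fracs_eq_frac[OF F s] cl by simp
  show "frac_mult F (frac \<one> \<one>) = F"
    using frac_mult_eq[OF F frac_one(1) s(1) frac_one(2) s(2)] fracs_eq_frac[OF F s] cl by simp
next
  fix F F' F'' assume F: "F \<in> fracs" "F' \<in> fracs" "F'' \<in> fracs"
  obtain s c where s: "s \<in> S" "(s, c) \<in> F''"
    using common_denominator_frac[OF F(3,3,3)] by metis
  obtain t a where t: "t \<in> S" "s \<otimes> t \<in> S" "(s \<otimes> t, c \<otimes> t) \<in> F''" "(c \<otimes> t, a) \<in> F"
    by (rule composable_frac[OF F(1,3) s])
  obtain u b where u: "u \<in> S" "s \<otimes> t \<otimes> u \<in> S" "(s \<otimes> t \<otimes> u, c \<otimes> t \<otimes> u) \<in> F''" "(c \<otimes> t \<otimes> u, b) \<in> F'"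
    by (rule composable_frac[OF F(2,3) t(2,3)])
  define x d where "x = s \<otimes> t \<otimes> u" and "d = c \<otimes> t \<otimes> u"
  have x: "x \<in> S" "(x, d) \<in> F''" "(d, a \<otimes> u) \<in> F" "(d, b) \<in> F'"
    unfolding x_def d_def using u fracs_mult[OF F(1) t(4) S_closed[OF u(1)]] by auto
  note cl = fracs_closed[OF F(1) x(3)] fracs_closed[OF F(2) x(4)]
  \<comment> \<open>Again \<open>d\<close> is a numerator that need not lie in \<open>S\<close>, so
    the sum is evaluated there from its definition with t = 1.\<close>
  have "\<exists>z z'. (d \<otimes> \<one>, z) \<in> F \<and> (d \<otimes> \<one>, z') \<in> F' \<and> (a \<otimes> u \<oplus> b) \<otimes> \<one> = z \<oplus> z'"
    by (rule exI[of _ "a \<otimes> u"], rule exI[of _ b]) (use cl x(3,4) in simp)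
  then have "(d, a \<otimes> u \<oplus> b) \<in> frac_add F F'"
    unfolding frac_add_def using cl one_S by blast
  then have 1: "frac_mult (frac_add F F') F'' = frac (a \<otimes> u \<oplus> b) x"
    by (rule frac_mult_eq[OF frac_add_closed[OF F(1,2)] F(3) x(1,2)])
  have 2: "frac_add (frac_mult F F'') (frac_mult F' F'') = frac (a \<otimes> u \<oplus> b) x"
    by (intro frac_add_eq frac_multI frac_mult_closed F x) (rule x)+
  show "frac_mult (frac_add F F') F'' = frac_add (frac_mult F F'') (frac_mult F' F'')"
    by (simp only: 1 2)
next
  fix F F' F'' assume F: "F \<in> fracs" "F' \<in> fracs" "F'' \<in> fracs"
  obtain s a b where s: "s \<in> S" "(s, a) \<in> F" "(s, b) \<in> F'"
    using common_denominator_frac[OF F(1,2,2)] by metis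
  obtain t c where t: "t \<in> S" "s \<otimes> t \<in> S" "(s \<otimes> t, a \<otimes> t) \<in> F" "(a \<otimes> t, c) \<in> F''"
    by (rule composable_frac[OF F(3,1) s(1,2)])
  have bt: "(s \<otimes> t, b \<otimes> t) \<in> F'"
    by (rule fracs_mult[OF F(2) s(3) S_closed[OF t(1)]])
  obtain u d where u: "u \<in> S" "s \<otimes> t \<otimes> u \<in> S" "(s \<otimes> t \<otimes> u, b \<otimes> t \<otimes> u) \<in> F'" "(b \<otimes> t \<otimes> u, d) \<in> F''"
    by (rule composable_frac[OF F(3,2) t(2) bt])
  note uA = S_closed[OF u(1)]
  define x where "x = s \<otimes> t \<otimes> u"
  have x: "x \<in> S" "(x, a \<otimes> t \<otimes> u) \<in> F" "(x, b \<otimes> t \<otimes> u) \<in> F'"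
      "(a \<otimes> t \<otimes> u, c \<otimes> u) \<in> F''" "(b \<otimes> t \<otimes> u, d) \<in> F''"
    unfolding x_def using u fracs_mult[OF F(1) t(3) uA] fracs_mult[OF F(3) t(4) uA] by auto
  have 1: "frac_mult F'' (frac_add F F') = frac (c \<otimes> u \<oplus> d) x"
    by (rule frac_mult_eq[OF F(3) frac_add_closed[OF F(1,2)] x(1) frac_addI[OF F(1,2) x(1-3)]
          fracs_add[OF F(3) x(4,5)]])
  have 2: "frac_add (frac_mult F'' F) (frac_mult F'' F') = frac (c \<otimes> u \<oplus> d) x"
    by (rule frac_add_eq[OF frac_mult_closed[OF F(3,1)] frac_mult_closed[OF F(3,2)] x(1)
          frac_multI[OF F(3,1) x(1,2,4)] frac_multI[OF F(3,2) x(1,3,5)]])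
  show "frac_mult F'' (frac_add F F') = frac_add (frac_mult F'' F) (frac_mult F'' F')"
    by (simp only: 1 2)
qed

theorem right_Ore_localization_ring_of_fractions:
  "right_Ore_localization A S ring_of_fractions (\<lambda>a. frac a \<one>)"
proof -
  interpret R: ring ring_of_fractions by (rule ring_ring_of_fractions)
  have R: "carrier ring_of_fractions = fracs" "mult ring_of_fractions = frac_mult"
      "\<one>\<^bsub>ring_of_fractions\<^esub> = frac \<one> \<one>" "\<zero>\<^bsub>ring_of_fractions\<^esub> = frac \<zero> \<one>" "add ring_of_fractions = frac_add"
    by (simp_all add: ring_of_fractions_def)
  have f: "frac a \<one> \<in> fracs" "(\<one>, a) \<in> frac a \<one>" if "a \<in> carrier A" for a
    using that frac_in_fracs one_S frac_self by auto
  \<comment> \<open>The image of \<open>a\<close> acts as left multiplication by \<open>a\<close>,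
    defined on all of \<open>A\<close>.\<close>
  have f': "(b, a \<otimes> b) \<in> frac a \<one>" if "a \<in> carrier A" "b \<in> carrier A" for a b
    using fracs_mult[OF f[OF that(1)] that(2)] that by simp
  have hom: "(\<lambda>a. frac a \<one>) \<in> ring_hom A ring_of_fractions"
  proof (rule ring_hom_memI; unfold R)
    fix a b assume a: "a \<in> carrier A" and b: "b \<in> carrier A"
    show "frac (a \<otimes> b) \<one> = frac_mult (frac a \<one>) (frac b \<one>)"
      using frac_mult_eq[OF f(1)[OF a] f(1)[OF b] one_S f(2)[OF b] f'[OF a b]] by simp
    show "frac (a \<oplus> b) \<one> = frac_add (frac a \<one>) (frac b \<one>)"
      using frac_add_eq[OF f(1)[OF a] f(1)[OF b] one_S f(2)[OF a] f(2)[OF b]] by simp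
  qed (simp_all add: f)
  have inv: "frac_mult (frac s \<one>) (frac \<one> s) = frac \<one> \<one>" "frac_mult (frac \<one> s) (frac s \<one>) = frac \<one> \<one>"
    if s: "s \<in> S" for s
  proof -
    note sA = S_closed[OF s]
    have 1: "frac \<one> s \<in> fracs" "(s, \<one>) \<in> frac \<one> s"
      using s by (simp_all add: frac_in_fracs frac_self)
    have "frac_mult (frac s \<one>) (frac \<one> s) = frac s s"
      by (rule frac_mult_eq[OF f(1)[OF sA] 1(1) s 1(2) f(2)[OF sA]])
    then show "frac_mult (frac s \<one>) (frac \<one> s) = frac \<one> \<one>"
      using fracs_eq_frac[OF frac_one(1) s frac_one(2)[OF sA]] by simp
    show "frac_mult (frac \<one> s) (frac s \<one>) = frac \<one> \<one>"
      by (rule frac_mult_eq[OF 1(1) f(1)[OF sA] one_S f(2)[OF sA] 1(2)])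
  qed
  have unit: "frac s \<one> \<in> Units ring_of_fractions" if s: "s \<in> S" for s
    unfolding Units_def R using inv[OF s] f(1)[OF S_closed[OF s]] frac_in_fracs[OF one_closed s] by blast
  have "r = frac a \<one> \<otimes>\<^bsub>ring_of_fractions\<^esub> inv\<^bsub>ring_of_fractions\<^esub> (frac s \<one>)"
    if r: "r = frac a s" and a: "a \<in> carrier A" and s: "s \<in> S" for r a s
  proof -
    have 1: "frac \<one> s \<in> fracs" "(s, \<one>) \<in> frac \<one> s"
      using s by (simp_all add: frac_in_fracs frac_self)
    have "inv\<^bsub>ring_of_fractions\<^esub> (frac s \<one>) = frac \<one> s"
      by (rule R.inv_unique'[symmetric]; unfold R) (use inv[OF s] 1 f(1)[OF S_closed[OF s]] in simp_all)
    then show ?thesis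
      unfolding R r using frac_mult_eq[OF f(1)[OF a] 1(1) s 1(2) f(2)[OF a]] by simp
  qed
  then have repr: "\<forall>r\<in>carrier ring_of_fractions. \<exists>a\<in>carrier A. \<exists>s\<in>S.
      r = frac a \<one> \<otimes>\<^bsub>ring_of_fractions\<^esub> inv\<^bsub>ring_of_fractions\<^esub> (frac s \<one>)"
    unfolding R(1) fracs_def by blast
  \<comment> \<open>Both sets are zero: the left one because the value at 1 recovers
    \<open>a\<close>, the right one because \<open>S\<close> consists of non-zero divisors.\<close>
  have ker: "{a \<in> carrier A. frac a \<one> = \<zero>\<^bsub>ring_of_fractions\<^esub>} = {a \<in> carrier A. \<exists>s\<in>S. a \<otimes> s = \<zero>}"
  proof -
    have "frac a \<one> = frac \<zero> \<one> \<longleftrightarrow> a = \<zero>" if "a \<in> carrier A" for a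
      using fracs_functional[OF frac_zero(1), of \<one> a \<zero>] f[OF that] f(2)[OF zero_closed] by auto
    moreover have "(\<exists>s\<in>S. a \<otimes> s = \<zero>) \<longleftrightarrow> a = \<zero>" if "a \<in> carrier A" for a
      using S_cancel_right[OF _ that zero_closed] S_closed one_S by fastforce
    ultimately show ?thesis unfolding R by blast
  qed
  show ?thesis
    unfolding right_Ore_localization_def using R.ring_axioms hom unit repr ker by blast
qed

end

section \<open>Tensor products with an Ore localization\<close>

text \<open>The localization is an arbitrary model of the definition, so that the results on tensor
  products hold for each of them and not only for the ring of graphs.\<close>

locale right_Ore_quotient = right_Ore A S
  for A :: "('a, 'b) ring_scheme" (structure) and S +
  fixes R :: "('r, 'c) ring_scheme" and \<phi> :: "'a \<Rightarrow> 'r"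
  assumes localization: "right_Ore_localization A S R \<phi>"
begin

sublocale R: ring R
  using localization by (simp add: right_Ore_localization_def)

abbreviation M :: "('a, 'r) module"
  where "M \<equiv> left_module_via \<phi> R"

lemma M_simps [simp]:
  "carrier M = carrier R" "x \<oplus>\<^bsub>M\<^esub> y = x \<oplus>\<^bsub>R\<^esub> y" "\<zero>\<^bsub>M\<^esub> = \<zero>\<^bsub>R\<^esub>" "a \<odot>\<^bsub>M\<^esub> x = \<phi> a \<otimes>\<^bsub>R\<^esub> x"
  by (simp_all add: left_module_via_def)

lemma \<phi>_hom: "\<phi> \<in> ring_hom A R"
  using localization by (simp add: right_Ore_localization_def)

lemmas \<phi>_closed = ring_hom_closed[OF \<phi>_hom]
  and \<phi>_mult = ring_hom_mult[OF \<phi>_hom]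
  and \<phi>_add = ring_hom_add[OF \<phi>_hom]
  and \<phi>_one = ring_hom_one[OF \<phi>_hom]

lemma \<phi>_Units: "s \<in> S \<Longrightarrow> \<phi> s \<in> Units R"
  using localization by (simp add: right_Ore_localization_def)

abbreviation inv\<phi> :: "'a \<Rightarrow> 'r"
  where "inv\<phi> s \<equiv> inv\<^bsub>R\<^esub> (\<phi> s)"

lemma inv\<phi>_closed: "s \<in> S \<Longrightarrow> inv\<phi> s \<in> carrier R"
  using \<phi>_Units by (rule R.Units_inv_closed)

lemma inv\<phi>_l: "s \<in> S \<Longrightarrow> inv\<phi> s \<otimes>\<^bsub>R\<^esub> \<phi> s = \<one>\<^bsub>R\<^esub>"
  using \<phi>_Units by (rule R.Units_l_inv)

lemma inv\<phi>_r: "s \<in> S \<Longrightarrow> \<phi> s \<otimes>\<^bsub>R\<^esub> inv\<phi> s = \<one>\<^bsub>R\<^esub>"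
  using \<phi>_Units by (rule R.Units_r_inv)

lemma fraction:
  assumes "r \<in> carrier R"
  obtains a s where "a \<in> carrier A" "s \<in> S" "r = \<phi> a \<otimes>\<^bsub>R\<^esub> inv\<phi> s"
  using localization assms by (auto simp: right_Ore_localization_def)

lemma \<phi>_eq_zero:
  assumes "a \<in> carrier A" "\<phi> a = \<zero>\<^bsub>R\<^esub>"
  shows "a = \<zero>"
proof -
  have "a \<in> {a \<in> carrier A. \<exists>l\<in>S. a \<otimes> l = \<zero>}"
    using localization assms unfolding right_Ore_localization_def by blast
  then obtain l where l: "l \<in> S" "a \<otimes> l = \<zero>" by blast
  then have "a \<otimes> l = \<zero> \<otimes> l"
    using S_closed by simp
  then show ?thesis
    by (rule S_cancel_right[OF l(1) assms(1) zero_closed])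
qed

lemma \<phi>_inj: "inj_on \<phi> (carrier A)"
proof (rule inj_onI)
  fix x y assume x: "x \<in> carrier A" and y: "y \<in> carrier A" and eq: "\<phi> x = \<phi> y"
  have "\<phi> (x \<ominus> y) \<oplus>\<^bsub>R\<^esub> \<phi> y = \<phi> y"
    using x y eq by (simp add: \<phi>_add[symmetric] minus_eq a_assoc l_neg)
  then have "\<phi> (x \<ominus> y) = \<zero>\<^bsub>R\<^esub>"
    using x y \<phi>_closed by (metis R.add.r_cancel_one minus_closed)
  then have "x \<ominus> y = \<zero>"
    using x y by (intro \<phi>_eq_zero) simp_all
  then show "x = y"
    by (rule eq_if_minus_eq_zero[OF x y])
qed

text \<open>This expands the fraction 1/s to b/(s b). Only s b has to lie in \<open>S\<close>,
  matching what \<open>common_multiple\<close> provides.\<close>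

lemma inv\<phi>_eq:
  assumes s: "s \<in> S" and b: "b \<in> carrier A" and sb: "s \<otimes> b \<in> S"
  shows "inv\<phi> s = \<phi> b \<otimes>\<^bsub>R\<^esub> inv\<phi> (s \<otimes> b)"
proof -
  note cl = inv\<phi>_closed[OF s] inv\<phi>_closed[OF sb] \<phi>_closed[OF b] \<phi>_closed[OF S_closed[OF s]]
  have "inv\<phi> s = inv\<phi> s \<otimes>\<^bsub>R\<^esub> (\<phi> (s \<otimes> b) \<otimes>\<^bsub>R\<^esub> inv\<phi> (s \<otimes> b))"
    using inv\<phi>_r[OF sb] cl by simp
  also have "\<dots> = (inv\<phi> s \<otimes>\<^bsub>R\<^esub> \<phi> s) \<otimes>\<^bsub>R\<^esub> \<phi> b \<otimes>\<^bsub>R\<^esub> inv\<phi> (s \<otimes> b)"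
    using cl by (simp add: \<phi>_mult[OF S_closed[OF s] b] R.m_assoc)
  also have "\<dots> = \<phi> b \<otimes>\<^bsub>R\<^esub> inv\<phi> (s \<otimes> b)"
    using inv\<phi>_l[OF s] cl by simp
  finally show ?thesis .
qed

lemma left_module_M: "left_module A M"
proof (intro left_module.intro left_module_axioms.intro)
  show "ring A" by (rule ring_axioms)
  show "abelian_group M"
  proof (rule abelian_groupI; unfold M_simps)
    fix x assume "x \<in> carrier R"
    then show "\<exists>y\<in>carrier R. y \<oplus>\<^bsub>R\<^esub> x = \<zero>\<^bsub>R\<^esub>"
      using R.l_neg by blast
  qed (simp_all add: R.a_ac)
qed (simp_all add: \<phi>_closed \<phi>_add \<phi>_mult \<phi>_one R.l_distr R.r_distr R.m_assoc)

text \<open>If r is the fraction a/s, then r (s b) is the image of a b. The claim covers all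
  multiples of \<open>s\<close> in \<open>S\<close>, so that the denominators of several elements
  can be combined by passing to a common multiple.\<close>

lemma denominator:
  assumes "r \<in> carrier R"
  obtains s where "s \<in> S" "\<And>b. b \<in> carrier A \<Longrightarrow> s \<otimes> b \<in> S \<Longrightarrow> r \<otimes>\<^bsub>R\<^esub> \<phi> (s \<otimes> b) \<in> \<phi> ` carrier A"
proof -
  obtain a s where a: "a \<in> carrier A" and s: "s \<in> S" and r: "r = \<phi> a \<otimes>\<^bsub>R\<^esub> inv\<phi> s"
    using fraction[OF assms] .
  have "r \<otimes>\<^bsub>R\<^esub> \<phi> (s \<otimes> b) = \<phi> (a \<otimes> b)" if b: "b \<in> carrier A" for b
  proof -
    note cl = inv\<phi>_closed[OF s] \<phi>_closed[OF a] \<phi>_closed[OF b] \<phi>_closed[OF S_closed[OF s]]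
    have "r \<otimes>\<^bsub>R\<^esub> \<phi> (s \<otimes> b) = \<phi> a \<otimes>\<^bsub>R\<^esub> ((inv\<phi> s \<otimes>\<^bsub>R\<^esub> \<phi> s) \<otimes>\<^bsub>R\<^esub> \<phi> b)"
      unfolding r using cl by (simp add: \<phi>_mult[OF S_closed[OF s] b] R.m_assoc)
    then show ?thesis
      using inv\<phi>_l[OF s] cl a b by (simp add: \<phi>_mult)
  qed
  then show thesis
    using that[OF s] a by blast
qed

section \<open>Tensor relations and elementary tensors\<close>

abbreviation relations :: "('a, 'n, 'd) module_scheme \<Rightarrow> ('n \<times> 'r \<Rightarrow>\<^sub>0 int) set"
  where "relations N \<equiv> tensor_relations A N M"

abbreviation generators :: "('a, 'n, 'd) module_scheme \<Rightarrow> ('n \<times> 'r \<Rightarrow>\<^sub>0 int) set"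
  where "generators N \<equiv>
     {frag_of (x \<oplus>\<^bsub>N\<^esub> y, u) - frag_of (x, u) - frag_of (y, u) | x y u.
         x \<in> carrier N \<and> y \<in> carrier N \<and> u \<in> carrier M}
      \<union> {frag_of (x, u \<oplus>\<^bsub>M\<^esub> v) - frag_of (x, u) - frag_of (x, v) | x u v.
         x \<in> carrier N \<and> u \<in> carrier M \<and> v \<in> carrier M}
      \<union> {frag_of (a \<odot>\<^bsub>N\<^esub> x, u) - frag_of (x, a \<odot>\<^bsub>M\<^esub> u) | a x u.
         a \<in> carrier A \<and> x \<in> carrier N \<and> u \<in> carrier M}"

lemma right_moduleD:
  assumes "right_module A N"
  shows "abelian_group N"
    and "\<And>a x. a \<in> carrier A \<Longrightarrow> x \<in> carrier N \<Longrightarrow> a \<odot>\<^bsub>N\<^esub> x \<in> carrier N"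
    and "\<And>x y. x \<in> carrier N \<Longrightarrow> y \<in> carrier N \<Longrightarrow> x \<oplus>\<^bsub>N\<^esub> y \<in> carrier N"
    and "\<And>a. a \<in> carrier A \<Longrightarrow> a \<odot>\<^bsub>N\<^esub> \<zero>\<^bsub>N\<^esub> = \<zero>\<^bsub>N\<^esub>"
proof -
  show N: "abelian_group N"
    using assms by (simp add: right_module_def)
  show "a \<odot>\<^bsub>N\<^esub> x \<in> carrier N" if "a \<in> carrier A" "x \<in> carrier N" for a x
    using right_module.smult_closed[OF assms that] .
  interpret N: abelian_group N by (rule N)
  show "x \<oplus>\<^bsub>N\<^esub> y \<in> carrier N" if "x \<in> carrier N" "y \<in> carrier N" for x y
    using that by simp
  fix a assume a: "a \<in> carrier A"
  have "a \<odot>\<^bsub>N\<^esub> \<zero>\<^bsub>N\<^esub> = a \<odot>\<^bsub>N\<^esub> \<zero>\<^bsub>N\<^esub> \<oplus>\<^bsub>N\<^esub> a \<odot>\<^bsub>N\<^esub> \<zero>\<^bsub>N\<^esub>"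
    using right_module.smult_r_distr[OF assms a N.zero_closed N.zero_closed] by simp
  then show "a \<odot>\<^bsub>N\<^esub> \<zero>\<^bsub>N\<^esub> = \<zero>\<^bsub>N\<^esub>"
    using right_module.smult_closed[OF assms a N.zero_closed] by (metis N.add.r_cancel_one')
qed

lemma keys_frag_diff2:
  "x \<in> T \<Longrightarrow> y \<in> T \<Longrightarrow> Poly_Mapping.keys (frag_of x - frag_of y) \<subseteq> T"
  "x \<in> T \<Longrightarrow> y \<in> T \<Longrightarrow> z \<in> T \<Longrightarrow> Poly_Mapping.keys (frag_of x - frag_of y - frag_of z) \<subseteq> T"
proof -
  show 1: "Poly_Mapping.keys (frag_of x - frag_of y) \<subseteq> T" if "x \<in> T" "y \<in> T" for x y
    using keys_diff[of "frag_of x" "frag_of y"] that by auto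
  show "Poly_Mapping.keys (frag_of x - frag_of y - frag_of z) \<subseteq> T" if "x \<in> T" "y \<in> T" "z \<in> T"
    using keys_diff[of "frag_of x - frag_of y" "frag_of z"] 1[OF that(1,2)] that(3) by auto
qed

lemma generators_subset:
  assumes "right_module A N"
  shows "generators N \<subseteq> carrier (free_Abelian_group (carrier N \<times> carrier M))"
  unfolding M_simps
proof (rule subsetI, unfold carrier_free_Abelian_group_iff, elim UnE CollectE exE conjE; hypsubst)
qed (intro keys_frag_diff2 SigmaI right_moduleD(2,3)[OF assms] R.a_closed R.m_closed \<phi>_closed; assumption)+

lemma subgroup_relations:
  assumes "right_module A N"
  shows "subgroup (relations N) (free_Abelian_group (carrier N \<times> carrier M))"
  unfolding tensor_relations_def
  by (rule group.generate_is_subgroup[OF group_free_Abelian_group generators_subset[OF assms]])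

lemma relations_keys:
  assumes "right_module A N" "c \<in> relations N"
  shows "Poly_Mapping.keys c \<subseteq> carrier N \<times> carrier R"
  using subsetD[OF subgroup.subset[OF subgroup_relations[OF assms(1)]] assms(2)] by simp

lemma relations_zero: "0 \<in> relations N"
  using generate.one[of "free_Abelian_group (carrier N \<times> carrier M)" "generators N"]
  by (simp add: tensor_relations_def)

lemma relations_add: "c \<in> relations N \<Longrightarrow> d \<in> relations N \<Longrightarrow> c + d \<in> relations N"
  unfolding tensor_relations_def
  using generate.eng[of c "free_Abelian_group (carrier N \<times> carrier M)" "generators N" d] by simp

lemma relations_minus:
  assumes N: "right_module A N" and c: "c \<in> relations N"
  shows "- c \<in> relations N"
  using subgroup.m_inv_closed[OF subgroup_relations[OF N] c] relations_keys[OF N c] by simp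

lemma relations_diff:
  assumes N: "right_module A N" and c: "c \<in> relations N" "d \<in> relations N"
  shows "c - d \<in> relations N"
  using relations_add[OF c(1) relations_minus[OF N c(2)]] by simp

lemma relations_incl: "c \<in> generators N \<Longrightarrow> c \<in> relations N"
  unfolding tensor_relations_def by (rule generate.incl)

lemma relations_add_left:
  assumes "x \<in> carrier N" "y \<in> carrier N" "u \<in> carrier R"
  shows "frag_of (x \<oplus>\<^bsub>N\<^esub> y, u) - frag_of (x, u) - frag_of (y, u) \<in> relations N"
  by (rule relations_incl) (use assms in \<open>unfold M_simps, blast\<close>)

lemma relations_balanced:
  assumes "a \<in> carrier A" "x \<in> carrier N" "u \<in> carrier R"
  shows "frag_of (a \<odot>\<^bsub>N\<^esub> x, u) - frag_of (x, \<phi> a \<otimes>\<^bsub>R\<^esub> u) \<in> relations N"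
  by (rule relations_incl) (use assms in \<open>unfold M_simps, blast\<close>)

text \<open>Additivity in the left argument for 0 + 0 = 0 yields the negative of this element as a
  relation.\<close>

lemma relations_zero_left:
  assumes N: "right_module A N" and u: "u \<in> carrier R"
  shows "frag_of (\<zero>\<^bsub>N\<^esub>, u) \<in> relations N"
proof -
  interpret N: abelian_group N by (rule right_moduleD(1)[OF N])
  have "- frag_of (\<zero>\<^bsub>N\<^esub>, u) \<in> relations N"
    using relations_add_left[of "\<zero>\<^bsub>N\<^esub>" N "\<zero>\<^bsub>N\<^esub>" u] u by simp
  from relations_minus[OF N this] show ?thesis by simp
qed

text \<open>Since \<open>t\<close> is a unit in \<open>R\<close>, u = t (t^-1 u); balancing moves
  \<open>t\<close> to the left factor, where it kills \<open>x\<close>.\<close>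

lemma torsion_relation:
  assumes N: "right_module A N" and x: "x \<in> carrier N" and u: "u \<in> carrier R"
    and t: "t \<in> S" "t \<odot>\<^bsub>N\<^esub> x = \<zero>\<^bsub>N\<^esub>"
  shows "frag_of (x, u) \<in> relations N"
proof -
  note cl = \<phi>_closed[OF S_closed[OF t(1)]] inv\<phi>_closed[OF t(1)] u
  have eq: "\<phi> t \<otimes>\<^bsub>R\<^esub> (inv\<phi> t \<otimes>\<^bsub>R\<^esub> u) = u"
    using cl inv\<phi>_r[OF t(1)] by (simp add: R.m_assoc[symmetric])
  have "frag_of (\<zero>\<^bsub>N\<^esub>, inv\<phi> t \<otimes>\<^bsub>R\<^esub> u) - frag_of (x, u) \<in> relations N"
    using relations_balanced[OF S_closed[OF t(1)] x, of "inv\<phi> t \<otimes>\<^bsub>R\<^esub> u"] cl t(2) eq by simp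
  moreover have "frag_of (\<zero>\<^bsub>N\<^esub>, inv\<phi> t \<otimes>\<^bsub>R\<^esub> u) \<in> relations N"
    using relations_zero_left[OF N] cl by simp
  ultimately have "frag_of (\<zero>\<^bsub>N\<^esub>, inv\<phi> t \<otimes>\<^bsub>R\<^esub> u) - (frag_of (\<zero>\<^bsub>N\<^esub>, inv\<phi> t \<otimes>\<^bsub>R\<^esub> u) - frag_of (x, u)) \<in> relations N"
    using relations_diff[OF N] by blast
  then show ?thesis by simp
qed

lemma relation_to_multiple:
  assumes N: "right_module A N" and x: "x \<in> carrier N"
    and s: "s \<in> S" and b: "b \<in> carrier A" and sb: "s \<otimes> b \<in> S"
  shows "frag_of (x, inv\<phi> s) - frag_of (b \<odot>\<^bsub>N\<^esub> x, inv\<phi> (s \<otimes> b)) \<in> relations N"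
  using relations_minus[OF N relations_balanced[OF b x inv\<phi>_closed[OF sb]]]
  by (simp add: inv\<phi>_eq[OF s b sb])

text \<open>The numerator of a fraction moves into the left factor. Two elementary tensors are
  expanded to a common denominator by \<open>relation_to_multiple\<close>, after which the left
  factors can be subtracted.\<close>

lemma tensor_is_elementary:
  assumes N: "right_module A N" and c: "Poly_Mapping.keys c \<subseteq> carrier N \<times> carrier R"
  shows "\<exists>x\<in>carrier N. \<exists>s\<in>S. c - frag_of (x, inv\<phi> s) \<in> relations N"
  using c
proof (induction c rule: frag_induction)
  interpret N: abelian_group N by (rule right_moduleD(1)[OF N])
  case zero
  show ?case
    using relations_minus[OF N relations_zero_left[OF N inv\<phi>_closed[OF one_S]]] one_S
    by (intro bexI[of _ "\<zero>\<^bsub>N\<^esub>"] bexI[of _ \<one>]) simp_all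
next
  case (one p)
  obtain x r where p: "p = (x, r)" "x \<in> carrier N" "r \<in> carrier R"
    using one by auto
  obtain a s where a: "a \<in> carrier A" and s: "s \<in> S" and r: "r = \<phi> a \<otimes>\<^bsub>R\<^esub> inv\<phi> s"
    using fraction[OF p(3)] .
  have "frag_of p - frag_of (a \<odot>\<^bsub>N\<^esub> x, inv\<phi> s) \<in> relations N"
    using relations_minus[OF N relations_balanced[OF a p(2) inv\<phi>_closed[OF s]]] by (simp add: p r)
  then show ?case
    using s right_moduleD(2)[OF N a p(2)] by blast
next
  interpret N: abelian_group N by (rule right_moduleD(1)[OF N])
  case (diff c d)
  obtain x s where x: "x \<in> carrier N" "s \<in> S" "c - frag_of (x, inv\<phi> s) \<in> relations N"
    using diff by blast
  obtain y t where y: "y \<in> carrier N" "t \<in> S" "d - frag_of (y, inv\<phi> t) \<in> relations N"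
    using diff by blast
  obtain b e where b: "b \<in> S" "e \<in> carrier A" "s \<otimes> b = t \<otimes> e" "s \<otimes> b \<in> S"
    using common_multiple[OF x(2) y(2)] .
  define v x' y' z where "v = inv\<phi> (s \<otimes> b)" and "x' = b \<odot>\<^bsub>N\<^esub> x" and "y' = e \<odot>\<^bsub>N\<^esub> y" and "z = x' \<ominus>\<^bsub>N\<^esub> y'"
  have cl: "x' \<in> carrier N" "y' \<in> carrier N"
    unfolding x'_def y'_def using right_moduleD(2)[OF N] S_closed[OF b(1)] b(2) x(1) y(1) by simp_all
  have z: "z \<in> carrier N" "z \<oplus>\<^bsub>N\<^esub> y' = x'"
    using cl by (simp_all add: z_def N.minus_eq N.a_assoc N.l_neg)
  have 1: "frag_of (x, inv\<phi> s) - frag_of (x', v) \<in> relations N"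
    unfolding x'_def v_def by (rule relation_to_multiple[OF N x(1,2) S_closed[OF b(1)] b(4)])
  have 2: "frag_of (y, inv\<phi> t) - frag_of (y', v) \<in> relations N"
    using relation_to_multiple[OF N y(1,2) b(2)] b(3,4) by (simp add: y'_def v_def)
  have 3: "frag_of (x', v) - frag_of (z, v) - frag_of (y', v) \<in> relations N"
    using relations_add_left[OF z(1) cl(2), of v] z(2) inv\<phi>_closed[OF b(4)] by (simp add: v_def)
  have "(c - frag_of (x, inv\<phi> s)) + (frag_of (x, inv\<phi> s) - frag_of (x', v))
      + (frag_of (x', v) - frag_of (z, v) - frag_of (y', v))
      - ((d - frag_of (y, inv\<phi> t)) + (frag_of (y, inv\<phi> t) - frag_of (y', v))) \<in> relations N"
    by (intro relations_diff[OF N] relations_add x y 1 2 3)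
  then have "(c - d) - frag_of (z, v) \<in> relations N"
    by (simp add: algebra_simps)
  then show ?case
    using z(1) b(4) unfolding v_def by blast
qed

text \<open>For every \<open>t \<in> S\<close> there is a homomorphism sending \<open>(x, r)\<close> to \<open>x \<cdot> (r t)\<close> if \<open>r t \<in> A\<close>.
  On each tensor relation these vanish for all sufficiently divisible \<open>t\<close>.\<close>

lemma elementary_tensor_eq_zero:
  assumes N: "right_module A N" and y: "y \<in> carrier N" and s: "s \<in> S"
    and rel: "frag_of (y, inv\<phi> s) \<in> relations N"
  shows "\<exists>t\<in>S. t \<odot>\<^bsub>N\<^esub> y = \<zero>\<^bsub>N\<^esub>"
proof -
  interpret N: abelian_group N by (rule right_moduleD(1)[OF N])
  note N_simps = right_moduleD(2)[OF N]
  have cancel: "p \<oplus>\<^bsub>N\<^esub> q \<ominus>\<^bsub>N\<^esub> p \<ominus>\<^bsub>N\<^esub> q = \<zero>\<^bsub>N\<^esub>" if "p \<in> carrier N" "q \<in> carrier N" for p q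
    using that by (simp add: N.minus_eq N.a_comm[of p q] N.a_assoc N.r_neg)
  define FN where "FN = free_Abelian_group (carrier N \<times> carrier R)"
  define \<psi> where "\<psi> = inv_into (carrier A) \<phi>"
  have \<psi>: "\<psi> (\<phi> a) = a" if "a \<in> carrier A" for a
    unfolding \<psi>_def by (rule inv_into_f_f[OF \<phi>_inj that])
  \<comment> \<open>The default value 0 makes \<open>f t\<close> total. It is harmless, as vanishing
    on a relation is claimed only for \<open>t\<close> divisible enough to clear the denominators of
    all elements of \<open>R\<close> occurring in it.\<close>
  define f where "f t = (\<lambda>(x, r). if r \<otimes>\<^bsub>R\<^esub> \<phi> t \<in> \<phi> ` carrier A then \<psi> (r \<otimes>\<^bsub>R\<^esub> \<phi> t) \<odot>\<^bsub>N\<^esub> x else \<zero>\<^bsub>N\<^esub>)" for t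
  have "\<exists>h. h \<in> hom FN (add_monoid N) \<and> (\<forall>p\<in>carrier N \<times> carrier R. h (frag_of p) = f t p)" for t
  proof -
    have "f t ` (carrier N \<times> carrier R) \<subseteq> carrier (add_monoid N)"
      by (auto simp: f_def \<psi> N_simps)
    from comm_group.free_Abelian_group_universal[OF N.a_comm_group this]
    show ?thesis unfolding FN_def by metis
  qed
  then obtain h where h: "\<And>t. h t \<in> hom FN (add_monoid N)"
      "\<And>t p. p \<in> carrier N \<times> carrier R \<Longrightarrow> h t (frag_of p) = f t p"
    by metis
  have h_add: "h t (c + d) = h t c \<oplus>\<^bsub>N\<^esub> h t d"
    if "Poly_Mapping.keys c \<subseteq> carrier N \<times> carrier R" "Poly_Mapping.keys d \<subseteq> carrier N \<times> carrier R" for t c d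
    using hom_mult[OF h(1), of c d t] that by (simp add: FN_def)
  have h_closed: "h t c \<in> carrier N" if "Poly_Mapping.keys c \<subseteq> carrier N \<times> carrier R" for t c
    using hom_in_carrier[OF h(1), of c t] that by (simp add: FN_def)
  have h_diff: "h t (c - d) = h t c \<ominus>\<^bsub>N\<^esub> h t d"
    if cd: "Poly_Mapping.keys c \<subseteq> carrier N \<times> carrier R" "Poly_Mapping.keys d \<subseteq> carrier N \<times> carrier R" for t c d
  proof -
    have k: "Poly_Mapping.keys (c - d) \<subseteq> carrier N \<times> carrier R"
      using keys_diff[of c d] cd by blast
    have "h t (c - d) \<oplus>\<^bsub>N\<^esub> h t d = h t c"
      using h_add[OF k cd(2)] by simp
    then show ?thesis
      using h_closed[OF k] h_closed[OF cd(1)] h_closed[OF cd(2)]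
      by (metis N.add.inv_solve_right' N.minus_eq)
  qed
  have h_zero: "h t 0 = \<zero>\<^bsub>N\<^esub>" for t
    using h_diff[of 0 0 t] h_closed[of 0 t] by (simp add: N.minus_eq N.r_neg)
  have h_frag: "h t (frag_of (x, r)) = a \<odot>\<^bsub>N\<^esub> x"
    if "x \<in> carrier N" "r \<in> carrier R" "a \<in> carrier A" "r \<otimes>\<^bsub>R\<^esub> \<phi> t = \<phi> a" for t x r a
    using that h(2)[of "(x, r)" t] by (simp add: f_def \<psi>)
  \<comment> \<open>Sufficiently divisible means: for all multiples in \<open>S\<close> of some
    fixed element of \<open>S\<close>. Such conditions for two relations combine via a common
    multiple, so they pass from the generators to the subgroup.\<close>
  have gen: "Poly_Mapping.keys c \<subseteq> carrier N \<times> carrier R \<and>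
      (\<exists>s\<in>S. \<forall>b\<in>carrier A. s \<otimes> b \<in> S \<longrightarrow> h (s \<otimes> b) c = \<zero>\<^bsub>N\<^esub>)" (is "?K c \<and> ?E c")
    if c: "c \<in> generators N" for c
  proof -
    have K: "?K c"
      using subsetD[OF generators_subset[OF N] c] by simp
    show ?thesis
      using c
    proof (elim UnE CollectE exE conjE)
      fix x y u assume c: "c = frag_of (x \<oplus>\<^bsub>N\<^esub> y, u) - frag_of (x, u) - frag_of (y, u)"
        and x: "x \<in> carrier N" and y: "y \<in> carrier N" and u: "u \<in> carrier M"
      obtain s where s: "s \<in> S" "\<And>b. b \<in> carrier A \<Longrightarrow> s \<otimes> b \<in> S \<Longrightarrow> u \<otimes>\<^bsub>R\<^esub> \<phi> (s \<otimes> b) \<in> \<phi> ` carrier A"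
        using denominator[of u] u by auto
      have "h (s \<otimes> b) c = \<zero>\<^bsub>N\<^esub>" if b: "b \<in> carrier A" "s \<otimes> b \<in> S" for b
      proof -
        obtain a where a: "a \<in> carrier A" "u \<otimes>\<^bsub>R\<^esub> \<phi> (s \<otimes> b) = \<phi> a"
          using s(2)[OF b] by blast
        have "h (s \<otimes> b) c = a \<odot>\<^bsub>N\<^esub> (x \<oplus>\<^bsub>N\<^esub> y) \<ominus>\<^bsub>N\<^esub> a \<odot>\<^bsub>N\<^esub> x \<ominus>\<^bsub>N\<^esub> a \<odot>\<^bsub>N\<^esub> y"
          unfolding c using x y u a keys_frag_diff2(1)[of _ "carrier N \<times> carrier R"]
          by (simp add: h_diff h_frag[OF _ _ a])
        also have "\<dots> = \<zero>\<^bsub>N\<^esub>"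
          using right_module.smult_r_distr[OF N a(1) x y] N_simps[OF a(1) x] N_simps[OF a(1) y]
          by (simp add: cancel)
        finally show ?thesis .
      qed
      then show ?thesis using K s(1) by blast
    next
      fix x u v assume c: "c = frag_of (x, u \<oplus>\<^bsub>M\<^esub> v) - frag_of (x, u) - frag_of (x, v)"
        and x: "x \<in> carrier N" and u: "u \<in> carrier M" and v: "v \<in> carrier M"
      obtain s where s: "s \<in> S" "\<And>b. b \<in> carrier A \<Longrightarrow> s \<otimes> b \<in> S \<Longrightarrow> u \<otimes>\<^bsub>R\<^esub> \<phi> (s \<otimes> b) \<in> \<phi> ` carrier A"
        using denominator[of u] u by auto
      obtain t where t: "t \<in> S" "\<And>b. b \<in> carrier A \<Longrightarrow> t \<otimes> b \<in> S \<Longrightarrow> v \<otimes>\<^bsub>R\<^esub> \<phi> (t \<otimes> b) \<in> \<phi> ` carrier A"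
        using denominator[of v] v by auto
      obtain d e where d: "d \<in> S" "e \<in> carrier A" "s \<otimes> d = t \<otimes> e" "s \<otimes> d \<in> S"
        using common_multiple[OF s(1) t(1)] .
      have "h (s \<otimes> d \<otimes> b) c = \<zero>\<^bsub>N\<^esub>" if b: "b \<in> carrier A" "s \<otimes> d \<otimes> b \<in> S" for b
      proof -
        have eq: "s \<otimes> (d \<otimes> b) = s \<otimes> d \<otimes> b" "t \<otimes> (e \<otimes> b) = s \<otimes> d \<otimes> b"
          using b d S_closed s(1) t(1) by (simp_all add: m_assoc[symmetric])
        obtain a where a: "a \<in> carrier A" "u \<otimes>\<^bsub>R\<^esub> \<phi> (s \<otimes> d \<otimes> b) = \<phi> a"
          using s(2)[of "d \<otimes> b"] b S_closed[OF d(1)] eq(1) by auto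
        obtain a' where a': "a' \<in> carrier A" "v \<otimes>\<^bsub>R\<^esub> \<phi> (s \<otimes> d \<otimes> b) = \<phi> a'"
          using t(2)[of "e \<otimes> b"] b d(2) eq(2) by auto
        have a'': "(u \<oplus>\<^bsub>R\<^esub> v) \<otimes>\<^bsub>R\<^esub> \<phi> (s \<otimes> d \<otimes> b) = \<phi> (a \<oplus> a')" "a \<oplus> a' \<in> carrier A"
          using u v a a' \<phi>_closed[OF S_closed[OF b(2)]] by (simp_all add: R.l_distr \<phi>_add)
        have "h (s \<otimes> d \<otimes> b) c = (a \<oplus> a') \<odot>\<^bsub>N\<^esub> x \<ominus>\<^bsub>N\<^esub> a \<odot>\<^bsub>N\<^esub> x \<ominus>\<^bsub>N\<^esub> a' \<odot>\<^bsub>N\<^esub> x"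
          unfolding c using x u v keys_frag_diff2(1)[of _ "carrier N \<times> carrier R"]
          by (simp add: h_diff h_frag[OF _ _ a] h_frag[OF _ _ a'] h_frag[OF _ _ a''(2,1)])
        also have "\<dots> = \<zero>\<^bsub>N\<^esub>"
          using right_module.smult_l_distr[OF N a(1) a'(1) x] N_simps[OF a(1) x] N_simps[OF a'(1) x]
          by (simp add: cancel)
        finally show ?thesis .
      qed
      then show ?thesis using K d(4) by blast
    next
      fix a x u assume c: "c = frag_of (a \<odot>\<^bsub>N\<^esub> x, u) - frag_of (x, a \<odot>\<^bsub>M\<^esub> u)"
        and a: "a \<in> carrier A" and x: "x \<in> carrier N" and u: "u \<in> carrier M"
      obtain s where s: "s \<in> S" "\<And>b. b \<in> carrier A \<Longrightarrow> s \<otimes> b \<in> S \<Longrightarrow> u \<otimes>\<^bsub>R\<^esub> \<phi> (s \<otimes> b) \<in> \<phi> ` carrier A"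
        using denominator[of u] u by auto
      have "h (s \<otimes> b) c = \<zero>\<^bsub>N\<^esub>" if b: "b \<in> carrier A" "s \<otimes> b \<in> S" for b
      proof -
        obtain d where d: "d \<in> carrier A" "u \<otimes>\<^bsub>R\<^esub> \<phi> (s \<otimes> b) = \<phi> d"
          using s(2)[OF b] by blast
        have ad: "(\<phi> a \<otimes>\<^bsub>R\<^esub> u) \<otimes>\<^bsub>R\<^esub> \<phi> (s \<otimes> b) = \<phi> (a \<otimes> d)" "a \<otimes> d \<in> carrier A"
          using a d u \<phi>_closed[OF a] \<phi>_closed[OF S_closed[OF b(2)]] by (simp_all add: R.m_assoc \<phi>_mult)
        have "h (s \<otimes> b) c = d \<odot>\<^bsub>N\<^esub> (a \<odot>\<^bsub>N\<^esub> x) \<ominus>\<^bsub>N\<^esub> (a \<otimes> d) \<odot>\<^bsub>N\<^esub> x"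
          unfolding c using x u a \<phi>_closed[OF a] N_simps[OF a x]
          by (simp add: h_diff h_frag[OF _ _ d] h_frag[OF _ _ ad(2,1)])
        also have "\<dots> = \<zero>\<^bsub>N\<^esub>"
          using right_module.smult_assoc[OF N a d(1) x] N_simps[OF d(1) N_simps[OF a x]]
          by (simp add: N.minus_eq N.r_neg)
        finally show ?thesis .
      qed
      then show ?thesis using K s(1) by blast
    qed
  qed
  have "?K c \<and> ?E c" if "c \<in> relations N" for c
    using that unfolding tensor_relations_def
  proof (induction c rule: generate.induct)
    case one
    then show ?case using one_S by (auto simp: h_zero)
  next
    case (incl c)
    then show ?case by (rule gen)
  next
    case (inv c)
    then have c: "?K c" "?E c"
      using gen[OF inv] by blast+
    have "h t (- c) = \<zero>\<^bsub>N\<^esub>" if "h t c = \<zero>\<^bsub>N\<^esub>" for t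
      using h_diff[OF _ c(1), of 0 t] that by (simp add: h_zero N.minus_eq)
    then have "?E (- c)"
      using c(2) by blast
    then show ?case
      using c(1) by simp
  next
    case (eng c d)
    then obtain s t where s: "s \<in> S" "\<And>b. b \<in> carrier A \<Longrightarrow> s \<otimes> b \<in> S \<Longrightarrow> h (s \<otimes> b) c = \<zero>\<^bsub>N\<^esub>"
      and t: "t \<in> S" "\<And>b. b \<in> carrier A \<Longrightarrow> t \<otimes> b \<in> S \<Longrightarrow> h (t \<otimes> b) d = \<zero>\<^bsub>N\<^esub>"
      and K: "?K c" "?K d"
      by blast
    obtain b e where b: "b \<in> S" "e \<in> carrier A" "s \<otimes> b = t \<otimes> e" "s \<otimes> b \<in> S"
      using common_multiple[OF s(1) t(1)] .
    have "h (s \<otimes> b \<otimes> a) (c + d) = \<zero>\<^bsub>N\<^esub>" if a: "a \<in> carrier A" "s \<otimes> b \<otimes> a \<in> S" for a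
    proof -
      have eq: "s \<otimes> (b \<otimes> a) = s \<otimes> b \<otimes> a" "t \<otimes> (e \<otimes> a) = s \<otimes> b \<otimes> a"
        using a b S_closed s(1) t(1) by (simp_all add: m_assoc[symmetric])
      have "h (s \<otimes> b \<otimes> a) c = \<zero>\<^bsub>N\<^esub>" "h (s \<otimes> b \<otimes> a) d = \<zero>\<^bsub>N\<^esub>"
        using s(2)[of "b \<otimes> a"] t(2)[of "e \<otimes> a"] a b(2) S_closed[OF b(1)] eq by simp_all
      then show ?thesis
        using h_add[OF K] by simp
    qed
    moreover have "?K (c + d)"
      using keys_add[of c d] K by blast
    ultimately show ?case using b(4) by auto
  qed
  then obtain t where t: "t \<in> S" "\<And>b. b \<in> carrier A \<Longrightarrow> t \<otimes> b \<in> S \<Longrightarrow> h (t \<otimes> b) (frag_of (y, inv\<phi> s)) = \<zero>\<^bsub>N\<^esub>"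
    using rel by blast
  \<comment> \<open>At a common multiple of \<open>t\<close> and \<open>s\<close>, written s e, the
    homomorphism sends the elementary tensor of \<open>y\<close> and the inverse of \<open>s\<close>
    to the product of \<open>y\<close> with \<open>e\<close>, which must therefore vanish.\<close>
  obtain b e where b: "b \<in> S" "e \<in> carrier A" "t \<otimes> b = s \<otimes> e" "t \<otimes> b \<in> S"
    using common_multiple[OF t(1) s] .
  note cl = inv\<phi>_closed[OF s] \<phi>_closed[OF S_closed[OF s]] \<phi>_closed[OF b(2)]
  have "inv\<phi> s \<otimes>\<^bsub>R\<^esub> \<phi> (t \<otimes> b) = (inv\<phi> s \<otimes>\<^bsub>R\<^esub> \<phi> s) \<otimes>\<^bsub>R\<^esub> \<phi> e"
    unfolding b(3) using cl by (simp add: \<phi>_mult[OF S_closed[OF s] b(2)] R.m_assoc)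
  then have "inv\<phi> s \<otimes>\<^bsub>R\<^esub> \<phi> (t \<otimes> b) = \<phi> e"
    using cl inv\<phi>_l[OF s] by simp
  then have ey: "e \<odot>\<^bsub>N\<^esub> y = \<zero>\<^bsub>N\<^esub>"
    using h_frag[OF y cl(1) b(2)] t(2)[OF S_closed[OF b(1)] b(4)] by simp
  text \<open>Since \<open>s e \<in> S\<close>, the element \<open>e\<close> becomes a unit in \<open>R\<close>, hence divides an element of \<open>S\<close>.\<close>
  obtain a u where a: "a \<in> carrier A" "u \<in> S" "inv\<phi> (s \<otimes> e) \<otimes>\<^bsub>R\<^esub> \<phi> s = \<phi> a \<otimes>\<^bsub>R\<^esub> inv\<phi> u"
    using fraction[of "inv\<phi> (s \<otimes> e) \<otimes>\<^bsub>R\<^esub> \<phi> s"] inv\<phi>_closed b(3,4) cl by auto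
  have se: "s \<otimes> e \<in> S" using b(3,4) by simp
  note cl = cl inv\<phi>_closed[OF se] \<phi>_closed[OF a(1)] inv\<phi>_closed[OF a(2)] \<phi>_closed[OF S_closed[OF a(2)]]
  have "inv\<phi> s \<otimes>\<^bsub>R\<^esub> \<phi> s = \<phi> e \<otimes>\<^bsub>R\<^esub> (inv\<phi> (s \<otimes> e) \<otimes>\<^bsub>R\<^esub> \<phi> s)"
    using inv\<phi>_eq[OF s b(2) se] cl by (simp add: R.m_assoc)
  then have "\<one>\<^bsub>R\<^esub> = \<phi> e \<otimes>\<^bsub>R\<^esub> (\<phi> a \<otimes>\<^bsub>R\<^esub> inv\<phi> u)"
    using a(3) inv\<phi>_l[OF s] by simp
  then have "\<phi> u = \<phi> e \<otimes>\<^bsub>R\<^esub> (\<phi> a \<otimes>\<^bsub>R\<^esub> inv\<phi> u) \<otimes>\<^bsub>R\<^esub> \<phi> u"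
    by (metis R.l_one cl(7))
  also have "\<dots> = \<phi> (e \<otimes> a)"
    using cl inv\<phi>_l[OF a(2)] a(1) b(2) by (simp add: R.m_assoc \<phi>_mult)
  finally have "u = e \<otimes> a"
    using inj_onD[OF \<phi>_inj] S_closed[OF a(2)] a(1) b(2) by blast
  then have "u \<odot>\<^bsub>N\<^esub> y = \<zero>\<^bsub>N\<^esub>"
    using right_module.smult_assoc[OF N b(2) a(1) y] ey right_moduleD(4)[OF N a(1)] by simp
  then show ?thesis using a(2) by blast
qed

section \<open>Induced maps on representatives\<close>

definition tensor_lift :: "('p \<Rightarrow> 'q) \<Rightarrow> ('p \<times> 'r \<Rightarrow>\<^sub>0 int) \<Rightarrow> ('q \<times> 'r \<Rightarrow>\<^sub>0 int)"
  where "tensor_lift f = frag_extend (\<lambda>(x, u). frag_of (f x, u))"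

lemma tensor_lift_simps:
  "tensor_lift f 0 = 0"
  "tensor_lift f (- c) = - tensor_lift f c"
  "tensor_lift f (c + d) = tensor_lift f c + tensor_lift f d"
  "tensor_lift f (c - d) = tensor_lift f c - tensor_lift f d"
  "tensor_lift f (frag_of (x, u)) = frag_of (f x, u)"
  by (simp_all add: tensor_lift_def frag_extend_minus frag_extend_add frag_extend_diff)

text \<open>Additivity and linearity of \<open>f\<close> carry each of the three kinds of generators
  to a generator of the same kind.\<close>

lemma tensor_lift_relations:
  assumes P: "right_module A P" and Q: "right_module A Q" and f: "f \<in> right_module_hom A P Q"
    and c: "c \<in> relations P"
  shows "tensor_lift f c \<in> relations Q"
proof -
  have f_simps: "f x \<in> carrier Q" "f (x \<oplus>\<^bsub>P\<^esub> y) = f x \<oplus>\<^bsub>Q\<^esub> f y" "a \<in> carrier A \<Longrightarrow> f (a \<odot>\<^bsub>P\<^esub> x) = a \<odot>\<^bsub>Q\<^esub> f x"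
    if "x \<in> carrier P" "y \<in> carrier P" for x y a
    using f that by (auto simp: right_module_hom_def)
  have gen: "tensor_lift f c \<in> relations Q" if c: "c \<in> generators P" for c
  proof (rule relations_incl)
    show "tensor_lift f c \<in> generators Q"
      using c
    proof (elim UnE CollectE exE conjE)
      fix x y u assume "c = frag_of (x \<oplus>\<^bsub>P\<^esub> y, u) - frag_of (x, u) - frag_of (y, u)"
        and x: "x \<in> carrier P" and y: "y \<in> carrier P" and u: "u \<in> carrier M"
      then have "tensor_lift f c = frag_of (f x \<oplus>\<^bsub>Q\<^esub> f y, u) - frag_of (f x, u) - frag_of (f y, u)"
        by (simp add: tensor_lift_simps f_simps)
      then show ?thesis
        using f_simps(1)[OF x x] f_simps(1)[OF y y] u by blast
    next
      fix x u v assume "c = frag_of (x, u \<oplus>\<^bsub>M\<^esub> v) - frag_of (x, u) - frag_of (x, v)"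
        and x: "x \<in> carrier P" and u: "u \<in> carrier M" and v: "v \<in> carrier M"
      then have "tensor_lift f c = frag_of (f x, u \<oplus>\<^bsub>M\<^esub> v) - frag_of (f x, u) - frag_of (f x, v)"
        by (simp only: tensor_lift_simps)
      then show ?thesis
        using f_simps(1)[OF x x] u v by blast
    next
      fix a x u assume c: "c = frag_of (a \<odot>\<^bsub>P\<^esub> x, u) - frag_of (x, a \<odot>\<^bsub>M\<^esub> u)"
        and a: "a \<in> carrier A" and x: "x \<in> carrier P" and u: "u \<in> carrier M"
      have "tensor_lift f c = frag_of (a \<odot>\<^bsub>Q\<^esub> f x, u) - frag_of (f x, a \<odot>\<^bsub>M\<^esub> u)"
        unfolding c by (simp only: tensor_lift_simps f_simps(3)[OF x x a])
      then show ?thesis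
        using f_simps(1)[OF x x] a u by blast
    qed
  qed
  show ?thesis
    using c unfolding tensor_relations_def[of A P]
  proof (induction c rule: generate.induct)
    case one
    then show ?case by (simp add: tensor_lift_simps relations_zero)
  next
    case (incl c)
    then show ?case by (rule gen)
  next
    case (inv c)
    have "Poly_Mapping.keys c \<subseteq> carrier P \<times> carrier M"
      using subsetD[OF generators_subset[OF P] inv] by simp
    then show ?case
      using relations_minus[OF Q gen[OF inv]] by (simp add: tensor_lift_simps)
  next
    case (eng c d)
    then show ?case by (simp add: tensor_lift_simps relations_add)
  qed
qed

text \<open>Modulo relations \<open>c\<close> is elementary, with left factor \<open>x\<close>. If
  its image vanishes, some \<open>t\<close> in \<open>S\<close> kills f x, hence kills
  \<open>x\<close> by injectivity, and then the elementary tensor vanishes already over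
  \<open>P\<close>.\<close>

lemma tensor_lift_relations_iff:
  assumes P: "right_module A P" and Q: "right_module A Q" and f: "f \<in> right_module_hom A P Q"
    and inj: "inj_on f (carrier P)"
    and c: "Poly_Mapping.keys c \<subseteq> carrier P \<times> carrier R" and rel: "tensor_lift f c \<in> relations Q"
  shows "c \<in> relations P"
proof -
  interpret P: abelian_group P by (rule right_moduleD(1)[OF P])
  interpret Q: abelian_group Q by (rule right_moduleD(1)[OF Q])
  obtain x s where x: "x \<in> carrier P" and s: "s \<in> S" and cx: "c - frag_of (x, inv\<phi> s) \<in> relations P"
    using tensor_is_elementary[OF P c] by blast
  have fx: "f x \<in> carrier Q"
    using f x by (auto simp: right_module_hom_def)
  have "tensor_lift f c - tensor_lift f (c - frag_of (x, inv\<phi> s)) \<in> relations Q"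
    by (rule relations_diff[OF Q rel tensor_lift_relations[OF P Q f cx]])
  then have "frag_of (f x, inv\<phi> s) \<in> relations Q"
    by (simp add: tensor_lift_simps)
  then obtain t where t: "t \<in> S" "t \<odot>\<^bsub>Q\<^esub> f x = \<zero>\<^bsub>Q\<^esub>"
    using elementary_tensor_eq_zero[OF Q fx s] by blast
  have tx: "t \<odot>\<^bsub>P\<^esub> x \<in> carrier P"
    by (rule right_moduleD(2)[OF P S_closed[OF t(1)] x])
  have add: "f (y \<oplus>\<^bsub>P\<^esub> z) = f y \<oplus>\<^bsub>Q\<^esub> f z" "f y \<in> carrier Q" if "y \<in> carrier P" "z \<in> carrier P" for y z
    using f that by (auto simp: right_module_hom_def)
  have f0: "f \<zero>\<^bsub>P\<^esub> = \<zero>\<^bsub>Q\<^esub>"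
    using add[OF P.zero_closed P.zero_closed] by (metis P.l_zero P.zero_closed Q.add.r_cancel_one')
  have "f (t \<odot>\<^bsub>P\<^esub> x) = \<zero>\<^bsub>Q\<^esub>"
    using f x S_closed[OF t(1)] t(2) by (simp add: right_module_hom_def)
  then have "t \<odot>\<^bsub>P\<^esub> x = \<zero>\<^bsub>P\<^esub>"
    using f0 inj_onD[OF inj _ tx P.zero_closed] by simp
  then have "frag_of (x, inv\<phi> s) \<in> relations P"
    by (rule torsion_relation[OF P x inv\<phi>_closed[OF s] t(1)])
  from relations_add[OF cx this] show ?thesis by simp
qed

section \<open>Tensor products as quotients, and flatness\<close>

abbreviation tensor_class :: "('a, 'n, 'd) module_scheme \<Rightarrow> ('n \<times> 'r \<Rightarrow>\<^sub>0 int) \<Rightarrow> ('n \<times> 'r \<Rightarrow>\<^sub>0 int) set"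
  where "tensor_class N c \<equiv> relations N #>\<^bsub>free_Abelian_group (carrier N \<times> carrier M)\<^esub> c"

lemma tensor_class_eq: "tensor_class N c = {d + c | d. d \<in> relations N}"
  by (auto simp: r_coset_def)

lemma tensor_class_eq_iff:
  assumes N: "right_module A N"
  shows "tensor_class N c = tensor_class N d \<longleftrightarrow> c - d \<in> relations N"
proof
  assume eq: "tensor_class N c = tensor_class N d"
  have "c \<in> tensor_class N c"
    unfolding tensor_class_eq using relations_zero[of N] by force
  then obtain e where "e \<in> relations N" "c = e + d"
    unfolding eq unfolding tensor_class_eq by blast
  then show "c - d \<in> relations N" by simp
next
  assume cd: "c - d \<in> relations N"
  have "e + c = (e + (c - d)) + d" "e + d = (e - (c - d)) + c" for e
    by simp_all
  moreover have "e + (c - d) \<in> relations N" "e - (c - d) \<in> relations N" if "e \<in> relations N" for e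
    using relations_add[OF that cd] relations_diff[OF N that cd] by auto
  ultimately show "tensor_class N c = tensor_class N d"
    unfolding tensor_class_eq by blast
qed

lemma carrier_tensor_product:
  "carrier (tensor_product A N M) = {tensor_class N c | c. Poly_Mapping.keys c \<subseteq> carrier N \<times> carrier R}"
  by (auto simp: tensor_product_def FactGroup_def RCOSETS_def)

lemma one_tensor_product: "\<one>\<^bsub>tensor_product A N M\<^esub> = relations N"
  by (simp add: tensor_product_def FactGroup_def)

text \<open>All representatives of a class have images in one class, so the set inside
  \<open>the_elem\<close> is a singleton.\<close>

lemma tensor_map_class:
  assumes P: "right_module A P" and Q: "right_module A Q" and f: "f \<in> right_module_hom A P Q"
  shows "tensor_map A Q M f (tensor_class P c) = tensor_class Q (tensor_lift f c)"
proof -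
  have "(\<lambda>c. tensor_class Q (tensor_lift f c)) ` tensor_class P c = {tensor_class Q (tensor_lift f c)}"
  proof (intro equalityI subsetI)
    fix X assume "X \<in> (\<lambda>c. tensor_class Q (tensor_lift f c)) ` tensor_class P c"
    then obtain d where d: "d \<in> relations P" "X = tensor_class Q (tensor_lift f (d + c))"
      unfolding tensor_class_eq[of P] by blast
    then show "X \<in> {tensor_class Q (tensor_lift f c)}"
      using tensor_lift_relations[OF P Q f d(1)]
      by (simp add: tensor_class_eq_iff[OF Q] tensor_lift_simps del: M_simps)
  next
    fix X assume "X \<in> {tensor_class Q (tensor_lift f c)}"
    moreover have "c \<in> tensor_class P c"
      unfolding tensor_class_eq using relations_zero[of P] by force
    ultimately show "X \<in> (\<lambda>c. tensor_class Q (tensor_lift f c)) ` tensor_class P c"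
      by blast
  qed
  then show ?thesis
    unfolding tensor_map_def tensor_lift_def by simp
qed

theorem flat_M: "flat_left_module TYPE('p) TYPE('q) A M"
  unfolding flat_left_module_def
proof (intro conjI allI impI left_module_M, elim conjE)
  fix P :: "('a, 'p) module" and Q :: "('a, 'q) module" and f
  assume P: "right_module A P" and Q: "right_module A Q" and f: "f \<in> right_module_hom A P Q"
    and inj: "inj_on f (carrier P)"
  show "inj_on (tensor_map A Q M f) (carrier (tensor_product A P M))"
  proof (rule inj_onI)
    fix X Y assume "X \<in> carrier (tensor_product A P M)" "Y \<in> carrier (tensor_product A P M)"
      and eq: "tensor_map A Q M f X = tensor_map A Q M f Y"
    then obtain c d where c: "Poly_Mapping.keys c \<subseteq> carrier P \<times> carrier R" "X = tensor_class P c"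
      and d: "Poly_Mapping.keys d \<subseteq> carrier P \<times> carrier R" "Y = tensor_class P d"
      unfolding carrier_tensor_product by blast
    have "tensor_lift f (c - d) \<in> relations Q"
      using eq unfolding c d tensor_map_class[OF P Q f] tensor_class_eq_iff[OF Q]
      by (simp add: tensor_lift_simps)
    moreover have "Poly_Mapping.keys (c - d) \<subseteq> carrier P \<times> carrier R"
      using keys_diff[of c d] c(1) d(1) by blast
    ultimately have "c - d \<in> relations P"
      by (intro tensor_lift_relations_iff[OF P Q f inj])
    then show "X = Y"
      unfolding c d tensor_class_eq_iff[OF P] .
  qed
qed

text \<open>A single \<open>l\<close> in \<open>S\<close> annihilating the whole module makes every
  generator of the free Abelian group a relation.\<close>

theorem tensor_product_torsion_trivial:
  fixes N :: "('a, 'd, 'e) module_scheme"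
  assumes N: "right_module A N" and l: "l \<in> S" "\<And>x. x \<in> carrier N \<Longrightarrow> l \<odot>\<^bsub>N\<^esub> x = \<zero>\<^bsub>N\<^esub>"
  shows "carrier (tensor_product A N M) = {\<one>\<^bsub>tensor_product A N M\<^esub>}"
proof -
  have "c \<in> relations N" if "Poly_Mapping.keys c \<subseteq> carrier N \<times> carrier R" for c
    using that
  proof (induction c rule: frag_induction)
    case (one p)
    then show ?case
      using torsion_relation[OF N _ _ l(1) l(2)] by (cases p) simp
  qed (auto simp: relations_zero relations_diff[OF N])
  then have "tensor_class N c = tensor_class N 0" if "Poly_Mapping.keys c \<subseteq> carrier N \<times> carrier R" for c
    using that unfolding tensor_class_eq_iff[OF N] by simp
  moreover have "tensor_class N 0 = relations N"
    unfolding tensor_class_eq by simp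
  moreover have "Poly_Mapping.keys (0 :: 'd \<times> 'r \<Rightarrow>\<^sub>0 int) \<subseteq> carrier N \<times> carrier R"
    by simp
  ultimately have "carrier (tensor_product A N M) = {relations N}"
    unfolding carrier_tensor_product by blast
  then show ?thesis
    by (simp add: one_tensor_product)
qed

end

section \<open>The augmentation\<close>

context group
begin

definition augmentation :: "('a \<Rightarrow>\<^sub>0 int) \<Rightarrow> int"
  where "augmentation x = (\<Sum>g\<in>Poly_Mapping.keys x. Poly_Mapping.lookup x g)"

text \<open>The augmentation is induced by the map from \<open>G\<close> to a one-point set, here
  the unit type; its additivity is then that of \<open>frag_extend\<close>.\<close>

lemma augmentation_eq_lookup:
  "augmentation x = Poly_Mapping.lookup (frag_extend (\<lambda>_. frag_of ()) x) ()"
  by (simp add: augmentation_def frag_extend_def lookup_sum)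

lemma augmentation_simps [simp]:
  "augmentation 0 = 0"
  "augmentation (frag_of g) = 1"
  "augmentation (x - y) = augmentation x - augmentation y"
  "augmentation (- x) = - augmentation x"
  "augmentation (x + y) = augmentation x + augmentation y"
  by (simp_all add: augmentation_eq_lookup frag_extend_diff frag_extend_minus frag_extend_add
      lookup_minus lookup_add)

lemma augmentation_mult: "augmentation (x \<star> y) = augmentation x * augmentation y"
  using subset_UNIV[of "Poly_Mapping.keys x"]
proof (induction x rule: frag_induction)
  case (one g)
  show ?case
    using subset_UNIV[of "Poly_Mapping.keys y"]
    by (induction y rule: frag_induction) (simp_all add: group_ring_diff_right)
qed (simp_all add: group_ring_diff_left left_diff_distrib)

text \<open>An element acts as multiplication by its augmentation, which is multiplicative with
  commutative values, so the reversed order in the right module law is respected.\<close>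

lemma right_module_trivial: "right_module (group_ring G) trivial_module"
proof (intro right_module.intro right_module_axioms.intro)
  show "ring (group_ring G)" by (rule ring_group_ring)
  show "abelian_group trivial_module"
  proof (rule abelian_groupI)
    fix n assume "n \<in> carrier trivial_module"
    show "\<exists>m\<in>carrier trivial_module. m \<oplus>\<^bsub>trivial_module\<^esub> n = \<zero>\<^bsub>trivial_module\<^esub>"
      by (auto simp: trivial_module_def intro: exI[of _ "- n"])
  qed (simp_all add: trivial_module_def)
qed (simp_all add: trivial_module_def augmentation_mult distrib_left distrib_right
    flip: augmentation_def)

end

context group_subgroup
begin

text \<open>The augmentation ideal \<open>J\<close> is non-zero as \<open>H\<close> is non-trivial,
  and its left annihilator \<open>L\<close> satisfies L J = 0. Primeness gives L = 0, which is the
  hypothesis for finding a regular element in \<open>J\<close>.\<close>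

lemma augmentation_zero_regular:
  assumes prime: "prime_ring \<int>H" and acc: "acc_right_annihilators \<int>H" and H: "H \<noteq> {\<one>}"
  shows "\<exists>l\<in>\<Lambda>. augmentation l = 0"
proof -
  interpret ZH: ring "\<int>H" by (rule ring_group_ring_H)
  define J where "J = {x. Poly_Mapping.keys x \<subseteq> H \<and> augmentation x = 0}"
  define L where "L = {y. Poly_Mapping.keys y \<subseteq> H \<and> (\<forall>x\<in>J. y \<star> x = 0)}"
  have uminus: "\<ominus>\<^bsub>\<int>H\<^esub> x = - x" if "Poly_Mapping.keys x \<subseteq> H" for x
    using that by (intro ZH.minus_equality) simp_all
  have J: "ideal J \<int>H"
  proof (rule idealI[OF ZH.ring_axioms ZH.add.subgroupI])
    show "J \<noteq> {}" by (auto simp: J_def intro: exI[of _ 0])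
    show "x \<otimes>\<^bsub>\<int>H\<^esub> a \<in> J" "a \<otimes>\<^bsub>\<int>H\<^esub> x \<in> J" if "a \<in> J" "x \<in> carrier \<int>H" for a x
      using that H_mult_closed[of a x] H_mult_closed[of x a] by (simp_all add: J_def augmentation_mult)
    show "a \<oplus>\<^bsub>\<int>H\<^esub> b \<in> J" if "a \<in> J" "b \<in> J" for a b
      using that keys_add_subset[of a H b] by (simp add: J_def)
    show "\<ominus>\<^bsub>\<int>H\<^esub> a \<in> J" if "a \<in> J" for a
      using that by (simp add: J_def uminus)
  qed (auto simp: J_def)
  have L: "ideal L \<int>H"
  proof (rule idealI[OF ZH.ring_axioms ZH.add.subgroupI])
    show "L \<noteq> {}" by (auto simp: L_def intro: exI[of _ 0])
    fix a x assume a: "a \<in> L" and x: "x \<in> carrier \<int>H"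
    have aH: "Poly_Mapping.keys a \<subseteq> H" "Poly_Mapping.keys x \<subseteq> H"
      using a x by (simp_all add: L_def)
    \<comment> \<open>\<open>L\<close> is also a right ideal because \<open>J\<close> is a left
      ideal: (a x) z = a (x z) with x z again in \<open>J\<close>.\<close>
    have 1: "x \<star> a \<star> z = x \<star> (a \<star> z)" "a \<star> x \<star> z = a \<star> (x \<star> z)" "x \<star> z \<in> J" if "z \<in> J" for z
    proof -
      have zH: "Poly_Mapping.keys z \<subseteq> H" using that by (simp add: J_def)
      show "x \<star> a \<star> z = x \<star> (a \<star> z)" "a \<star> x \<star> z = a \<star> (x \<star> z)"
        by (intro group_ring_assoc keys_H_carrier aH zH)+
      show "x \<star> z \<in> J"
        using that H_mult_closed[OF aH(2) zH] by (simp add: J_def augmentation_mult)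
    qed
    then show "x \<otimes>\<^bsub>\<int>H\<^esub> a \<in> L" "a \<otimes>\<^bsub>\<int>H\<^esub> x \<in> L"
      using a H_mult_closed[OF aH] H_mult_closed[OF aH(2,1)] by (simp_all add: L_def)
  next
    fix a b assume "a \<in> L" "b \<in> L"
    then show "a \<oplus>\<^bsub>\<int>H\<^esub> b \<in> L"
      using keys_add_subset[of a H b] by (simp add: L_def group_ring_add_left)
  next
    fix a assume "a \<in> L"
    then show "\<ominus>\<^bsub>\<int>H\<^esub> a \<in> L"
      by (simp add: L_def uminus group_ring_minus_left)
  qed (auto simp: L_def)
  have "x = 0" if "x \<in> L \<cdot>\<^bsub>\<int>H\<^esub> J" for x
    using that by (induction rule: ideal_prod.induct) (simp_all add: L_def)
  moreover have "0 \<in> L \<cdot>\<^bsub>\<int>H\<^esub> J"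
    using ideal_prod.prod[of 0 L 0 J "\<int>H"] by (simp add: L_def J_def)
  ultimately have "L \<cdot>\<^bsub>\<int>H\<^esub> J = {\<zero>\<^bsub>\<int>H\<^esub>}"
    by auto
  then have "L = {0} \<or> J = {0}"
    using prime L J unfolding prime_ring_def by simp
  moreover have "J \<noteq> {0}"
  proof -
    obtain h where h: "h \<in> H" "h \<noteq> \<one>"
      using H subgroup.one_closed[OF subgroup_H] by blast
    have "Poly_Mapping.keys (frag_of h - frag_of \<one>) \<subseteq> H"
      by (rule keys_diff_subset) (use h subgroup.one_closed[OF subgroup_H] in simp_all)
    then have "frag_of h - frag_of \<one> \<in> J"
      by (simp add: J_def)
    moreover have "frag_of h - frag_of \<one> \<noteq> (0 :: 'a \<Rightarrow>\<^sub>0 int)"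
      using h(2) by (simp add: frag_of_eq)
    ultimately show ?thesis by blast
  qed
  ultimately have L0: "L = {0}" by blast
  have "\<exists>l\<in>J. l \<in> \<Lambda>"
  proof (rule right_ideal_contains_regular[OF acc])
    show "y = 0" if "Poly_Mapping.keys y \<subseteq> H" "\<And>x. x \<in> J \<Longrightarrow> y \<star> x = 0" for y
      using that L0 by (auto simp: L_def)
    show "x \<star> a \<in> J" if "x \<in> J" "Poly_Mapping.keys a \<subseteq> H" for x a
      using that H_mult_closed[of x a] by (simp add: J_def augmentation_mult)
    show "x + y \<in> J" if "x \<in> J" "y \<in> J" for x y
      using that keys_add_subset[of x H y] by (simp add: J_def)
  qed (simp_all add: J_def)
  then show ?thesis
    by (auto simp: J_def)
qed

end

theorem lemma3p3:
  fixes G :: "('g, 'b) monoid_scheme" and H :: "'g set"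
  defines "ZG \<equiv> group_ring G"
    and "\<Lambda> \<equiv> nonzerodivisors (group_ring (G\<lparr>carrier := H\<rparr>))"
  assumes "group G" and "subgroup H G"
    and "commensurator G H = carrier G"
    and "prime_ring (group_ring (G\<lparr>carrier := H\<rparr>))"
    and "Goldie_ring (group_ring (G\<lparr>carrier := H\<rparr>))"
  shows "right_Ore_set \<Lambda> ZG \<and>
    (H \<noteq> {\<one>\<^bsub>G\<^esub>} \<longrightarrow>
      (\<exists>(R :: (('g \<Rightarrow>\<^sub>0 int) \<times> ('g \<Rightarrow>\<^sub>0 int)) set ring) \<phi>. right_Ore_localization ZG \<Lambda> R \<phi>) \<and>
      (\<forall>(R :: 'r ring) \<phi>. right_Ore_localization ZG \<Lambda> R \<phi> \<longrightarrow>
         inj_on \<phi> (carrier ZG) \<and>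
         flat_left_module TYPE('p) TYPE('q) ZG (left_module_via \<phi> R) \<and>
         carrier (tensor_product ZG trivial_module (left_module_via \<phi> R)) =
           {\<one>\<^bsub>tensor_product ZG trivial_module (left_module_via \<phi> R)\<^esub>}))"
proof -
  interpret group_subgroup G H
    using assms(3,4) by (simp add: group_subgroup_def group_subgroup_axioms_def)
  have goldie: "right_Goldie \<int>H"
    using assms(7) by (simp add: Goldie_ring_def)
  have Ore: "right_Ore_set \<Lambda> ZG"
    unfolding ZG_def \<Lambda>_def by (rule right_Ore_set_\<Lambda>[OF assms(5) goldie])
  interpret right_Ore ZG \<Lambda>
    unfolding right_Ore_def right_Ore_axioms_def
    using ring_group_ring Ore by (simp add: ZG_def)
  have "inj_on \<phi> (carrier ZG) \<and>
      flat_left_module TYPE('p) TYPE('q) ZG (left_module_via \<phi> R) \<and>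
      carrier (tensor_product ZG trivial_module (left_module_via \<phi> R)) =
        {\<one>\<^bsub>tensor_product ZG trivial_module (left_module_via \<phi> R)\<^esub>}"
    if H: "H \<noteq> {\<one>\<^bsub>G\<^esub>}" and loc: "right_Ore_localization ZG \<Lambda> R \<phi>" for R :: "'r ring" and \<phi>
  proof -
    interpret right_Ore_quotient ZG \<Lambda> R \<phi>
      by unfold_locales (rule loc)
    \<comment> \<open>This \<open>l\<close> acts as zero on the trivial module and becomes a unit in
      \<open>R\<close>, which forces the tensor product to vanish.\<close>
    obtain l where l: "l \<in> \<Lambda>" "augmentation l = 0"
      using augmentation_zero_regular[OF assms(6) _ H] goldie
      by (auto simp: right_Goldie_def \<Lambda>_def)
    have "carrier (tensor_product ZG trivial_module M) = {\<one>\<^bsub>tensor_product ZG trivial_module M\<^esub>}"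
    proof (rule tensor_product_torsion_trivial[OF _ l(1)])
      show "right_module ZG trivial_module"
        unfolding ZG_def by (rule right_module_trivial)
      show "l \<odot>\<^bsub>trivial_module\<^esub> n = \<zero>\<^bsub>trivial_module\<^esub>" for n
        using l(2) by (simp add: trivial_module_def augmentation_def)
    qed
    then show ?thesis
      using \<phi>_inj flat_M by blast
  qed
  then show ?thesis
    using Ore right_Ore_localization_ring_of_fractions by blast
qed

end
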